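(* Let $h_0\in H$ and, for any $t>0$, $t=n\tau$ with $n\in\mathbb N$, $n\ge 1$, let $h_n(t)=(\mathcal J_{t/n})^n[h_0]$ be the approximate solution obtained by the backward Euler scheme with step $\tau=t/n$. Then: (1) There exists a locally Lipschitz curve $h:[0,+\infty)\to H$, $h\in MM(\Phi;h_0)$ (i.e. a minimizing movement for $\Phi$ starting from $h_0$), such that $$h_n(t)\to h(t)\quad\text{in }L^2(\mathbb T)\text{ as }n\to\infty,$$ and $h:[0,+\infty)\to H$ is the unique EVI solution, in the sense that $h$ is unique among all the locally absolutely continuous curves such that $\lim_{t\to0}h(t)=h_0$ in $H$ and $$\frac12\frac{\mathrm d}{\mathrm dt}\|h(t)-v\|^2+\frac{\lambda}{2}\|h(t)-v\|^2\le\phi(v)-\phi(h(t)),\qquad\text{a.e. }t>0,\ \forall v\in D(\phi).$$ (2) The following regularity estimates hold for every $t>0$: $$\phi(h(t))\le\phi(v)+\frac1{2t}\|v-h_0\|^2,\qquad\forall v\in D(\phi),$$ $$|\partial\phi|^2(h(t))\le|\partial\phi|^2(v)+\frac1{t^2}\|v-h_0\|^2,\qquad\forall v\in D(|\partial\phi|).$$ (3) There exists $t_0>0$ such that $h(t)$ decays exponentially: $$\frac{\lambda}{2}\|h(t)-h^*\|^2\le(\phi(h_0)-\phi(h^* ))\,e^{-2\lambda(t-t_0)}\qquad\text{for any }t\ge t_0>0,$$ where $h^*=0$ is the unique minimizer of $\phi$.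
   Context: $\mathbb T$ is the unit interval with periodic boundary conditions. $H=\{u\in L^2(\mathbb T):\int_{\mathbb T}u\,\mathrm dx=0\}$ with the $L^2$-norm $\|\cdot\|$ and distance $\mathrm{dist}(u,v)=\|u-v\|$; $V=\{u\in H^2(\mathbb T):\int_{\mathbb T}u\,\mathrm dx=0\}$. The functional $\phi:H\to[0,+\infty]$ is $$\phi(h)=\int_{\mathbb T}\cosh(h_{xx})\,\mathrm dx\ \text{ if }h\in V,\qquad\phi(h)=+\infty\ \text{ otherwise},$$ and $D(\phi)=\{\phi<+\infty\}$. The constant is $\lambda=(2\pi/L)^4>0$, where $L$ is the period of the domain ($L=1$ for the unit interval). For $\tau>0$ and $h,v\in H$, $\Phi(\tau,h;v)=\phi(v)+\frac1{2\tau}\|h-v\|^2$, and the resolvent is $\mathcal J_\tau[h]=\operatorname{argmin}_{v\in H}\Phi(\tau,h;v)$ (the minimizer exists and is unique). Local slope: for $v\in D(\phi)$, $|\partial\phi|(v)=\limsup_{w\to v}\frac{\max\{\phi(v)-\phi(w),0\}}{\mathrm{dist}(v,w)}$, with $|\partial\phi|(v)=+\infty$ if $v\notin D(\phi)$, and $D(|\partial\phi|)=\{v\in D(\phi):|\partial\phi|(v)<+\infty\}$. Minimizing movement: given a partition $0=t_0<t_1<t_2<\cdots$, $t_n\to\infty$, with steps $\tau_n=t_n-t_{n-1}$, a discrete solution is a sequence $(U^n)_{n\ge0}$ in $H$ with $U^n\in\operatorname{argmin}_{v\in H}\Phi(\tau_n,U^{n-1};v)$ for $n\ge1$, with piecewise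 constant interpolant $\bar U(0)=U^0$, $\bar U(t)=U^n$ for $t\in(t_{n-1},t_n]$. A curve $h:[0,+\infty)\to H$ belongs to $MM(\Phi;h_0)$ if for every partition with sufficiently small mesh size $\sup_n\tau_n$ there is a discrete solution such that, as the mesh size tends to $0$, $\phi(U^0)\to\phi(h_0)$, $\limsup\|U^0-h_0\|<+\infty$, and $\bar U(t)\to h(t)$ in $H$ for every $t\ge0$. (The partition point $t_0=0$ here is unrelated to the time $t_0>0$ in part (3).) "Locally absolutely continuous" means absolutely continuous on compact subintervals of $(0,+\infty)$ with values in $H$.
   Formalization: "Locally Lipschitz on [0,+∞)" is read as Lipschitz on compact subintervals of (0,+∞), together with continuity on [0,+∞) and h(0)=h_0, because Lipschitz continuity up to t=0 fails when |∂φ|(h_0)=+∞ (e.g. h_0 a mean-zero step function). *)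

theory Defs
  imports "HOL-Analysis.Analysis"
begin

text \<open>The torus is the unit interval with periodic boundary conditions. As a measure space it is
  the unit interval; periodicity only enters through the test functions defining weak derivatives.\<close>

definition torus :: "real measure" where
  "torus = lebesgue_on {0..1}"

definition sq_integrable :: "(real \<Rightarrow> real) set" where
  "sq_integrable = {f \<in> borel_measurable torus. integrable torus (\<lambda>x. (f x)\<^sup>2)}"

definition l2_rel :: "(real \<Rightarrow> real) \<Rightarrow> (real \<Rightarrow> real) \<Rightarrow> bool" where
  "l2_rel f g \<longleftrightarrow> f \<in> sq_integrable \<and> g \<in> sq_integrable \<and> (AE x in torus. f x = g x)"

interpretation torus: finite_measure torus
  unfolding torus_def by (rule finite_measure_lebesgue_on) simp

lemma sq_integrable_prod:
  assumes "f \<in> sq_integrable" "g \<in> sq_integrable"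
  shows "integrable torus (\<lambda>x. f x * g x)"
proof (rule Bochner_Integration.integrable_bound)
  show "integrable torus (\<lambda>x. (f x)\<^sup>2 + (g x)\<^sup>2)"
    using assms by (auto simp: sq_integrable_def)
  show "(\<lambda>x. f x * g x) \<in> borel_measurable torus"
    using assms by (auto simp: sq_integrable_def)
  have "\<bar>a * b\<bar> \<le> \<bar>a\<^sup>2 + b\<^sup>2\<bar>" for a b :: real
  proof -
    have "2 * (\<bar>a\<bar> * \<bar>b\<bar>) \<le> a\<^sup>2 + b\<^sup>2"
      using sum_squares_bound[of "\<bar>a\<bar>" "\<bar>b\<bar>"] by simp
    moreover have "0 \<le> \<bar>a\<bar> * \<bar>b\<bar>" by simp
    ultimately show ?thesis unfolding abs_mult by linarith
  qed
  then show "AE x in torus. norm (f x * g x) \<le> norm ((f x)\<^sup>2 + (g x)\<^sup>2)" by simp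
qed

lemma sq_integrable_add:
  assumes "f \<in> sq_integrable" "g \<in> sq_integrable"
  shows "(\<lambda>x. f x + g x) \<in> sq_integrable"
proof -
  have "integrable torus (\<lambda>x. (f x)\<^sup>2 + (g x)\<^sup>2 + 2 * (f x * g x))"
    using assms sq_integrable_prod[OF assms] by (auto simp: sq_integrable_def)
  then have "integrable torus (\<lambda>x. (f x + g x)\<^sup>2)"
    by (simp add: power2_sum mult.assoc)
  then show ?thesis using assms by (auto simp: sq_integrable_def)
qed

lemma sq_integrable_scale: "f \<in> sq_integrable \<Longrightarrow> (\<lambda>x. c * f x) \<in> sq_integrable"
  by (auto simp: sq_integrable_def power_mult_distrib)

lemma sq_integrable_diff:
  "f \<in> sq_integrable \<Longrightarrow> g \<in> sq_integrable \<Longrightarrow> (\<lambda>x. f x - g x) \<in> sq_integrable"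
  using sq_integrable_add[OF _ sq_integrable_scale[of g "-1"], of f] by simp

lemma sq_integrable_const: "(\<lambda>x. c) \<in> sq_integrable"
  by (auto simp: sq_integrable_def)

lemma l2_rel_measurable [measurable_dest]:
  "l2_rel f g \<Longrightarrow> f \<in> borel_measurable torus" "l2_rel f g \<Longrightarrow> g \<in> borel_measurable torus"
  by (auto simp: l2_rel_def sq_integrable_def)

quotient_type l2 = "real \<Rightarrow> real" / partial: l2_rel
proof (rule part_equivpI)
  show "\<exists>f. l2_rel f f" using sq_integrable_const[of 0] by (auto simp: l2_rel_def)
  show "symp l2_rel" by (auto simp: symp_def l2_rel_def)
  show "transp l2_rel" unfolding transp_def l2_rel_def by (auto elim: AE_mp)
qed

lift_definition mean :: "l2 \<Rightarrow> real" is "\<lambda>f. \<integral>x. f x \<partial>torus"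
  by (rule integral_cong_AE) (auto simp: l2_rel_def sq_integrable_def)

instantiation l2 :: real_inner
begin

lift_definition zero_l2 :: l2 is "\<lambda>x. 0"
  by (simp add: l2_rel_def sq_integrable_const)

lift_definition plus_l2 :: "l2 \<Rightarrow> l2 \<Rightarrow> l2" is "\<lambda>f g x. f x + g x"
  by (auto simp: l2_rel_def sq_integrable_add)

lift_definition minus_l2 :: "l2 \<Rightarrow> l2 \<Rightarrow> l2" is "\<lambda>f g x. f x - g x"
  by (auto simp: l2_rel_def sq_integrable_diff)

lift_definition uminus_l2 :: "l2 \<Rightarrow> l2" is "\<lambda>f x. - f x"
  using sq_integrable_scale[of _ "-1"] by (auto simp: l2_rel_def)

lift_definition scaleR_l2 :: "real \<Rightarrow> l2 \<Rightarrow> l2" is "\<lambda>c f x. c * f x"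
  by (auto simp: l2_rel_def sq_integrable_scale)

lift_definition inner_l2 :: "l2 \<Rightarrow> l2 \<Rightarrow> real" is "\<lambda>f g. \<integral>x. f x * g x \<partial>torus"
  by (rule integral_cong_AE) (auto simp: l2_rel_def sq_integrable_def)

definition norm_l2 :: "l2 \<Rightarrow> real" where "norm_l2 u = sqrt (inner u u)"
definition sgn_l2 :: "l2 \<Rightarrow> l2" where "sgn_l2 u = inverse (norm u) *\<^sub>R u"
definition dist_l2 :: "l2 \<Rightarrow> l2 \<Rightarrow> real" where "dist_l2 u v = norm (u - v)"
definition uniformity_l2 :: "(l2 \<times> l2) filter" where
  "uniformity_l2 = (INF e\<in>{0<..}. principal {(x, y). dist x y < e})"
definition open_l2 :: "l2 set \<Rightarrow> bool" where
  "open_l2 S = (\<forall>x\<in>S. \<forall>\<^sub>F (x', y) in uniformity. x' = x \<longrightarrow> y \<in> S)"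

instance
proof
  fix u v w :: l2 and a b :: real
  show "u + v + w = u + (v + w)"
    by transfer (auto simp: l2_rel_def sq_integrable_add add.assoc)
  show "u + v = v + u"
    by transfer (auto simp: l2_rel_def sq_integrable_add add.commute)
  show "0 + u = u"
    by transfer (auto simp: l2_rel_def)
  show "- u + u = 0"
    by transfer (auto simp: l2_rel_def sq_integrable_const)
  show "u - v = u + - v"
    by transfer (auto simp: l2_rel_def sq_integrable_diff)
  show "a *\<^sub>R (u + v) = a *\<^sub>R u + a *\<^sub>R v"
    by transfer (auto simp: l2_rel_def sq_integrable_scale sq_integrable_add distrib_left)
  show "(a + b) *\<^sub>R u = a *\<^sub>R u + b *\<^sub>R u"
    by transfer (auto simp: l2_rel_def sq_integrable_scale sq_integrable_add distrib_right)
  show "a *\<^sub>R b *\<^sub>R u = (a * b) *\<^sub>R u"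
    by transfer (auto simp: l2_rel_def sq_integrable_scale mult.assoc)
  show "1 *\<^sub>R u = u"
    by transfer (auto simp: l2_rel_def)
  show "sgn u = inverse (norm u) *\<^sub>R u" by (rule sgn_l2_def)
  show "dist u v = norm (u - v)" by (rule dist_l2_def)
  show "(uniformity :: (l2 \<times> l2) filter) = (INF e\<in>{0<..}. principal {(x, y). dist x y < e})"
    by (rule uniformity_l2_def)
  show "open S = (\<forall>x\<in>S. \<forall>\<^sub>F (x', y) in uniformity. x' = x \<longrightarrow> y \<in> S)" for S :: "l2 set"
    by (rule open_l2_def)
  show "inner u v = inner v u"
    by transfer (simp add: mult.commute)
  show "inner (u + v) w = inner u w + inner v w"
    by transfer (simp add: l2_rel_def sq_integrable_prod distrib_right)
  show "inner (a *\<^sub>R u) v = a * inner u v"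
    by transfer (simp add: mult.assoc)
  show "0 \<le> inner u u"
    by transfer simp
  show "(inner u u = 0) = (u = 0)"
  proof transfer
    fix f :: "real \<Rightarrow> real" assume f: "l2_rel f f"
    then have "integrable torus (\<lambda>x. f x * f x)"
      by (auto simp: l2_rel_def sq_integrable_prod)
    then have "(\<integral>x. f x * f x \<partial>torus) = 0 \<longleftrightarrow> (AE x in torus. f x * f x = 0)"
      by (rule integral_nonneg_eq_0_iff_AE) simp
    then show "((\<integral>x. f x * f x \<partial>torus) = 0) = l2_rel f (\<lambda>x. 0)"
      using f by (simp add: l2_rel_def sq_integrable_const)
  qed
  show "norm u = sqrt (inner u u)" by (rule norm_l2_def)
qed

end

definition H :: "l2 set" where
  "H = {u. mean u = 0}"

definition test_function :: "(real \<Rightarrow> real) \<Rightarrow> bool" where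
  "test_function \<psi> \<longleftrightarrow> (\<forall>x. \<psi> (x + 1) = \<psi> x) \<and> (\<forall>n x. (deriv ^^ n) \<psi> differentiable (at x))"

lift_definition weak_deriv :: "l2 \<Rightarrow> l2 \<Rightarrow> bool" is
  "\<lambda>u g. \<forall>\<psi>. test_function \<psi> \<longrightarrow>
     (\<integral>x. u x * deriv \<psi> x \<partial>torus) = - (\<integral>x. g x * \<psi> x \<partial>torus)"
proof -
  fix u u' g g' assume uu': "l2_rel u u'" and gg': "l2_rel g g'"
  have "(\<integral>x. u x * deriv \<psi> x \<partial>torus) = (\<integral>x. u' x * deriv \<psi> x \<partial>torus)
      \<and> (\<integral>x. g x * \<psi> x \<partial>torus) = (\<integral>x. g' x * \<psi> x \<partial>torus)"
    if "test_function \<psi>" for \<psi>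
  proof -
    have "(deriv ^^ n) \<psi> differentiable (at x)" for n x
      using that by (simp add: test_function_def)
    from this[of 0] this[of 1] have "continuous_on UNIV \<psi>" "continuous_on UNIV (deriv \<psi>)"
      by (auto intro!: continuous_at_imp_continuous_on differentiable_imp_continuous_within)
    then have "\<psi> \<in> borel_measurable borel" "deriv \<psi> \<in> borel_measurable borel"
      by (auto intro: borel_measurable_continuous_onI)
    then have [measurable]: "\<psi> \<in> borel_measurable torus" "deriv \<psi> \<in> borel_measurable torus"
      by (auto simp: torus_def intro!: measurable_restrict_space1 measurable_completion)
    note [measurable] = l2_rel_measurable[OF uu'] l2_rel_measurable[OF gg']
    show ?thesis
      using uu' gg' by (auto simp: l2_rel_def intro!: integral_cong_AE)
  qed
  then show "(\<forall>\<psi>. test_function \<psi> \<longrightarrow>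
      (\<integral>x. u x * deriv \<psi> x \<partial>torus) = - (\<integral>x. g x * \<psi> x \<partial>torus)) =
    (\<forall>\<psi>. test_function \<psi> \<longrightarrow>
      (\<integral>x. u' x * deriv \<psi> x \<partial>torus) = - (\<integral>x. g' x * \<psi> x \<partial>torus))"
    by (metis (no_types, lifting))
qed

definition H1 :: "l2 set" where
  "H1 = {u. \<exists>g. weak_deriv u g}"

definition dx :: "l2 \<Rightarrow> l2" where
  "dx u = (THE g. weak_deriv u g)"

definition H2 :: "l2 set" where
  "H2 = {u \<in> H1. dx u \<in> H1}"

definition V :: "l2 set" where
  "V = {u \<in> H2. mean u = 0}"

lift_definition cosh_integral :: "l2 \<Rightarrow> ennreal" is "\<lambda>f. \<integral>\<^sup>+x. ennreal (cosh (f x)) \<partial>torus"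
  by (rule nn_integral_cong_AE) (auto simp: l2_rel_def)

text \<open>The functional is used on \<open>H\<close> only, and is infinite outside \<open>V\<close>, a subset of \<open>H\<close>.\<close>

definition phi :: "l2 \<Rightarrow> ereal" where
  "phi h = (if h \<in> V then enn2ereal (cosh_integral (dx (dx h))) else \<infinity>)"

definition dom_phi :: "l2 set" where
  "dom_phi = {v \<in> H. phi v < \<infinity>}"

text \<open>\<open>(2 \<pi> / L)\<^sup>4\<close> for the period \<open>L = 1\<close>.\<close>

definition lam :: real where
  "lam = (2 * pi) ^ 4"

definition Phi :: "real \<Rightarrow> l2 \<Rightarrow> l2 \<Rightarrow> ereal" where
  "Phi \<tau> h v = phi v + ereal (1 / (2 * \<tau>) * (norm (h - v))\<^sup>2)"

definition resolvent :: "real \<Rightarrow> l2 \<Rightarrow> l2" where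
  "resolvent \<tau> h = arg_min (Phi \<tau> h) (\<lambda>v. v \<in> H)"

definition slope :: "l2 \<Rightarrow> ereal" where
  "slope v = (if v \<in> dom_phi
     then Limsup (at v within H) (\<lambda>w. max (phi v - phi w) 0 / ereal (dist v w)) else \<infinity>)"

definition dom_slope :: "l2 set" where
  "dom_slope = {v \<in> dom_phi. slope v < \<infinity>}"

definition partition :: "(nat \<Rightarrow> real) \<Rightarrow> bool" where
  "partition p \<longleftrightarrow> p 0 = 0 \<and> strict_mono p \<and> filterlim p at_top sequentially"

definition mesh :: "(nat \<Rightarrow> real) \<Rightarrow> ereal" where
  "mesh p = (SUP n. ereal (p (Suc n) - p n))"

definition vanishing_mesh :: "(nat \<Rightarrow> real) filter" where
  "vanishing_mesh = inf (filtercomap mesh (nhds 0)) (principal {p. partition p})"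

definition discrete_solution :: "(nat \<Rightarrow> real) \<Rightarrow> (nat \<Rightarrow> l2) \<Rightarrow> bool" where
  "discrete_solution p U \<longleftrightarrow> U 0 \<in> H \<and>
     (\<forall>n. is_arg_min (Phi (p (Suc n) - p n) (U n)) (\<lambda>v. v \<in> H) (U (Suc n)))"

text \<open>For \<open>t \<ge> 0\<close>, the index below is \<open>0\<close> if \<open>t = 0\<close>, and is the \<open>n\<close> with
  \<open>p (n - 1) < t \<le> p n\<close> otherwise.\<close>

definition interpolant :: "(nat \<Rightarrow> real) \<Rightarrow> (nat \<Rightarrow> l2) \<Rightarrow> real \<Rightarrow> l2" where
  "interpolant p U t = U (LEAST n. t \<le> p n)"

text \<open>Curves on \<open>[0, \<infinity>)\<close> are total functions on the reals whose values at negative times are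
  irrelevant. Below, \<open>U p\<close> is the discrete solution chosen for the partition \<open>p\<close>.\<close>

definition MM :: "l2 \<Rightarrow> (real \<Rightarrow> l2) set" where
  "MM h0 = {h. (\<forall>t\<ge>0. h t \<in> H) \<and>
     (\<exists>U. (\<forall>\<^sub>F p in vanishing_mesh. discrete_solution p (U p)) \<and>
          ((\<lambda>p. phi (U p 0)) \<longlongrightarrow> phi h0) vanishing_mesh \<and>
          Limsup vanishing_mesh (\<lambda>p. ereal (norm (U p 0 - h0))) < \<infinity> \<and>
          (\<forall>t\<ge>0. ((\<lambda>p. interpolant p (U p) t) \<longlongrightarrow> h t) vanishing_mesh))}"

definition abs_continuous_on :: "real set \<Rightarrow> (real \<Rightarrow> 'a::metric_space) \<Rightarrow> bool" where
  "abs_continuous_on S g \<longleftrightarrow> (\<forall>\<epsilon>>0. \<exists>\<delta>>0. \<forall>D. finite D \<longrightarrow>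
     (\<forall>(a, b)\<in>D. a \<le> b \<and> {a..b} \<subseteq> S) \<longrightarrow>
     pairwise (\<lambda>(a, b) (c, d). disjnt {a<..<b} {c<..<d}) D \<longrightarrow>
     (\<Sum>(a, b)\<in>D. b - a) < \<delta> \<longrightarrow> (\<Sum>(a, b)\<in>D. dist (g a) (g b)) < \<epsilon>)"

definition EVI_solution :: "l2 \<Rightarrow> (real \<Rightarrow> l2) \<Rightarrow> bool" where
  "EVI_solution h0 h \<longleftrightarrow>
     (\<forall>t>0. h t \<in> H) \<and>
     (\<forall>a b. 0 < a \<longrightarrow> a \<le> b \<longrightarrow> abs_continuous_on {a..b} h) \<and>
     (h \<longlongrightarrow> h0) (at_right 0) \<and>
     (AE t in lborel. t > 0 \<longrightarrow> (\<forall>v\<in>dom_phi. \<exists>d.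
        ((\<lambda>s. (norm (h s - v))\<^sup>2) has_real_derivative d) (at t) \<and>
        ereal (1 / 2 * d + lam / 2 * (norm (h t - v))\<^sup>2) \<le> phi v - phi (h t)))"

end

theory Submission
  imports Defs
begin

text \<open>
  The functional is \<open>lam\<close>-convex because \<open>cosh x - x^2 / 2\<close> is convex and Wirtinger's inequality, applied
  twice, bounds \<open>(2 * pi)^2 * norm u\<close> by the norm of the second derivative of \<open>u\<close>. Everything else is the
  theory of gradient flows of \<open>l\<close>-convex functions on a Hilbert space.

  Monotonicity of the subdifferential gives, for two Euler schemes with steps \<open>\<tau>\<close> and \<open>\<sigma>\<close>,
  \<open>(\<tau> + \<sigma>) |U_i - V_j| \<le> \<sigma> |U_(i-1) - V_j| + \<tau> |U_i - V_(j-1)|\<close>, and hence Kobayashi's bound for \<open>|U_i - V_j|\<close>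
  on arbitrary partitions. All schemes therefore converge to one contraction semigroup, and the energy and slope
  estimates pass to the limit from the discrete level.

  The evolution variational inequality needs differentiability almost everywhere. It holds outside a
  countable set: the minimal slope decreases along the flow, and the curve is differentiable wherever
  that monotone function is continuous. Uniqueness follows by differentiating the squared distance of
  two solutions.
\<close>

section \<open>Convex energies and their resolvents\<close>

text \<open>Three obstacles shape the argument. Weak compactness is avoided: the limits behind
  existence and lower semicontinuity are strong, because uniform convexity turns near-optimal
  midpoints into Cauchy sequences, both of the functions and of their second derivatives. Next,
  \<open>MM\<close> quantifies over all partitions of small mesh, so comparing uniform schemes is
  not enough; schemes with unrelated steps must be compared, and \<open>J_double\<close> therefore
  carries two step sizes. Finally, the metric slope is a local limsup. Convexity makes it equal to
  the least global bound \<open>slope_bound\<close>, which resolvents preserve and which passes to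
  limits; only \<open>slope_le_iff\<close> returns to the original definition. The constant
  \<open>lam = (2 * pi)^4\<close> is the square of the factor in the norm inequality between a
  function and its second derivative. The decay rate \<open>lam\<close> of the flow uses the
  convexity modulus twice, once in the quadratic growth at the minimizer and once in the variational
  inequality.\<close>

lemma norm_midpoint_diff:
  fixes h x y :: "'a::real_inner"
  shows "(norm (h - midpoint x y))\<^sup>2 =
    (norm (h - x))\<^sup>2 / 2 + (norm (h - y))\<^sup>2 / 2 - (norm (x - y))\<^sup>2 / 4"
  by (simp add: midpoint_def power2_norm_eq_inner inner_simps inner_commute field_simps)

lemma midpoint_conv: "midpoint x y = (1 - 1/2) *\<^sub>R x + (1/2) *\<^sub>R y"
  by (simp add: midpoint_def scaleR_add_right)

text \<open>Convexity inequalities along a segment are divided by the parameter \<open>s\<close> of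
  the segment; this removes the remaining error of order \<open>s\<close>.\<close>

lemma le_of_mult_pos_limit:
  fixes a b c :: real
  assumes "\<And>s. 0 < s \<Longrightarrow> s \<le> 1 \<Longrightarrow> a \<le> b + s * c"
  shows "a \<le> b"
proof (rule tendsto_lowerbound)
  show "((\<lambda>s. b + s * c) \<longlongrightarrow> b) (at_right 0)"
    by (auto intro!: tendsto_eq_intros)
  show "\<forall>\<^sub>F s in at_right 0. a \<le> b + s * c"
    using assms by (auto simp: eventually_at_right_field intro!: exI[of _ 1])
qed simp

text \<open>Condition \<open>closed_F\<close> is a form of lower semicontinuity that a uniformly convex integral functional
  satisfies by Fatou's lemma: the midpoint condition, which holds along minimizing sequences, forces the
  second derivatives to converge strongly.\<close>

locale convex_energy =
  fixes H D :: "'a::real_inner set" and F :: "'a \<Rightarrow> real" and l :: real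
  assumes subspace_H: "subspace H" and complete_H: "complete H"
    and D_subset: "D \<subseteq> H" and dense_D: "H \<subseteq> closure D"
    and l_pos: "0 < l"
    and zero_D: "0 \<in> D" and min_0: "\<And>v. v \<in> D \<Longrightarrow> F 0 \<le> F v"
    and convex_D: "\<And>u v s. u \<in> D \<Longrightarrow> v \<in> D \<Longrightarrow> 0 \<le> s \<Longrightarrow> s \<le> 1 \<Longrightarrow> (1 - s) *\<^sub>R u + s *\<^sub>R v \<in> D"
    and convex_F: "\<And>u v s. u \<in> D \<Longrightarrow> v \<in> D \<Longrightarrow> 0 \<le> s \<Longrightarrow> s \<le> 1 \<Longrightarrow>
      F ((1 - s) *\<^sub>R u + s *\<^sub>R v) \<le> (1 - s) * F u + s * F v - l / 2 * (s * (1 - s)) * (norm (u - v))\<^sup>2"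
    and closed_F: "\<And>w h c C. (\<And>n::nat. w n \<in> D) \<Longrightarrow> w \<longlonglongrightarrow> h \<Longrightarrow> (\<And>n. F (w n) \<le> c n) \<Longrightarrow> c \<longlonglongrightarrow> C \<Longrightarrow>
      (\<And>e. 0 < e \<Longrightarrow> \<exists>N. \<forall>m\<ge>N. \<forall>n\<ge>N. F (w m) / 2 + F (w n) / 2 - e \<le> F (midpoint (w m) (w n))) \<Longrightarrow>
      h \<in> D \<and> F h \<le> C"
begin

section \<open>Midpoint consequences of uniform convexity\<close>

lemma in_H: "v \<in> D \<Longrightarrow> v \<in> H"
  using D_subset by auto

lemma midpoint_D: "u \<in> D \<Longrightarrow> v \<in> D \<Longrightarrow> midpoint u v \<in> D"
  unfolding midpoint_conv by (rule convex_D) auto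

lemma midpoint_F:
  assumes "u \<in> D" "v \<in> D"
  shows "F (midpoint u v) \<le> F u / 2 + F v / 2 - l / 8 * (norm (u - v))\<^sup>2"
  using convex_F[OF assms, of "1/2"] unfolding midpoint_conv by (simp add: field_simps)

text \<open>Uniform convexity pushes the energy of a midpoint below the average by
  \<open>l / 8\<close> times the squared distance. If the average is nearly attained, the distance
  must be small.\<close>

lemma Cauchy_of_midpoint:
  assumes D: "\<And>n::nat. w n \<in> D"
    and mid: "\<And>e. 0 < e \<Longrightarrow> \<exists>N. \<forall>m\<ge>N. \<forall>n\<ge>N. F (w m) / 2 + F (w n) / 2 - e \<le> F (midpoint (w m) (w n))"
  shows "Cauchy w"
proof (rule metric_CauchyI)
  fix e :: real assume e: "0 < e"
  \<comment> \<open>The factor 1/16 against the 1/8 of \<open>midpoint_F\<close> leaves half of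
    \<open>e^2\<close>, which makes the final inequality strict.\<close>
  then have "0 < l / 16 * e\<^sup>2" using l_pos by simp
  from mid[OF this] obtain N where N: "\<And>m n. m \<ge> N \<Longrightarrow> n \<ge> N \<Longrightarrow>
    F (w m) / 2 + F (w n) / 2 - l / 16 * e\<^sup>2 \<le> F (midpoint (w m) (w n))" by blast
  have "dist (w m) (w n) < e" if "m \<ge> N" "n \<ge> N" for m n
  proof -
    have "l / 8 * (norm (w m - w n))\<^sup>2 \<le> l / 16 * e\<^sup>2"
      using N[OF that] midpoint_F[OF D[of m] D[of n]] by linarith
    then have "(norm (w m - w n))\<^sup>2 \<le> e\<^sup>2 / 2" using l_pos by (simp add: field_simps)
    also have "\<dots> < e\<^sup>2" using e by simp
    finally show ?thesis using e by (simp add: dist_norm power_less_imp_less_base)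
  qed
  then show "\<exists>M. \<forall>m\<ge>M. \<forall>n\<ge>M. dist (w m) (w n) < e" by blast
qed

lemma Cauchy_limit_H:
  assumes "\<And>n::nat. w n \<in> H" "Cauchy w"
  obtains x where "x \<in> H" "w \<longlonglongrightarrow> x"
  using complete_H assms unfolding complete_def by blast

section \<open>Proximal functionals and existence of resolvents\<close>

definition yosida :: "real \<Rightarrow> 'a \<Rightarrow> 'a \<Rightarrow> real" where
  "yosida \<tau> h v = F v + (norm (h - v))\<^sup>2 / (2 * \<tau>)"

text \<open>The parallelogram identity, solved for \<open>F\<close> at the midpoint: it transfers
  near-minimality of \<open>yosida\<close> to the midpoint condition that \<open>closed_F\<close>
  demands of \<open>F\<close> alone.\<close>

lemma yosida_midpoint:
  assumes "0 < \<tau>"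
  shows "F (midpoint u v) = yosida \<tau> h (midpoint u v) - ((norm (h - u))\<^sup>2 / (4 * \<tau>) + (norm (h - v))\<^sup>2 / (4 * \<tau>))
    + (norm (u - v))\<^sup>2 / (8 * \<tau>)"
  using assms by (simp add: yosida_def norm_midpoint_diff field_simps)

text \<open>Direct method. The midpoints along a minimizing sequence have \<open>yosida\<close>
  value at least the infimum, so the sequence satisfies the midpoint condition and converges
  strongly.\<close>

lemma minimizer_exists:
  assumes h: "h \<in> H" and \<tau>: "0 < \<tau>"
  shows "\<exists>u\<in>D. \<forall>v\<in>D. yosida \<tau> h u \<le> yosida \<tau> h v"
proof -
  define G where "G = yosida \<tau> h"
  define m where "m = Inf (G ` D)"
  have bdd: "bdd_below (G ` D)"
  proof (rule bdd_belowI2)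
    fix v assume "v \<in> D"
    then show "F 0 \<le> G v" using min_0[of v] \<tau> by (simp add: G_def yosida_def add_increasing2)
  qed
  have m_le: "m \<le> G v" if "v \<in> D" for v
    unfolding m_def using bdd that by (rule cINF_lower)
  have "\<exists>w\<in>D. G w < m + 1 / real (Suc n)" for n
  proof -
    have "Inf (G ` D) < m + 1 / real (Suc n)" by (simp add: m_def)
    then show ?thesis using zero_D bdd cINF_less_iff[of D G] by blast
  qed
  then obtain w where wD: "\<And>n. w n \<in> D" and wG: "\<And>n. G (w n) < m + 1 / real (Suc n)"
    by metis
  have mid: "\<exists>N. \<forall>i\<ge>N. \<forall>j\<ge>N. F (w i) / 2 + F (w j) / 2 - e \<le> F (midpoint (w i) (w j))" if e: "0 < e" for e
  proof -
    obtain N where N: "1 / real (Suc N) < e" using e nat_approx_posE by blast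
    have "F (w i) / 2 + F (w j) / 2 - e \<le> F (midpoint (w i) (w j))" if ij: "i \<ge> N" "j \<ge> N" for i j
    proof -
      have a: "G (w k) < m + e" if "k \<ge> N" for k
      proof -
        have "1 / real (Suc k) \<le> 1 / real (Suc N)" using that by (simp add: field_simps)
        then show ?thesis using wG[of k] N by linarith
      qed
      have "F (midpoint (w i) (w j)) \<ge> G (midpoint (w i) (w j)) - ((norm (h - w i))\<^sup>2 / (4 * \<tau>) + (norm (h - w j))\<^sup>2 / (4 * \<tau>))"
        using yosida_midpoint[OF \<tau>, of "w i" "w j" h] \<tau> by (simp add: G_def)
      moreover have "G (w i) / 2 + G (w j) / 2 = F (w i) / 2 + F (w j) / 2 + ((norm (h - w i))\<^sup>2 / (4 * \<tau>) + (norm (h - w j))\<^sup>2 / (4 * \<tau>))"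
        using \<tau> by (simp add: G_def yosida_def field_simps)
      ultimately show ?thesis
        using a[OF ij(1)] a[OF ij(2)] m_le[OF midpoint_D[OF wD[of i] wD[of j]]] by linarith
    qed
    then show ?thesis by blast
  qed
  obtain u where "u \<in> H" and u: "w \<longlonglongrightarrow> u"
    using Cauchy_limit_H[OF in_H[OF wD] Cauchy_of_midpoint[OF wD mid]] by blast
  \<comment> \<open>The bound on \<open>F (w n)\<close> that near-minimality gives once the
    quadratic term is moved to the other side. Its limit turns the conclusion of
    \<open>closed_F\<close> into \<open>G u \<le> m\<close>.\<close>
  define c where "c n = m + 1 / real (Suc n) - (norm (h - w n))\<^sup>2 / (2 * \<tau>)" for n
  have "c \<longlonglongrightarrow> m + 0 - (norm (h - u))\<^sup>2 / (2 * \<tau>)"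
    unfolding c_def using \<tau>
    by (intro tendsto_intros u LIMSEQ_inverse_real_of_nat[unfolded inverse_eq_divide]) auto
  moreover have "F (w n) \<le> c n" for n
    using wG[of n] by (simp add: c_def G_def yosida_def)
  ultimately have "u \<in> D \<and> F u \<le> m + 0 - (norm (h - u))\<^sup>2 / (2 * \<tau>)"
    using closed_F[OF wD u _ _ mid] by blast
  then have "u \<in> D" "G u \<le> m" by (auto simp: G_def yosida_def)
  then show ?thesis using m_le unfolding G_def by force
qed

definition J :: "real \<Rightarrow> 'a \<Rightarrow> 'a" where
  "J \<tau> h = (SOME u. u \<in> D \<and> (\<forall>v\<in>D. yosida \<tau> h u \<le> yosida \<tau> h v))"

lemma
  assumes "h \<in> H" "0 < \<tau>"
  shows J_D: "J \<tau> h \<in> D" and J_min: "v \<in> D \<Longrightarrow> yosida \<tau> h (J \<tau> h) \<le> yosida \<tau> h v"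
  using someI_ex[of "\<lambda>u. u \<in> D \<and> (\<forall>v\<in>D. yosida \<tau> h u \<le> yosida \<tau> h v)"]
    minimizer_exists[OF assms] unfolding J_def by blast+

lemma J_H: "h \<in> H \<Longrightarrow> 0 < \<tau> \<Longrightarrow> J \<tau> h \<in> H"
  using J_D in_H by blast

text \<open>Two distinct minimizers would make their midpoint strictly better, by the convexity of
  \<open>F\<close> and of the squared norm.\<close>

lemma J_unique:
  assumes h: "h \<in> H" and \<tau>: "0 < \<tau>" and u: "u \<in> D" "\<And>v. v \<in> D \<Longrightarrow> yosida \<tau> h u \<le> yosida \<tau> h v"
  shows "u = J \<tau> h"
proof -
  let ?w = "J \<tau> h"
  have w: "?w \<in> D" using J_D[OF h \<tau>] .
  have eq: "yosida \<tau> h u = yosida \<tau> h ?w"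
    using u(2)[OF w] J_min[OF h \<tau> u(1)] by simp
  have "yosida \<tau> h u \<le> yosida \<tau> h (midpoint u ?w)"
    using u(2)[OF midpoint_D[OF u(1) w]] .
  moreover have "yosida \<tau> h (midpoint u ?w) \<le> yosida \<tau> h u / 2 + yosida \<tau> h ?w / 2
      - l / 8 * (norm (u - ?w))\<^sup>2 - (norm (u - ?w))\<^sup>2 / (8 * \<tau>)"
  proof -
    have "yosida \<tau> h (midpoint u ?w) = F (midpoint u ?w) + (norm (h - u))\<^sup>2 / (4 * \<tau>)
        + (norm (h - ?w))\<^sup>2 / (4 * \<tau>) - (norm (u - ?w))\<^sup>2 / (8 * \<tau>)"
      using yosida_midpoint[OF \<tau>, of u ?w h] by linarith
    then show ?thesis using midpoint_F[OF u(1) w] by (simp add: yosida_def add_divide_distrib)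
  qed
  ultimately have "l / 8 * (norm (u - ?w))\<^sup>2 \<le> - ((norm (u - ?w))\<^sup>2 / (8 * \<tau>))"
    using eq by linarith
  also have "\<dots> \<le> 0" using \<tau> by simp
  finally show ?thesis using l_pos by (simp add: mult_le_0_iff)
qed

text \<open>The points \<open>J (1 / k) h\<close> increase in energy and converge to \<open>h\<close>. Their minimality yields the
  midpoint condition of \<open>closed_F\<close>, so no weak compactness is needed.\<close>

lemma lsc_bound:
  assumes x: "\<And>n::nat. x n \<in> D" and lim: "x \<longlonglongrightarrow> h" and hH: "h \<in> H" and C: "\<And>n. F (x n) \<le> C"
  shows "h \<in> D \<and> F h \<le> C"
proof -
  define t where "t k = 1 / real (Suc k)" for k
  have t: "0 < t k" for k by (simp add: t_def)
  define w where "w k = J (t k) h" for k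
  have wD: "w k \<in> D" for k unfolding w_def by (rule J_D[OF hH t])
  \<comment> \<open>Minimality is tested against \<open>x n\<close>, whose quadratic penalty
    vanishes as \<open>n\<close> grows.\<close>
  have bound: "F (w k) + (norm (h - w k))\<^sup>2 / (2 * t k) \<le> C" for k
  proof (rule tendsto_lowerbound)
    have "(\<lambda>n. C + (norm (h - x n))\<^sup>2 / (2 * t k)) \<longlonglongrightarrow> C + (norm (h - h))\<^sup>2 / (2 * t k)"
      using t[of k] by (intro tendsto_intros lim) auto
    then show "(\<lambda>n. C + (norm (h - x n))\<^sup>2 / (2 * t k)) \<longlonglongrightarrow> C" by simp
    show "\<forall>\<^sub>F n in sequentially. F (w k) + (norm (h - w k))\<^sup>2 / (2 * t k) \<le> C + (norm (h - x n))\<^sup>2 / (2 * t k)"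
    proof (rule always_eventually, rule allI)
      fix n
      show "F (w k) + (norm (h - w k))\<^sup>2 / (2 * t k) \<le> C + (norm (h - x n))\<^sup>2 / (2 * t k)"
        using J_min[OF hH t x, of k n] C[of n] unfolding w_def yosida_def by linarith
    qed
  qed simp
  have FC: "F (w k) \<le> C" for k
  proof -
    have "0 \<le> (norm (h - w k))\<^sup>2 / (2 * t k)" using t[of k] by simp
    then show ?thesis using bound[of k] by linarith
  qed
  \<comment> \<open>Adding the minimality inequalities for the parameters \<open>t i\<close> and
    \<open>t j\<close> cancels the energies and leaves the squared distances.\<close>
  have dist_mono: "(norm (h - w j))\<^sup>2 \<le> (norm (h - w i))\<^sup>2" if "i \<le> j" for i j
  proof (cases "i = j")
    case False
    then have ij: "t j < t i" using that by (simp add: t_def frac_less2)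
    have "F (w i) + (norm (h - w i))\<^sup>2 / (2 * t i) \<le> F (w j) + (norm (h - w j))\<^sup>2 / (2 * t i)"
      "F (w j) + (norm (h - w j))\<^sup>2 / (2 * t j) \<le> F (w i) + (norm (h - w i))\<^sup>2 / (2 * t j)"
      using J_min[OF hH t wD, of i j] J_min[OF hH t wD, of j i] unfolding w_def yosida_def by auto
    then have "((norm (h - w j))\<^sup>2 - (norm (h - w i))\<^sup>2) * (1 / (2 * t j) - 1 / (2 * t i)) \<le> 0"
      by (simp add: algebra_simps)
    moreover have "1 / (2 * t j) - 1 / (2 * t i) > 0"
      using ij t[of j] t[of i] by (simp add: field_simps)
    ultimately show ?thesis by (simp add: mult_le_0_iff)
  qed simp
  \<comment> \<open>Thus \<open>w i\<close> has least energy among the points of \<open>D\<close>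
    that are no farther from \<open>h\<close> than \<open>w i\<close>.\<close>
  have F_mono: "F (w i) \<le> F u" if "u \<in> D" "(norm (h - u))\<^sup>2 \<le> (norm (h - w i))\<^sup>2" for i u
  proof -
    have "F (w i) + (norm (h - w i))\<^sup>2 / (2 * t i) \<le> F u + (norm (h - u))\<^sup>2 / (2 * t i)"
      using J_min[OF hH t that(1), of i] unfolding w_def yosida_def by auto
    moreover have "(norm (h - u))\<^sup>2 / (2 * t i) \<le> (norm (h - w i))\<^sup>2 / (2 * t i)"
      using that(2) t[of i] by (simp add: divide_right_mono)
    ultimately show ?thesis by linarith
  qed
  have "incseq (\<lambda>k. F (w k))"
    by (rule incseq_SucI) (auto intro!: F_mono wD dist_mono)
  moreover have "\<forall>k. F (w k) \<le> C" using FC by simp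
  ultimately obtain L where L: "(\<lambda>k. F (w k)) \<longlonglongrightarrow> L" "\<And>k. F (w k) \<le> L"
    using incseq_convergent by metis
  \<comment> \<open>The midpoint is no farther from \<open>h\<close> than the farther of its end
    points, which is \<open>w i\<close>, so \<open>F_mono\<close> applies.\<close>
  have mid1: "F (w i) \<le> F (midpoint (w i) (w j))" if "i \<le> j" for i j
  proof (rule F_mono[OF midpoint_D[OF wD wD]])
    show "(norm (h - midpoint (w i) (w j)))\<^sup>2 \<le> (norm (h - w i))\<^sup>2"
      unfolding norm_midpoint_diff using dist_mono[OF that] zero_le_power2[of "norm (w i - w j)"] by linarith
  qed
  have mid: "\<exists>N. \<forall>i\<ge>N. \<forall>j\<ge>N. F (w i) / 2 + F (w j) / 2 - e \<le> F (midpoint (w i) (w j))" if e: "0 < e" for e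
  proof -
    have "\<forall>\<^sub>F k in sequentially. L - e < F (w k)"
      using order_tendstoD(1)[OF L(1), of "L - e"] e by simp
    \<comment> \<open>All energies past \<open>N\<close> lie in \<open>(L - e, L]\<close>, so the
      smaller of two is within \<open>e\<close> of their average.\<close>
    then obtain N where N: "\<And>k. k \<ge> N \<Longrightarrow> L - e < F (w k)"
      by (auto simp: eventually_sequentially)
    have "F (w i) / 2 + F (w j) / 2 - e \<le> F (midpoint (w i) (w j))" if ij: "i \<ge> N" "j \<ge> N" for i j
    proof -
      have "min (F (w i)) (F (w j)) \<le> F (midpoint (w i) (w j))"
        using mid1[of i j] mid1[of j i] midpoint_sym[of "w i" "w j"] by (cases "i \<le> j") auto
      then show ?thesis using N[OF ij(1)] N[OF ij(2)] L(2)[of i] L(2)[of j] by linarith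
    qed
    then show ?thesis by blast
  qed
  have "(\<lambda>k. (norm (h - w k))\<^sup>2) \<longlonglongrightarrow> 0"
  proof (rule tendsto_sandwich)
    show "\<forall>\<^sub>F k in sequentially. 0 \<le> (norm (h - w k))\<^sup>2" by simp
    show "\<forall>\<^sub>F k in sequentially. (norm (h - w k))\<^sup>2 \<le> 2 * (C - F 0) * t k"
    proof (rule always_eventually, rule allI)
      fix k
      have "(norm (h - w k))\<^sup>2 / (2 * t k) \<le> C - F 0"
        using bound[of k] min_0[OF wD[of k]] by linarith
      then show "(norm (h - w k))\<^sup>2 \<le> 2 * (C - F 0) * t k"
        using t[of k] by (simp add: field_simps)
    qed
    show "(\<lambda>k. 2 * (C - F 0) * t k) \<longlonglongrightarrow> 0"
      unfolding t_def using tendsto_mult_right_zero[OF LIMSEQ_inverse_real_of_nat[unfolded inverse_eq_divide]] by blast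
  qed simp
  then have "(\<lambda>k. sqrt ((norm (h - w k))\<^sup>2)) \<longlonglongrightarrow> sqrt 0" by (rule tendsto_real_sqrt)
  then have "w \<longlonglongrightarrow> h"
    by (simp add: tendsto_dist_iff[of w h] dist_norm norm_minus_commute)
  then show ?thesis
    using closed_F[OF wD _ FC tendsto_const mid] by blast
qed

text \<open>A convergent bound is eventually below \<open>C + e\<close>, so a tail of the sequence
  falls under \<open>lsc_bound\<close>.\<close>

lemma lsc:
  assumes x: "\<And>n::nat. x n \<in> D" and lim: "x \<longlonglongrightarrow> h" and c: "\<And>n. F (x n) \<le> c n" "c \<longlonglongrightarrow> C"
  shows "h \<in> D" "F h \<le> C"
proof -
  have hH: "h \<in> H"
    by (rule closed_sequentially[OF complete_imp_closed[OF complete_H] in_H[OF x] lim])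
  have *: "h \<in> D \<and> F h \<le> C + e" if e: "0 < e" for e
  proof -
    have "\<forall>\<^sub>F n in sequentially. c n < C + e"
      using order_tendstoD(2)[OF c(2), of "C + e"] e by simp
    then obtain N where N: "\<And>n. n \<ge> N \<Longrightarrow> c n < C + e"
      by (auto simp: eventually_sequentially)
    have "F (x (n + N)) \<le> C + e" for n
      using c(1)[of "n + N"] N[of "n + N"] by simp
    then show ?thesis using lsc_bound[OF x LIMSEQ_ignore_initial_segment[OF lim] hH] by blast
  qed
  show "h \<in> D" using *[of 1] by simp
  show "F h \<le> C" using * field_le_epsilon by blast
qed

text \<open>Euler-Lagrange inequality of the proximal step:
  \<open>(h - J \<tau> h) /\<^sub>R \<tau>\<close> is a subgradient at \<open>J \<tau> h\<close>,
  improved by the convexity modulus. Minimality is tested on the segment towards \<open>v\<close>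
  and divided by the parameter.\<close>

lemma variational:
  assumes h: "h \<in> H" and \<tau>: "0 < \<tau>" and v: "v \<in> D"
  shows "F (J \<tau> h) + ((h - J \<tau> h) /\<^sub>R \<tau>) \<bullet> (v - J \<tau> h) + l / 2 * (norm (v - J \<tau> h))\<^sup>2 \<le> F v"
proof -
  define u where "u = J \<tau> h"
  have uD: "u \<in> D" unfolding u_def by (rule J_D[OF h \<tau>])
  define I where "I = (h - u) \<bullet> (v - u)"
  define N where "N = (norm (v - u))\<^sup>2"
  have "F u + I / \<tau> + l / 2 * N \<le> F v"
  proof (rule le_of_mult_pos_limit)
    fix s :: real assume s: "0 < s" "s \<le> 1"
    let ?w = "(1 - s) *\<^sub>R u + s *\<^sub>R v"
    have eq: "(norm (h - ?w))\<^sup>2 = (norm (h - u))\<^sup>2 - 2 * s * I + s\<^sup>2 * N"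
      unfolding I_def N_def power2_norm_eq_inner power2_eq_square[of s]
      by (simp add: inner_simps inner_commute algebra_simps)
    have "F u + (norm (h - u))\<^sup>2 / (2 * \<tau>) \<le> F ?w + (norm (h - ?w))\<^sup>2 / (2 * \<tau>)"
      using J_min[OF h \<tau> convex_D[OF uD v, of s]] s unfolding yosida_def u_def by simp
    moreover have "F ?w \<le> (1 - s) * F u + s * F v - l / 2 * (s * (1 - s)) * N"
      using convex_F[OF uD v, of s] s by (simp add: N_def norm_minus_commute)
    moreover have "(norm (h - ?w))\<^sup>2 / (2 * \<tau>) =
        (norm (h - u))\<^sup>2 / (2 * \<tau>) - s * (I / \<tau>) + s * (s * (N / (2 * \<tau>)))"
      unfolding eq using \<tau> by (simp add: field_simps power2_eq_square)
    ultimately have "0 \<le> - (s * F u) + s * F v - l / 2 * (s * (1 - s)) * N - s * (I / \<tau>) + s * (s * (N / (2 * \<tau>)))"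
      by (simp add: left_diff_distrib)
    then have "0 \<le> s * (F v - F u - l / 2 * ((1 - s) * N) - I / \<tau> + s * (N / (2 * \<tau>)))"
      by (simp add: algebra_simps)
    then have "0 \<le> F v - F u - l / 2 * ((1 - s) * N) - I / \<tau> + s * (N / (2 * \<tau>))"
      using s by (simp add: zero_le_mult_iff)
    moreover have "l / 2 * ((1 - s) * N) = l / 2 * N - s * (l / 2 * N)" by (simp add: field_simps)
    moreover have "s * (N / (2 * \<tau>) + l / 2 * N) = s * (N / (2 * \<tau>)) + s * (l / 2 * N)"
      by (simp add: distrib_left)
    ultimately show "F u + I / \<tau> + l / 2 * N \<le> F v + s * (N / (2 * \<tau>) + l / 2 * N)"
      by linarith
  qed
  then show ?thesis
    unfolding u_def I_def N_def inner_scaleR_left divide_inverse_commute .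
qed

lemma variational':
  assumes h: "h \<in> H" and \<tau>: "0 < \<tau>" and v: "v \<in> D"
  shows "F (J \<tau> h) + ((h - J \<tau> h) /\<^sub>R \<tau>) \<bullet> (v - J \<tau> h) \<le> F v"
proof -
  have "0 \<le> l / 2 * (norm (v - J \<tau> h))\<^sup>2" using l_pos by simp
  then show ?thesis using variational[OF assms] by linarith
qed

text \<open>Each subgradient inequality is tested at the other resolvent, so that the energies
  cancel in the sum. Writing \<open>h - u = (h - v) - (u - v)\<close> and
  \<open>g - v = (u - v) - (u - g)\<close> isolates the squared distance, and Cauchy-Schwarz leaves
  one factor to cancel.\<close>

lemma J_double:
  assumes h: "h \<in> H" "g \<in> H" and p: "0 < \<tau>" "0 < \<sigma>"
  shows "(\<tau> + \<sigma>) * norm (J \<tau> h - J \<sigma> g) \<le> \<sigma> * norm (h - J \<sigma> g) + \<tau> * norm (J \<tau> h - g)"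
proof -
  define u v where "u = J \<tau> h" and "v = J \<sigma> g"
  have D: "u \<in> D" "v \<in> D" unfolding u_def v_def by (auto intro: J_D h p)
  have 1: "F u + (h - u) \<bullet> (v - u) / \<tau> \<le> F v"
    using variational'[OF h(1) p(1) D(2)] by (simp add: u_def divide_inverse_commute)
  have 2: "F v + (g - v) \<bullet> (u - v) / \<sigma> \<le> F u"
    using variational'[OF h(2) p(2) D(1)] by (simp add: v_def divide_inverse_commute)
  have "(h - u) \<bullet> (v - u) / \<tau> + (g - v) \<bullet> (u - v) / \<sigma> \<le> 0" using 1 2 by linarith
  then have "\<sigma> * ((h - u) \<bullet> (v - u)) + \<tau> * ((g - v) \<bullet> (u - v)) \<le> 0"
    using p by (simp add: field_simps)
  then have "(\<tau> + \<sigma>) * (norm (u - v))\<^sup>2 \<le> \<sigma> * ((h - v) \<bullet> (u - v)) + \<tau> * ((u - g) \<bullet> (u - v))"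
    by (simp add: power2_norm_eq_inner inner_simps inner_commute algebra_simps)
  also have "\<dots> \<le> \<sigma> * (norm (h - v) * norm (u - v)) + \<tau> * (norm (u - g) * norm (u - v))"
    using p by (intro add_mono mult_left_mono norm_cauchy_schwarz) auto
  finally have "norm (u - v) * ((\<tau> + \<sigma>) * norm (u - v)) \<le> norm (u - v) * (\<sigma> * norm (h - v) + \<tau> * norm (u - g))"
    by (simp add: algebra_simps power2_eq_square)
  then have "(\<tau> + \<sigma>) * norm (u - v) \<le> \<sigma> * norm (h - v) + \<tau> * norm (u - g)"
    using p by (cases "norm (u - v) = 0") (auto simp: mult_le_cancel_left)
  then show ?thesis unfolding u_def v_def .
qed

text \<open>For equal steps the data combine to \<open>h - g\<close> before Cauchy-Schwarz is
  applied; \<open>J_double\<close> estimates the two contributions separately.\<close>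

lemma J_nonexpansive:
  assumes h: "h \<in> H" "g \<in> H" and \<tau>: "0 < \<tau>"
  shows "norm (J \<tau> h - J \<tau> g) \<le> norm (h - g)"
proof -
  define u v where "u = J \<tau> h" and "v = J \<tau> g"
  have D: "u \<in> D" "v \<in> D" unfolding u_def v_def by (auto intro: J_D h \<tau>)
  have 1: "F u + (h - u) \<bullet> (v - u) / \<tau> \<le> F v"
    using variational'[OF h(1) \<tau> D(2)] by (simp add: u_def divide_inverse_commute)
  have 2: "F v + (g - v) \<bullet> (u - v) / \<tau> \<le> F u"
    using variational'[OF h(2) \<tau> D(1)] by (simp add: v_def divide_inverse_commute)
  have "((h - u) \<bullet> (v - u) + (g - v) \<bullet> (u - v)) / \<tau> \<le> 0"
    using 1 2 by (simp add: add_divide_distrib)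
  then have "(h - u) \<bullet> (v - u) + (g - v) \<bullet> (u - v) \<le> 0"
    using \<tau> by (simp add: divide_le_0_iff)
  then have "(norm (u - v))\<^sup>2 \<le> (h - g) \<bullet> (u - v)"
    by (simp add: power2_norm_eq_inner inner_simps inner_commute algebra_simps)
  also have "\<dots> \<le> norm (h - g) * norm (u - v)" by (rule norm_cauchy_schwarz)
  finally have "norm (u - v) \<le> norm (h - g)"
    by (cases "norm (u - v) = 0") (auto simp: power2_eq_square mult_le_cancel_right)
  then show ?thesis unfolding u_def v_def .
qed

text \<open>A global surrogate for the metric slope. For convex energies the two agree, see
  \<open>slope_le_iff\<close>, and an inequality over all of \<open>D\<close> passes to limits by
  lower semicontinuity.\<close>

definition slope_bound :: "'a \<Rightarrow> real \<Rightarrow> bool" where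
  "slope_bound v M \<longleftrightarrow> v \<in> D \<and> 0 \<le> M \<and> (\<forall>w\<in>D. F v - F w \<le> M * norm (v - w))"

lemma slope_boundD:
  assumes "slope_bound v M"
  shows "v \<in> D" "0 \<le> M" "w \<in> D \<Longrightarrow> F v - F w \<le> M * norm (v - w)"
  using assms by (auto simp: slope_bound_def)

lemma slope_bound_zero: "slope_bound 0 0"
  using zero_D min_0 by (simp add: slope_bound_def)

text \<open>The discrete velocity is a subgradient at the new point, so its norm bounds the slope
  there.\<close>

lemma slope_bound_J_increment:
  assumes h: "h \<in> H" and \<tau>: "0 < \<tau>"
  shows "slope_bound (J \<tau> h) (norm (h - J \<tau> h) / \<tau>)"
  unfolding slope_bound_def
proof (intro conjI ballI J_D[OF h \<tau>])
  show "0 \<le> norm (h - J \<tau> h) / \<tau>" using \<tau> by simp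
  fix w assume w: "w \<in> D"
  let ?\<xi> = "(h - J \<tau> h) /\<^sub>R \<tau>"
  have "F (J \<tau> h) - F w \<le> ?\<xi> \<bullet> (J \<tau> h - w)"
    using variational'[OF h \<tau> w] inner_minus_right[of ?\<xi> "J \<tau> h - w"] by simp
  also have "\<dots> \<le> norm ?\<xi> * norm (J \<tau> h - w)" by (rule norm_cauchy_schwarz)
  finally show "F (J \<tau> h) - F w \<le> norm (h - J \<tau> h) / \<tau> * norm (J \<tau> h - w)"
    using \<tau> by (simp add: divide_inverse mult.commute)
qed

text \<open>With \<open>u = J \<tau> v\<close>, testing \<open>variational'\<close> at the starting
  point \<open>v\<close> gives an energy drop of at least \<open>norm (v - u)^2 / \<tau>\<close>,
  while the slope bound limits the drop to \<open>M * norm (v - u)\<close>.\<close>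

lemma J_step:
  assumes v: "slope_bound v M" and \<tau>: "0 < \<tau>"
  shows "norm (v - J \<tau> v) / \<tau> \<le> M"
proof -
  have vD: "v \<in> D" and vH: "v \<in> H" using slope_boundD(1)[OF v] in_H by auto
  define u where "u = J \<tau> v"
  have "F u + (norm (v - u))\<^sup>2 / \<tau> \<le> F v"
    using variational'[OF vH \<tau> vD]
    by (simp add: u_def power2_norm_eq_inner divide_inverse_commute)
  moreover have "F v - F u \<le> M * norm (v - u)"
    using slope_boundD(3)[OF v J_D[OF vH \<tau>]] unfolding u_def .
  ultimately have "norm (v - u) * (norm (v - u) / \<tau>) \<le> norm (v - u) * M"
    by (simp add: power2_eq_square mult.commute)
  then have "norm (v - u) / \<tau> \<le> M" if "0 < norm (v - u)"
    using that by (simp only: mult_le_cancel_left_pos)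
  then show ?thesis unfolding u_def[symmetric]
    using slope_boundD(2)[OF v] by (cases "norm (v - u) = 0") auto
qed

lemma slope_bound_mono: "slope_bound v M \<Longrightarrow> M \<le> M' \<Longrightarrow> slope_bound v M'"
  unfolding slope_bound_def
  using mult_right_mono[of M M' "norm (v - w)" for w] by (meson norm_ge_zero order_trans)

lemma slope_bound_J: "slope_bound v M \<Longrightarrow> 0 < \<tau> \<Longrightarrow> slope_bound (J \<tau> v) M"
  by (rule slope_bound_mono[OF slope_bound_J_increment[OF in_H[OF slope_boundD(1)]] J_step])

text \<open>Read as \<open>F (x n) \<le> F w + M n * norm (x n - w)\<close>, the slope bound is an
  upper bound with convergent right-hand side, which is the form that \<open>lsc\<close>
  accepts.\<close>

lemma slope_bound_limit:
  assumes x: "\<And>n::nat. slope_bound (x n) (M n)" and lim: "x \<longlonglongrightarrow> h" "M \<longlonglongrightarrow> L"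
  shows "slope_bound h L"
proof -
  have c: "F h \<le> F w + L * norm (h - w) \<and> h \<in> D" if w: "w \<in> D" for w
  proof -
    have a: "F (x n) \<le> F w + M n * norm (x n - w)" for n
      using slope_boundD(3)[OF x w, of n] by simp
    have b: "(\<lambda>n. F w + M n * norm (x n - w)) \<longlonglongrightarrow> F w + L * norm (h - w)"
      by (intro tendsto_intros lim)
    show ?thesis using lsc[OF slope_boundD(1)[OF x] lim(1) a b] by blast
  qed
  have "0 \<le> L" by (rule LIMSEQ_le_const[OF lim(2)]) (use slope_boundD(2)[OF x] in auto)
  moreover have "F h - F w \<le> L * norm (h - w)" if "w \<in> D" for w
    using c[OF that] by linarith
  ultimately show ?thesis using c[OF zero_D] unfolding slope_bound_def by blast
qed

end

section \<open>Convergence of Euler schemes\<close>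

text \<open>Concavity of the square root. The weighted mean \<open>C\<close> is given through a
  product, as it arises in \<open>scheme_comparison\<close>.\<close>

lemma weighted_sqrt_le:
  fixes p q A B C :: real
  assumes "0 < p" "0 < q" "0 \<le> A" "0 \<le> B" and C: "(p + q) * C = p * A + q * B"
  shows "p * sqrt A + q * sqrt B \<le> (p + q) * sqrt C"
proof (rule power2_le_imp_le)
  have C0: "0 \<le> C" using assms
    by (metis add_nonneg_nonneg add_pos_pos less_imp_le mult_nonneg_nonneg zero_le_mult_iff not_le)
  have "2 * (sqrt A * sqrt B) \<le> A + B"
    using sum_squares_bound[of "sqrt A" "sqrt B"] assms by simp
  then have "(p * q) * (2 * (sqrt A * sqrt B)) \<le> (p * q) * (A + B)"
    using assms by (intro mult_left_mono) auto
  then have "(p * sqrt A + q * sqrt B)\<^sup>2 \<le> p\<^sup>2 * A + q\<^sup>2 * B + (p * q) * (A + B)"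
    using assms by (simp add: power2_sum power_mult_distrib algebra_simps)
  also have "\<dots> = (p + q) * (p * A + q * B)"
    by (simp add: power2_eq_square algebra_simps)
  also have "\<dots> = ((p + q) * sqrt C)\<^sup>2"
    unfolding C[symmetric] using C0 by (simp add: power_mult_distrib power2_eq_square)
  finally show "(p * sqrt A + q * sqrt B)\<^sup>2 \<le> ((p + q) * sqrt C)\<^sup>2" .
  show "0 \<le> (p + q) * sqrt C" using assms C0 by simp
qed

lemma norm_diff_le_add:
  fixes a b c :: "'a::real_normed_vector"
  shows "norm (a - c) \<le> norm (a - b) + norm (c - b)"
  using norm_triangle_ineq4[of "a - b" "c - b"] by simp

section \<open>Euler schemes with variable steps\<close>

context convex_energy
begin

text \<open>The step \<open>\<tau> n\<close> leads from \<open>U n\<close> to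
  \<open>U (Suc n)\<close>, so \<open>U i\<close> belongs to the time
  \<open>\<Sum>k<i. \<tau> k\<close>.\<close>

definition scheme :: "'a \<Rightarrow> (nat \<Rightarrow> real) \<Rightarrow> (nat \<Rightarrow> 'a) \<Rightarrow> bool" where
  "scheme x \<tau> U \<longleftrightarrow> U 0 = x \<and> (\<forall>n. 0 < \<tau> n \<and> U (Suc n) = J (\<tau> n) (U n))"

lemma schemeD:
  assumes "scheme x \<tau> U"
  shows "U 0 = x" "0 < \<tau> n" "U (Suc n) = J (\<tau> n) (U n)"
  using assms by (auto simp: scheme_def)

lemma scheme_H: "scheme x \<tau> U \<Longrightarrow> x \<in> H \<Longrightarrow> U n \<in> H"
  by (induction n) (auto simp: scheme_def J_H)

lemma scheme_const: "0 < \<tau> \<Longrightarrow> scheme x (\<lambda>_. \<tau>) (\<lambda>n. (J \<tau> ^^ n) x)"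
  by (simp add: scheme_def)

lemma iterate_H: "x \<in> H \<Longrightarrow> 0 < \<tau> \<Longrightarrow> (J \<tau> ^^ n) x \<in> H"
  using scheme_H[OF scheme_const] by blast

lemma iterate_nonexpansive:
  assumes "x \<in> H" "y \<in> H" "0 < \<tau>"
  shows "norm ((J \<tau> ^^ n) x - (J \<tau> ^^ n) y) \<le> norm (x - y)"
proof (induction n)
  case (Suc n)
  then show ?case
    using J_nonexpansive[OF iterate_H[OF assms(1,3)] iterate_H[OF assms(2,3)] assms(3), of n n]
    by simp
qed simp

text \<open>One step moves \<open>v\<close> by at most \<open>M * \<tau> n\<close>, and resolvents
  do not expand distances; the displacements add up.\<close>

lemma scheme_drift:
  assumes U: "scheme x \<tau> U" and x: "x \<in> H" and v: "slope_bound v M"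
  shows "norm (U n - v) \<le> norm (x - v) + M * (\<Sum>k<n. \<tau> k)"
proof (induction n)
  case 0
  then show ?case by (simp add: schemeD[OF U])
next
  case (Suc n)
  have vH: "v \<in> H" using v slope_boundD(1) in_H by blast
  note p = schemeD(2)[OF U, of n]
  have "norm (U (Suc n) - v) \<le> norm (J (\<tau> n) (U n) - J (\<tau> n) v) + norm (J (\<tau> n) v - v)"
    unfolding schemeD(3)[OF U]
    using norm_triangle_ineq[of "J (\<tau> n) (U n) - J (\<tau> n) v" "J (\<tau> n) v - v"] by simp
  also have "\<dots> \<le> norm (U n - v) + M * \<tau> n"
    using J_nonexpansive[OF scheme_H[OF U x] vH p, of n] J_step[OF v p] p
    by (simp add: norm_minus_commute pos_divide_le_eq)
  finally show ?case using Suc by (simp add: algebra_simps)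
qed

text \<open>Kobayashi's estimate: the expression under the root solves the recursion of \<open>J_double\<close>
  with equality, and the square root is concave.\<close>

lemma scheme_comparison:
  assumes U: "scheme x \<tau> U" "x \<in> H" and W: "scheme y \<sigma> W" "y \<in> H" and v: "slope_bound v M"
  shows "norm (U i - W j) \<le> norm (x - v) + norm (y - v) +
    M * sqrt (((\<Sum>k<i. \<tau> k) - (\<Sum>k<j. \<sigma> k))\<^sup>2 + (\<Sum>k<i. (\<tau> k)\<^sup>2) + (\<Sum>k<j. (\<sigma> k)\<^sup>2))"
proof (induction i arbitrary: j)
  case 0
  define s where "s = (\<Sum>k<j. \<sigma> k)"
  \<comment> \<open>With one index zero the time difference is the whole elapsed time
    \<open>s\<close>, so the root dominates the drift.\<close>
  have "s \<le> sqrt (s\<^sup>2 + (\<Sum>k<j. (\<sigma> k)\<^sup>2))" by (intro real_le_rsqrt) (simp add: sum_nonneg)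
  then have "M * s \<le> M * sqrt (s\<^sup>2 + (\<Sum>k<j. (\<sigma> k)\<^sup>2))"
    using slope_boundD(2)[OF v] by (rule mult_left_mono)
  moreover have "norm (x - W j) \<le> norm (x - v) + norm (W j - v)"
    by (rule norm_diff_le_add)
  moreover have "norm (W j - v) \<le> norm (y - v) + M * s"
    unfolding s_def by (rule scheme_drift[OF W v])
  ultimately show ?case by (simp add: schemeD(1)[OF U(1)] s_def)
next
  case (Suc i)
  note IH = this
  show ?case
  proof (induction j)
    case 0
    define s where "s = (\<Sum>k<Suc i. \<tau> k)"
    have "s \<le> sqrt (s\<^sup>2 + (\<Sum>k<Suc i. (\<tau> k)\<^sup>2))" by (intro real_le_rsqrt) (simp add: sum_nonneg del: sum.lessThan_Suc)
    then have "M * s \<le> M * sqrt (s\<^sup>2 + (\<Sum>k<Suc i. (\<tau> k)\<^sup>2))"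
      using slope_boundD(2)[OF v] by (rule mult_left_mono)
    moreover have "norm (U (Suc i) - y) \<le> norm (U (Suc i) - v) + norm (y - v)"
      by (rule norm_diff_le_add)
    moreover have "norm (U (Suc i) - v) \<le> norm (x - v) + M * s"
      unfolding s_def by (rule scheme_drift[OF U v])
    ultimately show ?case by (simp add: schemeD(1)[OF W(1)] s_def del: sum.lessThan_Suc)
  next
    case (Suc j)
    define N where "N = norm (x - v) + norm (y - v)"
    define t s where "t = (\<Sum>k<i. \<tau> k)" and "s = (\<Sum>k<j. \<sigma> k)"
    define Q where "Q = (\<Sum>k<i. (\<tau> k)\<^sup>2) + (\<Sum>k<j. (\<sigma> k)\<^sup>2)"
    define p q where "p = \<tau> i" and "q = \<sigma> j"
    have pq: "0 < p" "0 < q" unfolding p_def q_def by (auto intro: schemeD U W)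
    have Q0: "0 \<le> Q" unfolding Q_def by (intro add_nonneg_nonneg sum_nonneg) auto
    \<comment> \<open>The radicands at \<open>(i, Suc j)\<close>, \<open>(Suc i, j)\<close> and
      \<open>(Suc i, Suc j)\<close>. \<open>C\<close> is the mean of \<open>A\<close> and
      \<open>B\<close> with the weights of \<open>J_double\<close>.\<close>
    define A B C where "A = (t - (s + q))\<^sup>2 + Q + q\<^sup>2" and "B = ((t + p) - s)\<^sup>2 + Q + p\<^sup>2"
      and "C = ((t + p) - (s + q))\<^sup>2 + Q + p\<^sup>2 + q\<^sup>2"
    have a: "norm (U i - W (Suc j)) \<le> N + M * sqrt A"
      using IH[of "Suc j"] unfolding A_def N_def Q_def t_def s_def q_def by (simp add: algebra_simps)
    have b: "norm (U (Suc i) - W j) \<le> N + M * sqrt B"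
      using Suc unfolding B_def N_def Q_def t_def s_def p_def by (simp add: algebra_simps)
    have "(q + p) * C = q * A + p * B"
      unfolding A_def B_def C_def by (simp add: power2_eq_square algebra_simps)
    then have c: "q * sqrt A + p * sqrt B \<le> (q + p) * sqrt C"
      using pq Q0 unfolding A_def B_def by (intro weighted_sqrt_le) auto
    have "(p + q) * norm (U (Suc i) - W (Suc j)) \<le> q * norm (U i - W (Suc j)) + p * norm (U (Suc i) - W j)"
      using J_double[OF scheme_H[OF U] scheme_H[OF W] pq, of i j]
      unfolding schemeD(3)[OF U(1)] schemeD(3)[OF W(1)] p_def q_def .
    also have "\<dots> \<le> q * (N + M * sqrt A) + p * (N + M * sqrt B)"
      using pq a b by (intro add_mono mult_left_mono) auto
    also have "\<dots> = (p + q) * N + M * (q * sqrt A + p * sqrt B)" by (simp add: algebra_simps)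
    also have "\<dots> \<le> (p + q) * N + M * ((q + p) * sqrt C)"
      using c slope_boundD(2)[OF v] by (intro add_left_mono mult_left_mono)
    also have "\<dots> = (p + q) * (N + M * sqrt C)" by (simp add: algebra_simps)
    finally have "norm (U (Suc i) - W (Suc j)) \<le> N + M * sqrt C"
      using pq by (simp add: mult_le_cancel_left)
    then show ?case
      unfolding C_def N_def Q_def t_def s_def p_def q_def by (simp add: algebra_simps)
  qed
qed

text \<open>Points of \<open>D\<close> are dense but need not have a finite slope. One short
  proximal step moves such a point only slightly and makes the slope finite.\<close>

lemma dense_slope_bound:
  assumes x: "x \<in> H" and e: "0 < e"
  obtains v M where "slope_bound v M" "norm (x - v) < e"
proof -
  obtain u where u: "u \<in> D" "dist u x < e / 2"
    using dense_D x e closure_approachable[of x D] by (meson half_gt_zero subsetD)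
  note uH = in_H[OF u(1)]
  define c where "c = F u - F 0"
  have c: "0 \<le> c" using min_0[OF u(1)] by (simp add: c_def)
  \<comment> \<open>The step moves \<open>u\<close> by at most \<open>sqrt (2 * \<tau> * c)\<close>;
    this choice keeps that below \<open>e / 2\<close>, and \<open>c + 1\<close> covers the case
    \<open>c = 0\<close>.\<close>
  define \<tau> where "\<tau> = e\<^sup>2 / (16 * (c + 1))"
  have \<tau>: "0 < \<tau>" using e c by (simp add: \<tau>_def)
  let ?v = "J \<tau> u"
  have "F ?v + (norm (u - ?v))\<^sup>2 / (2 * \<tau>) \<le> F u"
    using J_min[OF uH \<tau> u(1)] by (simp add: yosida_def)
  then have "(norm (u - ?v))\<^sup>2 / (2 * \<tau>) \<le> c"
    using min_0[OF J_D[OF uH \<tau>]] by (simp add: c_def)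
  then have "(norm (u - ?v))\<^sup>2 \<le> 2 * \<tau> * c" using \<tau> by (simp add: field_simps)
  also have "\<dots> = e\<^sup>2 / 8 * (c / (c + 1))" using c by (simp add: \<tau>_def field_simps)
  also have "\<dots> \<le> e\<^sup>2 / 8 * 1" using c by (intro mult_left_mono) auto
  also have "\<dots> < (e / 2)\<^sup>2" using e by (simp add: power_divide)
  finally have "norm (u - ?v) < e / 2"
    by (rule power_less_imp_less_base) (use e in simp)
  moreover have "norm (x - ?v) \<le> norm (u - x) + norm (u - ?v)"
    using norm_diff_le_add[of x ?v u] by (simp add: norm_minus_commute)
  ultimately have "norm (x - ?v) < e" using u(2) by (simp add: dist_norm)
  then show thesis using that slope_bound_J_increment[OF uH \<tau>] by blast
qed

section \<open>Uniform closeness of fine schemes\<close>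

lemma sum_squares_le_mesh:
  fixes \<tau> :: "nat \<Rightarrow> real"
  assumes "\<And>k. k < n \<Longrightarrow> 0 \<le> \<tau> k \<and> \<tau> k \<le> d"
  shows "(\<Sum>k<n. (\<tau> k)\<^sup>2) \<le> d * (\<Sum>k<n. \<tau> k)"
  unfolding sum_distrib_left
  by (rule sum_mono) (use assms in \<open>auto simp: power2_eq_square intro: mult_right_mono\<close>)

text \<open>The schemes are quantified after \<open>d\<close>: one bound on mesh and time gap serves
  all pairs of schemes from \<open>x\<close> up to time \<open>T\<close>. In Kobayashi's estimate
  \<open>v\<close> is taken close to \<open>x\<close>; this fixes \<open>M\<close>, and the radicand
  is then made small.\<close>

lemma scheme_close:
  assumes x: "x \<in> H" and e: "0 < e" and T: "0 \<le> T"
  shows "\<exists>d>0. \<forall>\<tau> \<sigma> U W i j. scheme x \<tau> U \<longrightarrow> scheme x \<sigma> W \<longrightarrow> (\<forall>k<i. \<tau> k \<le> d) \<longrightarrow> (\<forall>k<j. \<sigma> k \<le> d) \<longrightarrow>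
    (\<Sum>k<i. \<tau> k) \<le> T \<longrightarrow> (\<Sum>k<j. \<sigma> k) \<le> T \<longrightarrow> \<bar>(\<Sum>k<i. \<tau> k) - (\<Sum>k<j. \<sigma> k)\<bar> \<le> d \<longrightarrow>
    norm (U i - W j) \<le> e"
proof -
  obtain v M where v: "slope_bound v M" and xv: "norm (x - v) < e / 4"
    using dense_slope_bound[OF x, of "e / 4"] e by auto
  \<comment> \<open>The radicand is at most \<open>d * (1 + 2 * T)\<close>, and \<open>c\<close>
    makes \<open>M\<close> times its root at most \<open>e / 2\<close>; \<open>M\<^sup>2 + 1\<close>
    avoids a division by zero.\<close>
  define c where "c = (e / 2)\<^sup>2 / ((M\<^sup>2 + 1) * (1 + 2 * T))"
  have c: "0 < c" using e T by (simp add: c_def add_nonneg_pos add_pos_nonneg)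
  define d where "d = min 1 c"
  have d: "0 < d" "d \<le> 1" "d \<le> c" using c by (auto simp: d_def)
  have "norm (U i - W j) \<le> e"
    if U: "scheme x \<tau> U" and W: "scheme x \<sigma> W" and \<tau>: "\<forall>k<i. \<tau> k \<le> d" and \<sigma>: "\<forall>k<j. \<sigma> k \<le> d"
      and t: "(\<Sum>k<i. \<tau> k) \<le> T" "(\<Sum>k<j. \<sigma> k) \<le> T" "\<bar>(\<Sum>k<i. \<tau> k) - (\<Sum>k<j. \<sigma> k)\<bar> \<le> d"
    for \<tau> \<sigma> U W i j
  proof -
    have 1: "(\<Sum>k<i. (\<tau> k)\<^sup>2) \<le> d * T"
      using sum_squares_le_mesh[of i \<tau> d] \<tau> t(1) d(1) schemeD(2)[OF U] less_imp_le
      by (meson mult_left_mono order_trans)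
    have 2: "(\<Sum>k<j. (\<sigma> k)\<^sup>2) \<le> d * T"
      using sum_squares_le_mesh[of j \<sigma> d] \<sigma> t(2) d(1) schemeD(2)[OF W] less_imp_le
      by (meson mult_left_mono order_trans)
    have 3: "((\<Sum>k<i. \<tau> k) - (\<Sum>k<j. \<sigma> k))\<^sup>2 \<le> d * 1"
    proof -
      have "\<bar>(\<Sum>k<i. \<tau> k) - (\<Sum>k<j. \<sigma> k)\<bar>\<^sup>2 \<le> d\<^sup>2" using t(3) by (rule power_mono) simp
      also have "\<dots> \<le> d * 1" unfolding power2_eq_square using d by (intro mult_left_mono) auto
      finally show ?thesis by simp
    qed
    let ?Q = "((\<Sum>k<i. \<tau> k) - (\<Sum>k<j. \<sigma> k))\<^sup>2 + (\<Sum>k<i. (\<tau> k)\<^sup>2) + (\<Sum>k<j. (\<sigma> k)\<^sup>2)"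
    have "?Q \<le> d * (1 + 2 * T)" using 1 2 3 by (simp add: algebra_simps)
    also have "\<dots> \<le> c * (1 + 2 * T)" using d T by (intro mult_right_mono) auto
    also have "\<dots> = (e / 2)\<^sup>2 / (M\<^sup>2 + 1)" using T by (simp add: c_def)
    finally have "M\<^sup>2 * ?Q \<le> M\<^sup>2 * ((e / 2)\<^sup>2 / (M\<^sup>2 + 1))" by (rule mult_left_mono) simp
    also have "\<dots> = (e / 2)\<^sup>2 * (M\<^sup>2 / (M\<^sup>2 + 1))" by simp
    also have "\<dots> \<le> (e / 2)\<^sup>2 * 1" 
      by (intro mult_left_mono) (auto simp: divide_le_eq_1 intro: add_nonneg_pos)
    finally have "sqrt (M\<^sup>2 * ?Q) \<le> e / 2" using e by (intro real_le_lsqrt) auto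
    then have "M * sqrt ?Q \<le> e / 2" using slope_boundD(2)[OF v] by (simp add: real_sqrt_mult)
    then show ?thesis using scheme_comparison[OF U x W x v, of i j] xv by linarith
  qed
  then show ?thesis using d(1) by blast
qed

section \<open>The limit semigroup and its exponential formula\<close>

definition S :: "real \<Rightarrow> 'a \<Rightarrow> 'a" where
  "S t x = (if t = 0 then x else lim (\<lambda>n. (J (t / real n) ^^ n) x))"

text \<open>Time zero has its own clause in \<open>S\<close> because \<open>J 0\<close> is not the
  identity: division by zero removes the penalty from \<open>yosida\<close>.\<close>

lemma S_0 [simp]: "S 0 x = x"
  by (simp add: S_def)

lemma S_LIMSEQ:
  assumes x: "x \<in> H" and t: "0 < t"
  shows "(\<lambda>n. (J (t / real n) ^^ n) x) \<longlonglongrightarrow> S t x" "S t x \<in> H"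
proof -
  \<comment> \<open>The index starts at one because \<open>t / real 0\<close> is not a step
    size.\<close>
  let ?w = "\<lambda>n. (J (t / real (Suc n)) ^^ Suc n) x"
  have w: "scheme x (\<lambda>_. t / real (Suc n)) (\<lambda>k. (J (t / real (Suc n)) ^^ k) x)" for n
    using t by (intro scheme_const) simp
  have "Cauchy ?w"
  proof (rule metric_CauchyI)
    fix e :: real assume e: "0 < e"
    obtain d where d: "0 < d" and close: "\<And>\<tau> \<sigma> U W i j. scheme x \<tau> U \<Longrightarrow> scheme x \<sigma> W \<Longrightarrow> \<forall>k<i. \<tau> k \<le> d \<Longrightarrow> \<forall>k<j. \<sigma> k \<le> d \<Longrightarrow>
      (\<Sum>k<i. \<tau> k) \<le> t \<Longrightarrow> (\<Sum>k<j. \<sigma> k) \<le> t \<Longrightarrow> \<bar>(\<Sum>k<i. \<tau> k) - (\<Sum>k<j. \<sigma> k)\<bar> \<le> d \<Longrightarrow> norm (U i - W j) \<le> e / 2"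
      using scheme_close[OF x, of "e / 2" t] e t by (metis half_gt_zero less_imp_le)
    obtain N where N: "t / d < real N" using reals_Archimedean2 by blast
    have "dist (?w m) (?w n) < e" if "m \<ge> N" "n \<ge> N" for m n
    proof -
      have "t / real (Suc k) \<le> d" if "k \<ge> N" for k
      proof -
        have "t / d < real (Suc k)" using that N by linarith
        then show ?thesis using d by (simp add: field_simps)
      qed
      then have "norm (?w m - ?w n) \<le> e / 2"
        using that d by (intro close[OF w w]) (auto simp del: of_nat_Suc)
      then show ?thesis using e by (simp add: dist_norm)
    qed
    then show "\<exists>M. \<forall>m\<ge>M. \<forall>n\<ge>M. dist (?w m) (?w n) < e" by blast
  qed
  moreover have "?w n \<in> H" for n
    using iterate_H[OF x, of "t / real (Suc n)" "Suc n"] t by (simp del: funpow.simps)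
  ultimately obtain y where y: "y \<in> H" "?w \<longlonglongrightarrow> y"
    using Cauchy_limit_H[of ?w] by metis
  then have *: "(\<lambda>n. (J (t / real n) ^^ n) x) \<longlonglongrightarrow> y"
    using filterlim_sequentially_Suc[of "\<lambda>n. (J (t / real n) ^^ n) x" "nhds y", THEN iffD1] by simp
  then have "S t x = y" using t by (simp add: S_def limI)
  then show "(\<lambda>n. (J (t / real n) ^^ n) x) \<longlonglongrightarrow> S t x" "S t x \<in> H" using * y by auto
qed

lemma S_H: "x \<in> H \<Longrightarrow> 0 \<le> t \<Longrightarrow> S t x \<in> H"
  using S_LIMSEQ(2) by (cases "t = 0") auto

text \<open>In \<open>scheme_close\<close> the second scheme is taken from the exponential formula
  and sent to its limit. The estimate stays uniform in the scheme and in \<open>t \<le> T\<close>,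
  as arbitrary partitions and the semigroup law require.\<close>

lemma scheme_limit:
  assumes x: "x \<in> H" and e: "0 < e" and T: "0 \<le> T"
  obtains d where "0 < d" "\<And>t \<tau> U i. 0 \<le> t \<Longrightarrow> t \<le> T \<Longrightarrow> scheme x \<tau> U \<Longrightarrow> \<forall>k<i. \<tau> k \<le> d \<Longrightarrow>
    \<bar>(\<Sum>k<i. \<tau> k) - t\<bar> \<le> d \<Longrightarrow> norm (U i - S t x) \<le> e"
proof -
  \<comment> \<open>The horizon is enlarged by one because the elapsed time of \<open>U i\<close>
    may exceed \<open>t\<close>.\<close>
  obtain d where d: "0 < d" and close: "\<And>\<tau> \<sigma> U W i j. scheme x \<tau> U \<Longrightarrow> scheme x \<sigma> W \<Longrightarrow> \<forall>k<i. \<tau> k \<le> d \<Longrightarrow> \<forall>k<j. \<sigma> k \<le> d \<Longrightarrow>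
      (\<Sum>k<i. \<tau> k) \<le> T + 1 \<Longrightarrow> (\<Sum>k<j. \<sigma> k) \<le> T + 1 \<Longrightarrow> \<bar>(\<Sum>k<i. \<tau> k) - (\<Sum>k<j. \<sigma> k)\<bar> \<le> d \<Longrightarrow> norm (U i - W j) \<le> e"
    using scheme_close[OF x e, of "T + 1"] T by (metis add_nonneg_nonneg zero_le_one)
  have "norm (U i - S t x) \<le> e"
    if t: "0 \<le> t" "t \<le> T" and U: "scheme x \<tau> U" and \<tau>: "\<forall>k<i. \<tau> k \<le> min 1 d"
      and i: "\<bar>(\<Sum>k<i. \<tau> k) - t\<bar> \<le> min 1 d" for t \<tau> U i
  proof (cases "t = 0")
    case True
    have "norm (U i - (J 1 ^^ 0) x) \<le> e"
      by (rule close[OF U scheme_const[of 1]]) (use \<tau> i t True in auto)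
    then show ?thesis using True by simp
  next
    case False
    then have t0: "0 < t" using t by simp
    show ?thesis
    proof (rule tendsto_upperbound)
      show "(\<lambda>n. norm (U i - (J (t / real n) ^^ n) x)) \<longlonglongrightarrow> norm (U i - S t x)"
        by (intro tendsto_intros S_LIMSEQ x t0)
      obtain N where N: "t / d < real N" using reals_Archimedean2 by blast
      show "\<forall>\<^sub>F n in sequentially. norm (U i - (J (t / real n) ^^ n) x) \<le> e"
        unfolding eventually_sequentially
      proof (intro exI allI impI)
        fix n assume "n \<ge> max 1 N"
        then have n: "0 < n" "t / d < real n" using N by auto
        then have "t / real n \<le> d" using d by (simp add: field_simps)
        then show "norm (U i - (J (t / real n) ^^ n) x) \<le> e"
          using n t0 t \<tau> i by (intro close[OF U scheme_const[of "t / real n"]]) auto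
      qed
    qed simp
  qed
  then show thesis using that[of "min 1 d"] d by auto
qed

lemma S_nonexpansive:
  assumes "x \<in> H" "y \<in> H" "0 \<le> t"
  shows "norm (S t x - S t y) \<le> norm (x - y)"
proof (cases "t = 0")
  case False
  then have t: "0 < t" using assms by simp
  show ?thesis
  proof (rule tendsto_upperbound)
    show "(\<lambda>n. norm ((J (t / real n) ^^ n) x - (J (t / real n) ^^ n) y)) \<longlonglongrightarrow> norm (S t x - S t y)"
      by (intro tendsto_intros S_LIMSEQ assms t)
    show "\<forall>\<^sub>F n in sequentially. norm ((J (t / real n) ^^ n) x - (J (t / real n) ^^ n) y) \<le> norm (x - y)"
      using eventually_gt_at_top[of 0]
      by eventually_elim (use t in \<open>intro iterate_nonexpansive assms; simp\<close>)
  qed simp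
qed simp

text \<open>One scheme of small constant step is split after \<open>n\<close> steps. Its first part
  approximates \<open>S t x\<close>, the whole approximates \<open>S (s + t) x\<close>, and
  nonexpansiveness carries the error of the first part through the second.\<close>

lemma S_semigroup:
  assumes x: "x \<in> H" and s: "0 \<le> s" and t: "0 \<le> t"
  shows "S (s + t) x = S s (S t x)"
proof -
  note yH = S_H[OF x t]
  have "norm (S (s + t) x - S s (S t x)) \<le> 0 + e" if e: "0 < e" for e
  proof -
    obtain d1 where d1: "0 < d1" and lim1: "\<And>u \<tau> U i. 0 \<le> u \<Longrightarrow> u \<le> s + t \<Longrightarrow> scheme x \<tau> U \<Longrightarrow> \<forall>k<i. \<tau> k \<le> d1 \<Longrightarrow>
        \<bar>(\<Sum>k<i. \<tau> k) - u\<bar> \<le> d1 \<Longrightarrow> norm (U i - S u x) \<le> e / 3"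
      using scheme_limit[OF x, of "e / 3" "s + t"] e s t by auto
    obtain d2 where d2: "0 < d2" and lim2: "\<And>u \<tau> U i. 0 \<le> u \<Longrightarrow> u \<le> s \<Longrightarrow> scheme (S t x) \<tau> U \<Longrightarrow> \<forall>k<i. \<tau> k \<le> d2 \<Longrightarrow>
        \<bar>(\<Sum>k<i. \<tau> k) - u\<bar> \<le> d2 \<Longrightarrow> norm (U i - S u (S t x)) \<le> e / 3"
      using scheme_limit[OF yH, of "e / 3" s] e s by auto
    define \<tau> where "\<tau> = min d1 d2 / 2"
    have \<tau>: "0 < \<tau>" "2 * \<tau> \<le> d1" "2 * \<tau> \<le> d2" using d1 d2 by (auto simp: \<tau>_def)
    \<comment> \<open>Rounding up to whole steps gives a time error of at most \<open>\<tau>\<close>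
      for each part and \<open>2 * \<tau>\<close> for the sum, hence the half in the choice of
      \<open>\<tau>\<close>.\<close>
    define m n where "m = nat \<lceil>s / \<tau>\<rceil>" and "n = nat \<lceil>t / \<tau>\<rceil>"
    have round: "\<bar>real (nat \<lceil>r / \<tau>\<rceil>) * \<tau> - r\<bar> \<le> \<tau>" if "0 \<le> r" for r
    proof -
      have "0 \<le> r / \<tau>" using that \<tau> by simp
      then have "r / \<tau> \<le> real (nat \<lceil>r / \<tau>\<rceil>)" "real (nat \<lceil>r / \<tau>\<rceil>) \<le> r / \<tau> + 1" by linarith+
      then have "r \<le> real (nat \<lceil>r / \<tau>\<rceil>) * \<tau>" "real (nat \<lceil>r / \<tau>\<rceil>) * \<tau> \<le> r + \<tau>"
        using \<tau> by (simp_all add: field_simps)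
      then show ?thesis by linarith
    qed
    have m: "\<bar>real m * \<tau> - s\<bar> \<le> \<tau>" and n: "\<bar>real n * \<tau> - t\<bar> \<le> \<tau>"
      unfolding m_def n_def using round s t by auto
    have "norm ((J \<tau> ^^ (m + n)) x - S (s + t) x) \<le> e / 3"
      by (rule lim1[OF _ _ scheme_const[OF \<tau>(1)]]) (use m n s t \<tau> in \<open>auto simp: algebra_simps\<close>)
    moreover have "norm ((J \<tau> ^^ n) x - S t x) \<le> e / 3"
      by (rule lim1[OF _ _ scheme_const[OF \<tau>(1)]]) (use m n s t \<tau> in \<open>auto simp: algebra_simps\<close>)
    moreover have "norm ((J \<tau> ^^ m) (S t x) - S s (S t x)) \<le> e / 3"
      by (rule lim2[OF _ _ scheme_const[OF \<tau>(1)]]) (use m n s t \<tau> in \<open>auto simp: algebra_simps\<close>)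
    moreover have "norm ((J \<tau> ^^ m) ((J \<tau> ^^ n) x) - (J \<tau> ^^ m) (S t x)) \<le> norm ((J \<tau> ^^ n) x - S t x)"
      by (rule iterate_nonexpansive[OF iterate_H[OF x \<tau>(1)] yH \<tau>(1)])
    moreover have four: "norm (A - D) \<le> norm (B - A) + norm (B - C) + norm (C - D)" for A B C D :: 'a
      using norm_triangle_ineq[of "B - C" "C - D"] norm_triangle_ineq[of "A - B" "B - D"]
      by (simp add: norm_minus_commute)
    moreover note four[of "S (s + t) x" "S s (S t x)" "(J \<tau> ^^ m) ((J \<tau> ^^ n) x)" "(J \<tau> ^^ m) (S t x)"]
    ultimately show ?thesis
      unfolding funpow_add o_apply by linarith
  qed
  then have "norm (S (s + t) x - S s (S t x)) \<le> 0" by (rule field_le_epsilon)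
  then show ?thesis by simp
qed

section \<open>Slope, drift and energy along the scheme\<close>

lemma iterate_slope_bound:
  assumes "slope_bound x M" "0 < \<tau>"
  shows "slope_bound ((J \<tau> ^^ n) x) M"
  by (induction n) (auto simp: assms slope_bound_J)

lemma
  assumes x: "slope_bound x M" and t: "0 \<le> t"
  shows S_slope_bound: "slope_bound (S t x) M"
    and S_drift: "norm (S t x - x) \<le> M * t"
proof -
  have xH: "x \<in> H" using slope_boundD(1)[OF x] in_H by blast
  have "slope_bound (S t x) M \<and> norm (S t x - x) \<le> M * t" if t: "0 < t"
  proof
    let ?w = "\<lambda>n. (J (t / real (Suc n)) ^^ Suc n) x"
    have w: "?w \<longlonglongrightarrow> S t x"
      using filterlim_sequentially_Suc[THEN iffD2, OF S_LIMSEQ(1)[OF xH t]] .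
    have "slope_bound (?w n) M" for n
      by (rule iterate_slope_bound[OF x]) (use t in simp)
    then show "slope_bound (S t x) M" by (rule slope_bound_limit[OF _ w tendsto_const])
    show "norm (S t x - x) \<le> M * t"
    proof (rule tendsto_upperbound)
      show "(\<lambda>n. norm (?w n - x)) \<longlonglongrightarrow> norm (S t x - x)" by (intro tendsto_intros w)
      have "norm (?w n - x) \<le> M * t" for n
        using scheme_drift[OF scheme_const[of "t / real (Suc n)"] xH x, of "Suc n"] t
        by (simp del: of_nat_Suc funpow.simps)
      then show "\<forall>\<^sub>F n in sequentially. norm (?w n - x) \<le> M * t" by simp
    qed simp
  qed
  then show "slope_bound (S t x) M" "norm (S t x - x) \<le> M * t" using x t by (cases "t = 0"; simp)+
qed

text \<open>Discrete form of the Lyapunov function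
  \<open>norm (u - v)^2 / 2 + t * (F u - F v) + t^2 / 2 * norm u'^2\<close> of a gradient flow, with
  \<open>n * (n - 1)\<close> in place of \<open>n^2\<close>. For \<open>n = 0\<close> the increment
  term has coefficient zero.\<close>

lemma discrete_energy_estimate:
  assumes x: "x \<in> H" and \<tau>: "0 < \<tau>" and v: "v \<in> D"
  defines "X \<equiv> \<lambda>n. (J \<tau> ^^ n) x"
  shows "(norm (X n - v))\<^sup>2 / 2 + real n * \<tau> * F (X n)
      + real n * (real n - 1) / 2 * (norm (X (n - 1) - X n))\<^sup>2
    \<le> (norm (x - v))\<^sup>2 / 2 + real n * \<tau> * F v"
proof (induction n)
  case 0
  then show ?case by (simp add: X_def)
next
  case (Suc n)
  have XH: "X n \<in> H" unfolding X_def by (rule iterate_H[OF x \<tau>])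
  have X: "X (Suc n) = J \<tau> (X n)" by (simp add: X_def)
  define g where "g = (norm (X n - X (Suc n)))\<^sup>2"
  have 1: "(norm (X (Suc n) - v))\<^sup>2 / 2 \<le> (norm (X n - v))\<^sup>2 / 2 + \<tau> * F v - \<tau> * F (X (Suc n))"
  proof -
    have "F (X (Suc n)) + ((X n - X (Suc n)) \<bullet> (v - X (Suc n))) / \<tau> \<le> F v"
      using variational'[OF XH \<tau> v] unfolding X by (simp add: divide_inverse_commute)
    then have "(X n - X (Suc n)) \<bullet> (v - X (Suc n)) \<le> \<tau> * F v - \<tau> * F (X (Suc n))"
      using \<tau> by (simp add: field_simps)
    moreover have "(norm (X (Suc n) - v))\<^sup>2 / 2 + g / 2 - (norm (X n - v))\<^sup>2 / 2 = (X n - X (Suc n)) \<bullet> (v - X (Suc n))"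
      by (simp add: g_def power2_norm_eq_inner inner_simps inner_commute field_simps)
    moreover have "0 \<le> g" by (simp add: g_def)
    ultimately show ?thesis by linarith
  qed
  have split: "real (Suc n) * \<tau> * a = \<tau> * a + real n * \<tau> * a" for a
    by (simp add: algebra_simps)
  \<comment> \<open>The coefficient of the increment grows by \<open>n\<close>; these
    \<open>n\<close> squared increments are paid for by the energy drop, which is at least
    \<open>g\<close> after multiplication by \<open>\<tau>\<close>. The others use that increments
    do not grow.\<close>
  have "real n * (\<tau> * F (X (Suc n)) + g) + real n * (real n - 1) / 2 * g \<le>
    real n * (\<tau> * F (X n)) + real n * (real n - 1) / 2 * (norm (X (n - 1) - X n))\<^sup>2"
  proof (cases n)
    case (Suc k)
    have XkH: "X k \<in> H" unfolding X_def by (rule iterate_H[OF x \<tau>])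
    have Xn: "X n = J \<tau> (X k)" unfolding Suc by (simp add: X_def)
    have XD: "X n \<in> D" unfolding Xn by (rule J_D[OF XkH \<tau>])
    have "F (X (Suc n)) + g / \<tau> \<le> F (X n)"
      using variational'[OF XH \<tau> XD] unfolding X g_def by (simp add: divide_inverse_commute power2_norm_eq_inner)
    then have a: "\<tau> * F (X (Suc n)) + g \<le> \<tau> * F (X n)" using \<tau> by (simp add: field_simps)
    have "norm (X n - X (Suc n)) / \<tau> \<le> norm (X k - X n) / \<tau>"
      unfolding X using J_step[OF slope_bound_J_increment[OF XkH \<tau>] \<tau>] unfolding Xn .
    then have b: "g \<le> (norm (X (n - 1) - X n))\<^sup>2"
      using \<tau> unfolding g_def Suc by (simp add: divide_le_cancel power_mono)
    have "0 \<le> real n * (real n - 1) / 2" using Suc by simp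
    then show ?thesis using a b by (intro add_mono mult_left_mono) auto
  qed simp
  moreover have "real (Suc n) * (real (Suc n) - 1) / 2 * g = real n * g + real n * (real n - 1) / 2 * g"
    by (simp add: field_simps)
  moreover have "real n * (\<tau> * F (X (Suc n)) + g) = real n * (\<tau> * F (X (Suc n))) + real n * g"
    by (rule distrib_left)
  moreover define p q r where "p = real n * \<tau>" and "q = real n * (real n - 1) / 2 * (norm (X (n - 1) - X n))\<^sup>2"
    and "r = real n * (real n - 1) / 2 * g"
  moreover have "real (Suc n) * \<tau> * F (X (Suc n)) = \<tau> * F (X (Suc n)) + p * F (X (Suc n))"
    "real (Suc n) * \<tau> * F v = \<tau> * F v + p * F v"
    "real n * (\<tau> * F (X n)) = p * F (X n)" "real n * (\<tau> * F (X (Suc n))) = p * F (X (Suc n))"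
    by (simp_all add: p_def algebra_simps)
  ultimately show ?case
    using Suc.IH 1 unfolding diff_Suc_1 g_def[symmetric] p_def[symmetric] q_def[symmetric]
    by linarith
qed

end

section \<open>Regularity of the flow\<close>

lemma norm_midpoint_le:
  fixes a b y :: "'a::real_normed_vector"
  shows "norm (midpoint a b - y) \<le> norm (a - y) / 2 + norm (b - y) / 2"
proof -
  have "2 *\<^sub>R (midpoint a b - y) = (a - y) + (b - y)"
    by (simp add: midpoint_def algebra_simps scaleR_2)
  then have "2 * norm (midpoint a b - y) = norm ((a - y) + (b - y))"
    by (metis abs_numeral norm_scaleR)
  then show ?thesis using norm_triangle_ineq[of "a - y" "b - y"] by linarith
qed

section \<open>Decay, energy estimate and slope regularization\<close>

context convex_energy
begin

text \<open>Uniform convexity on the segment from the minimizer \<open>0\<close> to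
  \<open>u\<close>, divided by the parameter.\<close>

lemma growth:
  assumes u: "u \<in> D"
  shows "F 0 + l / 2 * (norm u)\<^sup>2 \<le> F u"
proof -
  have "F 0 + l / 2 * (norm u)\<^sup>2 \<le> F u + s * (l / 2 * (norm u)\<^sup>2)" if s: "0 < s" "s \<le> 1" for s
  proof -
    let ?w = "(1 - s) *\<^sub>R 0 + s *\<^sub>R u"
    have "F 0 \<le> (1 - s) * F 0 + s * F u - l / 2 * (s * (1 - s)) * (norm (0 - u))\<^sup>2"
      using min_0[OF convex_D[OF zero_D u, of s]] convex_F[OF zero_D u, of s] s by simp
    then have "s * (F 0 + l / 2 * (norm u)\<^sup>2) \<le> s * (F u + s * (l / 2 * (norm u)\<^sup>2))"
      by (simp add: algebra_simps diff_divide_distrib)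
    then show ?thesis using s by (simp only: mult_le_cancel_left_pos)
  qed
  then show ?thesis by (rule le_of_mult_pos_limit)
qed

text \<open>The variational inequality tested at \<open>0\<close> and the growth of \<open>F\<close>
  supply \<open>l / 2\<close> each; together they give the full rate \<open>l\<close>.\<close>

lemma J_contracts_to_zero:
  assumes h: "h \<in> H" and \<tau>: "0 < \<tau>"
  shows "(1 + \<tau> * l) * norm (J \<tau> h) \<le> norm h"
proof -
  define u where "u = J \<tau> h"
  have "F u + ((h - u) \<bullet> (0 - u)) / \<tau> + l / 2 * (norm (0 - u))\<^sup>2 \<le> F 0"
    using variational[OF h \<tau> zero_D] unfolding u_def inner_scaleR_left divide_inverse_commute .
  then have "l * (norm u)\<^sup>2 + ((h - u) \<bullet> (0 - u)) / \<tau> \<le> 0"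
    using growth[OF J_D[OF h \<tau>], folded u_def] by simp
  then have "\<tau> * l * (norm u)\<^sup>2 + (h - u) \<bullet> (0 - u) \<le> 0"
    using \<tau> by (simp add: field_simps)
  then have "(1 + \<tau> * l) * (norm u)\<^sup>2 \<le> h \<bullet> u"
    by (simp add: power2_norm_eq_inner inner_simps algebra_simps)
  also have "\<dots> \<le> norm h * norm u" by (rule norm_cauchy_schwarz)
  finally have "norm u * ((1 + \<tau> * l) * norm u) \<le> norm u * norm h"
    by (simp add: power2_eq_square mult_ac)
  then show ?thesis unfolding u_def[symmetric]
    by (cases "norm u = 0") (auto simp: mult_le_cancel_left)
qed

text \<open>The factors \<open>1 + t * l / n\<close> of \<open>n\<close> steps accumulate to
  \<open>exp (t * l)\<close> in the limit.\<close>

lemma S_decay: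
  assumes x: "x \<in> H" and t: "0 \<le> t"
  shows "norm (S t x) \<le> exp (- l * t) * norm x"
proof (cases "t = 0")
  case False
  then have t: "0 < t" using t by simp
  have it: "(1 + \<tau> * l) ^ n * norm ((J \<tau> ^^ n) x) \<le> norm x" if \<tau>: "0 < \<tau>" for \<tau> n
  proof (induction n)
    case (Suc n)
    have "(1 + \<tau> * l) ^ n * ((1 + \<tau> * l) * norm (J \<tau> ((J \<tau> ^^ n) x))) \<le> (1 + \<tau> * l) ^ n * norm ((J \<tau> ^^ n) x)"
      using \<tau> l_pos by (intro mult_left_mono J_contracts_to_zero iterate_H x) auto
    then show ?case using Suc by (simp add: mult_ac)
  qed simp
  have "exp (t * l) * norm (S t x) \<le> norm x"
  proof (rule tendsto_upperbound)
    show "(\<lambda>n. (1 + (t * l) / real n) ^ n * norm ((J (t / real n) ^^ n) x)) \<longlonglongrightarrow> exp (t * l) * norm (S t x)"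
      by (intro tendsto_intros tendsto_exp_limit_sequentially S_LIMSEQ x t)
    show "\<forall>\<^sub>F n in sequentially. (1 + (t * l) / real n) ^ n * norm ((J (t / real n) ^^ n) x) \<le> norm x"
      using eventually_gt_at_top[of 0]
    proof eventually_elim
      case (elim n)
      then show ?case using it[of "t / real n" n] t by simp
    qed
  qed simp
  then have "norm (S t x) \<le> norm x / exp (t * l)" by (simp add: field_simps)
  then show ?thesis by (simp add: exp_minus divide_inverse mult_ac)
qed simp

text \<open>The distance term on the left is kept because \<open>quot_subgradient\<close> is derived
  from it; the varying bound \<open>c n\<close> lets it pass to the limit through
  \<open>lsc\<close>.\<close>

lemma S_energy_estimate:
  assumes x: "x \<in> H" and t: "0 < t" and v: "v \<in> D"
  shows "S t x \<in> D" "(norm (S t x - v))\<^sup>2 / 2 + t * F (S t x) \<le> (norm (x - v))\<^sup>2 / 2 + t * F v"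
proof -
  define X where "X n = (J (t / real (Suc n)) ^^ Suc n) x" for n
  have X: "X \<longlonglongrightarrow> S t x"
    unfolding X_def using filterlim_sequentially_Suc[THEN iffD2, OF S_LIMSEQ(1)[OF x t]] .
  have XD: "X n \<in> D" for n
    using J_D[OF iterate_H[OF x]] t by (simp add: X_def)
  define c where "c n = ((norm (x - v))\<^sup>2 / 2 + t * F v - (norm (X n - v))\<^sup>2 / 2) / t" for n
  have "F (X n) \<le> c n" for n
  proof -
    let ?N = "Suc n"
    have "(norm (X n - v))\<^sup>2 / 2 + real ?N * (t / real ?N) * F (X n)
      + real ?N * (real ?N - 1) / 2 * (norm ((J (t / real ?N) ^^ (?N - 1)) x - X n))\<^sup>2
      \<le> (norm (x - v))\<^sup>2 / 2 + real ?N * (t / real ?N) * F v"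
      unfolding X_def by (rule discrete_energy_estimate[OF x _ v]) (use t in simp)
    moreover have "0 \<le> real ?N * (real ?N - 1) / 2 * (norm ((J (t / real ?N) ^^ (?N - 1)) x - X n))\<^sup>2"
      by (intro mult_nonneg_nonneg divide_nonneg_nonneg) auto
    moreover have Nt: "real ?N * (t / real ?N) = t" by simp
    ultimately have "(norm (X n - v))\<^sup>2 / 2 + t * F (X n) \<le> (norm (x - v))\<^sup>2 / 2 + t * F v"
      unfolding Nt by linarith
    then show ?thesis using t by (simp add: c_def field_simps)
  qed
  moreover have "c \<longlonglongrightarrow> ((norm (x - v))\<^sup>2 / 2 + t * F v - (norm (S t x - v))\<^sup>2 / 2) / t"
    unfolding c_def using t by (intro tendsto_intros X) auto
  ultimately have *: "S t x \<in> D" "F (S t x) \<le> ((norm (x - v))\<^sup>2 / 2 + t * F v - (norm (S t x - v))\<^sup>2 / 2) / t"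
    using lsc[OF XD X] by blast+
  show "S t x \<in> D" by fact
  show "(norm (S t x - v))\<^sup>2 / 2 + t * F (S t x) \<le> (norm (x - v))\<^sup>2 / 2 + t * F v"
    using *(2) t by (simp add: field_simps)
qed

text \<open>Here the increment term of the discrete estimate is used: it controls the slope at
  \<open>X n\<close>. The energy gain \<open>t * (F v - F (X n))\<close> is absorbed by Young's
  inequality, at the cost of \<open>t\<^sup>2 * M\<^sup>2 / 2\<close> and of exactly the distance
  term on the left.\<close>

lemma S_regularizes:
  assumes x: "x \<in> H" and t: "0 < t" and v: "slope_bound v M"
  shows "slope_bound (S t x) (sqrt (M\<^sup>2 + (norm (v - x))\<^sup>2 / t\<^sup>2))"
proof -
  define R where "R = M\<^sup>2 + (norm (v - x))\<^sup>2 / t\<^sup>2"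
  have R0: "0 \<le> R" by (simp add: R_def)
  note vD = slope_boundD(1)[OF v] and M0 = slope_boundD(2)[OF v]
  \<comment> \<open>At least two steps, so that \<open>N - 1\<close> is positive in the factor
    \<open>N / (N - 1)\<close>, which tends to one.\<close>
  define X where "X n = (J (t / real (Suc (Suc n))) ^^ Suc (Suc n)) x" for n
  have X: "X \<longlonglongrightarrow> S t x"
    unfolding X_def
    using filterlim_sequentially_Suc[THEN iffD2, OF filterlim_sequentially_Suc[THEN iffD2, OF S_LIMSEQ(1)[OF x t]]] .
  define B where "B n = sqrt ((1 + 1 / real (Suc n)) * R)" for n
  have "slope_bound (X n) (B n)" for n
  proof -
    define N where "N = real (Suc (Suc n))"
    have N: "2 \<le> N" by (simp add: N_def)
    define \<tau> where "\<tau> = t / N"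
    have \<tau>: "0 < \<tau>" and N\<tau>: "N * \<tau> = t" using t N by (auto simp: \<tau>_def)
    define y where "y = (J \<tau> ^^ Suc n) x"
    have yH: "y \<in> H" unfolding y_def by (rule iterate_H[OF x \<tau>])
    have Xy: "X n = J \<tau> y" by (simp add: X_def y_def \<tau>_def N_def)
    have X': "X n = (J \<tau> ^^ Suc (Suc n)) x" by (simp add: X_def \<tau>_def N_def)
    define g where "g = norm (y - X n) / \<tau>"
    have g: "slope_bound (X n) g" unfolding g_def Xy by (rule slope_bound_J_increment[OF yH \<tau>])
    have "(norm (X n - v))\<^sup>2 / 2 + t * F (X n) + N * (N - 1) / 2 * (norm (y - X n))\<^sup>2
      \<le> (norm (x - v))\<^sup>2 / 2 + t * F v"
      using discrete_energy_estimate[OF x \<tau> vD, of "Suc (Suc n)"] N\<tau>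
      unfolding X'[symmetric] N_def[symmetric] diff_Suc_1 y_def[symmetric] by simp
    moreover have "t * F v - t * F (X n) \<le> t\<^sup>2 * M\<^sup>2 / 2 + (norm (X n - v))\<^sup>2 / 2"
    proof -
      have "t * (F v - F (X n)) \<le> t * (M * norm (v - X n))"
        using slope_boundD(3)[OF v slope_boundD(1)[OF g]] t by simp
      moreover have "2 * (t * M) * norm (X n - v) \<le> (t * M)\<^sup>2 + (norm (X n - v))\<^sup>2"
        by (rule sum_squares_bound)
      ultimately show ?thesis by (simp add: norm_minus_commute power_mult_distrib algebra_simps)
    qed
    ultimately have "N * (N - 1) / 2 * (norm (y - X n))\<^sup>2 \<le> (norm (x - v))\<^sup>2 / 2 + t\<^sup>2 * M\<^sup>2 / 2"
      by linarith
    moreover have "norm (y - X n) = g * \<tau>" using \<tau> by (simp add: g_def)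
    moreover have "t\<^sup>2 * R = (norm (x - v))\<^sup>2 + t\<^sup>2 * M\<^sup>2"
      using t by (simp add: R_def norm_minus_commute field_simps)
    ultimately have "N * (N - 1) * (g * \<tau>)\<^sup>2 \<le> t\<^sup>2 * R" by simp
    also have "\<dots> = N\<^sup>2 * \<tau>\<^sup>2 * R" by (simp add: N\<tau>[symmetric] power_mult_distrib)
    finally have "(N * \<tau>\<^sup>2) * ((N - 1) * g\<^sup>2) \<le> (N * \<tau>\<^sup>2) * (N * R)"
      by (simp add: power_mult_distrib power2_eq_square mult_ac)
    then have "(N - 1) * g\<^sup>2 \<le> N * R" using N \<tau> by (simp add: mult_le_cancel_left)
    then have "g\<^sup>2 \<le> N / (N - 1) * R" using N by (simp add: field_simps)
    also have "N / (N - 1) = 1 + 1 / real (Suc n)" using N by (simp add: N_def field_simps)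
    finally have "g \<le> B n" unfolding B_def by (rule real_le_rsqrt)
    then show ?thesis using g slope_bound_mono by blast
  qed
  moreover have "B \<longlonglongrightarrow> sqrt ((1 + 0) * R)"
    unfolding B_def by (intro tendsto_intros LIMSEQ_inverse_real_of_nat[unfolded inverse_eq_divide])
  ultimately have "slope_bound (S t x) (sqrt ((1 + 0) * R))"
    using slope_bound_limit[OF _ X] by blast
  then show ?thesis by (simp add: R_def)
qed

text \<open>The infimum is attained, see \<open>slope_bound_minslope\<close>. As a real number it is
  meaningful only where some bound exists, which is the case along the flow at positive
  times.\<close>

definition minslope :: "'a \<Rightarrow> real" where
  "minslope u = Inf {M. slope_bound u M}"

lemma minslope_le: "slope_bound u M \<Longrightarrow> minslope u \<le> M"
  unfolding minslope_def
  by (rule cInf_lower) (auto intro!: bdd_belowI[of _ 0] dest: slope_boundD(2))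

lemma slope_bound_minslope:
  assumes u: "slope_bound u M"
  shows "slope_bound u (minslope u)"
  unfolding slope_bound_def
proof (intro conjI ballI)
  have ne: "{M. slope_bound u M} \<noteq> {}" using u by blast
  show "u \<in> D" by (rule slope_boundD(1)[OF u])
  show "0 \<le> minslope u" unfolding minslope_def by (rule cInf_greatest[OF ne]) (simp add: slope_boundD(2))
  fix w assume w: "w \<in> D"
  show "F u - F w \<le> minslope u * norm (u - w)"
  proof (cases "u = w")
    case False
    then have p: "0 < norm (u - w)" by simp
    have "(F u - F w) / norm (u - w) \<le> minslope u"
      unfolding minslope_def
    proof (rule cInf_greatest[OF ne])
      fix K assume "K \<in> {M. slope_bound u M}"
      then show "(F u - F w) / norm (u - w) \<le> K"
        using slope_boundD(3)[of u K w] w p by (simp add: pos_divide_le_eq)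
    qed
    then show ?thesis using p by (simp add: pos_divide_le_eq)
  qed simp
qed

section \<open>Difference quotients as approximate subgradients\<close>

context
  fixes x assumes x: "x \<in> H"
begin

text \<open>The minimizer \<open>0\<close> has slope bound \<open>0\<close>, so
  \<open>S_regularizes\<close> makes the slope finite at every positive time.\<close>

lemma slope_bound_S: "0 < t \<Longrightarrow> slope_bound (S t x) (minslope (S t x))"
  using slope_bound_minslope[OF S_regularizes[OF x _ slope_bound_zero]] .

lemma S_shift:
  assumes "0 \<le> a" "a \<le> b"
  shows "S b x = S (b - a) (S a x)"
  using S_semigroup[OF x, of "b - a" a] assms by simp

lemma minslope_antimono:
  assumes "0 < a" "a \<le> b"
  shows "minslope (S b x) \<le> minslope (S a x)"
  unfolding S_shift[of a b, OF less_imp_le, OF assms]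
  by (rule minslope_le, rule S_slope_bound[OF slope_bound_S]) (use assms in auto)

lemma S_lipschitz:
  assumes "0 < a" "a \<le> s" "a \<le> t"
  shows "norm (S s x - S t x) \<le> minslope (S a x) * \<bar>s - t\<bar>"
proof -
  have *: "norm (S t x - S s x) \<le> minslope (S a x) * (t - s)" if "a \<le> s" "s \<le> t" for s t
  proof -
    have "norm (S t x - S s x) \<le> minslope (S s x) * (t - s)"
      using S_drift[OF slope_bound_S[of s], of "t - s"] S_shift[of s t] that assms(1) by simp
    also have "\<dots> \<le> minslope (S a x) * (t - s)"
      using minslope_antimono[of a s] that assms(1) by (intro mult_right_mono) auto
    finally show ?thesis .
  qed
  show ?thesis using *[of s t] *[of t s] assms by (cases "s \<le> t") (auto simp: norm_minus_commute)
qed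

text \<open>The negative difference quotient, since the flow follows minus a subgradient. It is
  symmetric in \<open>a\<close> and \<open>b\<close>.\<close>

definition quot :: "real \<Rightarrow> real \<Rightarrow> 'a" where
  "quot a b = (S a x - S b x) /\<^sub>R (b - a)"

text \<open>The difference of the squared distances of \<open>S a x\<close> and \<open>S b x\<close>
  to \<open>w\<close> is affine in \<open>w\<close> and vanishes at their midpoint. The energy
  estimate over \<open>{a..b}\<close> is therefore a subgradient inequality with base point
  there.\<close>

lemma quot_subgradient:
  assumes ab: "0 < a" "a < b" and w: "w \<in> D"
  shows "F (S b x) + quot a b \<bullet> (w - midpoint (S a x) (S b x)) \<le> F w"
proof -
  have "(norm (S b x - w))\<^sup>2 / 2 + (b - a) * F (S b x) \<le> (norm (S a x - w))\<^sup>2 / 2 + (b - a) * F w"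
    using S_energy_estimate(2)[OF S_H[OF x], of a "b - a" w] S_shift[of a b] ab w by simp
  moreover have "(norm (S a x - w))\<^sup>2 / 2 - (norm (S b x - w))\<^sup>2 / 2 =
      - ((S a x - S b x) \<bullet> (w - midpoint (S a x) (S b x)))"
    by (simp add: midpoint_def power2_norm_eq_inner inner_simps inner_commute field_simps)
  ultimately have "(b - a) * F (S b x) + (S a x - S b x) \<bullet> (w - midpoint (S a x) (S b x)) \<le> (b - a) * F w"
    by linarith
  then have "F (S b x) + (S a x - S b x) \<bullet> (w - midpoint (S a x) (S b x)) / (b - a) \<le> F w"
    using ab by (simp add: field_simps)
  then show ?thesis by (simp add: quot_def divide_inverse_commute)
qed

lemma norm_quot_le:
  assumes "0 < a" "a < b"
  shows "norm (quot a b) \<le> minslope (S a x)"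
  using S_lipschitz[of a a b] assms by (simp add: quot_def divide_inverse_commute[symmetric] pos_divide_le_eq)

text \<open>Where \<open>minslope\<close> is continuous along the flow, with value \<open>m\<close>, difference quotients have norm at most
  \<open>m + o(1)\<close>, and their midpoints, being approximate subgradients, have norm at least \<open>m - o(1)\<close>. The
  parallelogram identity makes them a Cauchy family.\<close>

lemma quot_Cauchy:
  assumes t: "0 < t" and cont: "isCont (\<lambda>s. minslope (S s x)) t" and e: "0 < e"
  shows "\<exists>d>0. d < t \<and> (\<forall>a b a' b'. t - d < a \<longrightarrow> a < b \<longrightarrow> b < t + d \<longrightarrow> t - d < a' \<longrightarrow> a' < b' \<longrightarrow> b' < t + d \<longrightarrow>
    norm (quot a b - quot a' b') < e)"
proof (rule ccontr)
  assume neg: "\<not> ?thesis"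
  define m where "m = minslope (S t x)"
  have m0: "0 \<le> m" unfolding m_def using slope_boundD(2)[OF slope_bound_S[OF t]] .
  have "isCont (\<lambda>s. (minslope (S s x))\<^sup>2) t" using cont by (intro continuous_intros)
  \<comment> \<open>Two vectors with squared norms at most \<open>m\<^sup>2 + e\<^sup>2 / 8\<close>
    and distance at least \<open>e\<close> have a midpoint with squared norm at most
    \<open>m\<^sup>2 - e\<^sup>2 / 8\<close>.\<close>
  then have "\<forall>\<^sub>F s in at t. (minslope (S s x))\<^sup>2 < m\<^sup>2 + e\<^sup>2 / 8"
    unfolding isCont_def m_def using e by (intro order_tendstoD(2)) auto
  then obtain d0 where d0: "0 < d0" "\<And>s. s \<noteq> t \<Longrightarrow> dist s t < d0 \<Longrightarrow> (minslope (S s x))\<^sup>2 < m\<^sup>2 + e\<^sup>2 / 8"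
    by (auto simp: eventually_at)
  have near: "(minslope (S s x))\<^sup>2 \<le> m\<^sup>2 + e\<^sup>2 / 8" if "t - d0 < s" "s < t + d0" for s
    using d0(2)[of s] that by (cases "s = t") (auto simp: m_def dist_real_def abs_less_iff intro: less_imp_le)
  \<comment> \<open>By monotonicity \<open>K\<close> bounds slopes and speeds from time
    \<open>t / 2\<close> on.\<close>
  define K where "K = minslope (S (t / 2) x)"
  have K0: "0 \<le> K" unfolding K_def using slope_boundD(2)[OF slope_bound_S] t by simp
  \<comment> \<open>If closeness fails at scale \<open>d\<close>, the midpoint \<open>z\<close> of
    the two offending quotients is a subgradient at \<open>S t x\<close> up to
    \<open>2 * K\<^sup>2 * d\<close>: one half for the energy at \<open>S b x\<close>, one half for
    the shifted base point.\<close>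
  have key: "\<exists>z. (norm z)\<^sup>2 \<le> m\<^sup>2 - e\<^sup>2 / 8 \<and> (\<forall>w\<in>D. F (S t x) + z \<bullet> (w - S t x) - 2 * K\<^sup>2 * d \<le> F w)"
    if d: "0 < d" "d \<le> d0" "d \<le> t / 2" for d
  proof -
    obtain a b a' b' where ab: "t - d < a" "a < b" "b < t + d" and ab': "t - d < a'" "a' < b'" "b' < t + d"
      and ge: "e \<le> norm (quot a b - quot a' b')"
    proof -
      have "d < t" using d t by simp
      then have "\<not> (\<forall>a b a' b'. t - d < a \<longrightarrow> a < b \<longrightarrow> b < t + d \<longrightarrow> t - d < a' \<longrightarrow> a' < b' \<longrightarrow> b' < t + d \<longrightarrow>
          norm (quot a b - quot a' b') < e)"
        using neg d(1) by blast
      then show thesis using that unfolding not_all not_imp not_less by blast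
    qed
    define z where "z = midpoint (quot a b) (quot a' b')"
    have small: "(norm (quot a b))\<^sup>2 \<le> m\<^sup>2 + e\<^sup>2 / 8" if "t - d < a" "a < b" "b < t + d" for a b
    proof -
      have "(norm (quot a b))\<^sup>2 \<le> (minslope (S a x))\<^sup>2"
        using norm_quot_le[of a b] that d t by (intro power_mono) auto
      also have "\<dots> \<le> m\<^sup>2 + e\<^sup>2 / 8" using near[of a] that d by simp
      finally show ?thesis .
    qed
    have "(norm z)\<^sup>2 = (norm (quot a b))\<^sup>2 / 2 + (norm (quot a' b'))\<^sup>2 / 2 - (norm (quot a b - quot a' b'))\<^sup>2 / 4"
      using norm_midpoint_diff[of 0 "quot a b" "quot a' b'"] by (simp add: z_def)
    moreover have "e\<^sup>2 \<le> (norm (quot a b - quot a' b'))\<^sup>2" using ge e by (intro power_mono) auto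
    ultimately have z: "(norm z)\<^sup>2 \<le> m\<^sup>2 - e\<^sup>2 / 8"
      using small[OF ab] small[OF ab'] by linarith
    have sub: "F (S t x) + quot a b \<bullet> (w - S t x) - 2 * K\<^sup>2 * d \<le> F w"
      if ab: "t - d < a" "a < b" "b < t + d" and w: "w \<in> D" for a b w
    proof -
      have a0: "t / 2 \<le> a" "0 < a" using ab d t by auto
      have close: "norm (S s x - S t x) \<le> K * d" if "t - d < s" "s < t + d" for s
      proof -
        have "norm (S s x - S t x) \<le> K * \<bar>s - t\<bar>"
          unfolding K_def using that d t by (intro S_lipschitz) auto
        also have "\<dots> \<le> K * d" using that K0 by (intro mult_left_mono) auto
        finally show ?thesis .
      qed
      have "m \<le> K" unfolding m_def K_def using t by (intro minslope_antimono) auto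
      then have "m * norm (S t x - S b x) \<le> K * (K * d)"
        using close[of b] ab K0 m0 by (intro mult_mono) (auto simp: norm_minus_commute)
      moreover have "F (S t x) - F (S b x) \<le> m * norm (S t x - S b x)"
        unfolding m_def using slope_boundD(1)[OF slope_bound_S[of b]] a0 ab
        by (intro slope_boundD(3)[OF slope_bound_S[OF t]]) auto
      moreover have "quot a b \<bullet> (midpoint (S a x) (S b x) - S t x) \<le> K * (K * d)"
      proof -
        have mid: "norm (midpoint (S a x) (S b x) - S t x) \<le> K * d"
          using norm_midpoint_le[of "S a x" "S b x" "S t x"] close[of a] close[of b] ab by linarith
        have "norm (quot a b) \<le> K"
          unfolding K_def using norm_quot_le[OF a0(2) ab(2)] minslope_antimono[of "t / 2" a] a0 t by linarith
        then have "norm (quot a b) * norm (midpoint (S a x) (S b x) - S t x) \<le> K * (K * d)"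
          using mid K0 by (intro mult_mono) auto
        then show ?thesis using norm_cauchy_schwarz order_trans by blast
      qed
      moreover have "quot a b \<bullet> (w - midpoint (S a x) (S b x)) = quot a b \<bullet> (w - S t x) - quot a b \<bullet> (midpoint (S a x) (S b x) - S t x)"
        by (simp add: inner_simps)
      moreover have "K * (K * d) = K\<^sup>2 * d" by (simp add: power2_eq_square)
      ultimately show ?thesis using quot_subgradient[OF a0(2) ab(2) w] by linarith
    qed
    have "F (S t x) + z \<bullet> (w - S t x) - 2 * K\<^sup>2 * d \<le> F w" if w: "w \<in> D" for w
    proof -
      have "z \<bullet> (w - S t x) = (quot a b \<bullet> (w - S t x)) / 2 + (quot a' b' \<bullet> (w - S t x)) / 2"
        by (simp add: z_def midpoint_def inner_simps field_simps)
      then show ?thesis using sub[OF ab w] sub[OF ab' w] by linarith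
    qed
    then show ?thesis using z by blast
  qed
  \<comment> \<open>As \<open>d\<close> shrinks, the vectors \<open>z\<close> show that
    \<open>r\<close> is a slope bound at \<open>S t x\<close>, although \<open>r < m\<close> and
    \<open>m\<close> is the least one.\<close>
  define r where "r = sqrt (m\<^sup>2 - e\<^sup>2 / 8)"
  obtain z0 where "(norm (z0::'a))\<^sup>2 \<le> m\<^sup>2 - e\<^sup>2 / 8" using key[of "min d0 (t / 2)", OF _ min.cobounded1 min.cobounded2] d0(1) t by auto
  then have r0: "0 \<le> m\<^sup>2 - e\<^sup>2 / 8" using zero_le_power2 order_trans by blast
  have "slope_bound (S t x) r"
    unfolding slope_bound_def
  proof (intro conjI ballI)
    show "S t x \<in> D" using slope_boundD(1)[OF slope_bound_S[OF t]] .
    show "0 \<le> r" using r0 by (simp add: r_def)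
    fix w assume w: "w \<in> D"
    show "F (S t x) - F w \<le> r * norm (S t x - w)"
    proof (rule field_le_epsilon)
      fix \<eta> :: real assume \<eta>: "0 < \<eta>"
      define d where "d = min (min d0 (t / 2)) (\<eta> / (2 * K\<^sup>2 + 1))"
      have c: "0 < 2 * K\<^sup>2 + 1" by (simp add: add_nonneg_pos)
      then have d: "0 < d" "d \<le> d0" "d \<le> t / 2"
        using d0(1) t \<eta> unfolding d_def by (simp_all only: min_less_iff_conj min.coboundedI1 min.cobounded1 min.cobounded2 zero_less_divide_iff) auto
      have "2 * K\<^sup>2 * d \<le> (2 * K\<^sup>2 + 1) * d" using d by (simp add: algebra_simps)
      also have "\<dots> \<le> (2 * K\<^sup>2 + 1) * (\<eta> / (2 * K\<^sup>2 + 1))"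
        using c by (intro mult_left_mono) (auto simp: d_def)
      also have "\<dots> = \<eta>" using c by simp
      finally have Kd: "2 * K\<^sup>2 * d \<le> \<eta>" .
      obtain z where z: "(norm z)\<^sup>2 \<le> m\<^sup>2 - e\<^sup>2 / 8" and zw: "F (S t x) + z \<bullet> (w - S t x) - 2 * K\<^sup>2 * d \<le> F w"
        using key[OF d] w by blast
      have "norm z \<le> r" unfolding r_def using z by (rule real_le_rsqrt)
      then have "norm z * norm (S t x - w) \<le> r * norm (S t x - w)" by (rule mult_right_mono) simp
      moreover have "z \<bullet> (S t x - w) \<le> norm z * norm (S t x - w)" by (rule norm_cauchy_schwarz)
      moreover have "z \<bullet> (w - S t x) = - (z \<bullet> (S t x - w))" by (simp add: inner_simps)
      ultimately show "F (S t x) - F w \<le> r * norm (S t x - w) + \<eta>" using zw Kd by linarith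
    qed
  qed
  then have "m \<le> r" unfolding m_def by (rule minslope_le)
  then have "m\<^sup>2 \<le> r\<^sup>2" using m0 by (rule power_mono)
  also have "\<dots> = m\<^sup>2 - e\<^sup>2 / 8" using r0 by (simp add: r_def)
  finally show False using e by simp
qed

end

end

section \<open>Absolutely continuous functions\<close>

lemma has_vector_derivative_iff_quotient:
  fixes f :: "real \<Rightarrow> 'a::real_normed_vector"
  shows "(f has_vector_derivative L) (at t) \<longleftrightarrow> ((\<lambda>s. (f s - f t) /\<^sub>R (s - t)) \<longlongrightarrow> L) (at t)"
proof -
  have "(f has_vector_derivative L) (at t) \<longleftrightarrow>
      ((\<lambda>s. norm (f s - f t - (s - t) *\<^sub>R L) / norm (s - t)) \<longlongrightarrow> 0) (at t)"
    by (simp add: has_vector_derivative_def has_derivative_iff_norm bounded_linear_scaleR_left)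
  also have "\<dots> \<longleftrightarrow> ((\<lambda>s. norm ((f s - f t) /\<^sub>R (s - t) - L)) \<longlongrightarrow> 0) (at t)"
  proof (rule tendsto_cong[OF eventually_mono[OF eventually_neq_at_within]])
    fix s assume "s \<noteq> t"
    then have "f s - f t - (s - t) *\<^sub>R L = (s - t) *\<^sub>R ((f s - f t) /\<^sub>R (s - t) - L)"
      by (simp add: scaleR_diff_right)
    then show "norm (f s - f t - (s - t) *\<^sub>R L) / norm (s - t) = norm ((f s - f t) /\<^sub>R (s - t) - L)"
      using \<open>s \<noteq> t\<close> by simp
  qed
  also have "\<dots> \<longleftrightarrow> ((\<lambda>s. (f s - f t) /\<^sub>R (s - t)) \<longlongrightarrow> L) (at t)"
    by (simp only: tendsto_norm_zero_iff LIM_zero_iff)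
  finally show ?thesis .
qed

lemma abs_continuous_on_imp_continuous_on:
  assumes g: "abs_continuous_on {a..b::real} g"
  shows "continuous_on {a..b} g"
  unfolding continuous_on_iff
proof (intro ballI allI impI)
  fix s e :: real assume s: "s \<in> {a..b}" and e: "0 < e"
  obtain d where d: "0 < d" and D: "\<And>D. finite D \<Longrightarrow> (\<forall>(u, v)\<in>D. u \<le> v \<and> {u..v} \<subseteq> {a..b}) \<Longrightarrow>
     pairwise (\<lambda>(u, v) (u', v'). disjnt {u<..<v} {u'<..<v'}) D \<Longrightarrow>
     (\<Sum>(u, v)\<in>D. v - u) < d \<Longrightarrow> (\<Sum>(u, v)\<in>D. dist (g u) (g v)) < e"
    using g[unfolded abs_continuous_on_def, rule_format, OF e] by blast
  have "dist (g t) (g s) < e" if t: "t \<in> {a..b}" "dist t s < d" for t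
    using D[of "{(min s t, max s t)}"] s t
    by (cases "s \<le> t") (auto simp: dist_real_def dist_commute min_def max_def)
  then show "\<exists>d>0. \<forall>t\<in>{a..b}. dist t s < d \<longrightarrow> dist (g t) (g s) < e" using d by blast
qed

text \<open>Applied with \<open>f\<close> the squared distance between an absolutely continuous
  curve \<open>g\<close> and a Lipschitz curve.\<close>

lemma abs_continuous_on_lipschitz_combination:
  fixes f :: "real \<Rightarrow> real" and g h :: "real \<Rightarrow> 'a::metric_space"
  assumes g: "abs_continuous_on S g" and C: "0 \<le> C"
    and f: "\<And>s t. s \<in> S \<Longrightarrow> t \<in> S \<Longrightarrow> dist (f s) (f t) \<le> C * (dist (g s) (g t) + \<bar>s - t\<bar>)"
  shows "abs_continuous_on S f"
  unfolding abs_continuous_on_def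
proof (intro allI impI)
  fix e :: real assume e: "0 < e"
  define r where "r = e / (C + 1) / 2"
  have r: "0 < r" using e C by (simp add: r_def)
  obtain d where d: "0 < d" and D: "\<And>D. finite D \<Longrightarrow> (\<forall>(u, v)\<in>D. u \<le> v \<and> {u..v} \<subseteq> S) \<Longrightarrow>
     pairwise (\<lambda>(u, v) (u', v'). disjnt {u<..<v} {u'<..<v'}) D \<Longrightarrow>
     (\<Sum>(u, v)\<in>D. v - u) < d \<Longrightarrow> (\<Sum>(u, v)\<in>D. dist (g u) (g v)) < r"
    using g[unfolded abs_continuous_on_def, rule_format, OF r] by blast
  have "(\<Sum>(u, v)\<in>D. dist (f u) (f v)) < e"
    if D': "finite D" "\<forall>(u, v)\<in>D. u \<le> v \<and> {u..v} \<subseteq> S"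
      "pairwise (\<lambda>(u, v) (u', v'). disjnt {u<..<v} {u'<..<v'}) D" "(\<Sum>(u, v)\<in>D. v - u) < min d r" for D
  proof -
    have "(\<Sum>(u, v)\<in>D. dist (f u) (f v)) \<le> (\<Sum>(u, v)\<in>D. C * (dist (g u) (g v) + (v - u)))"
    proof (rule sum_mono, clarify)
      fix u v assume "(u, v) \<in> D"
      then have "u \<le> v" "{u..v} \<subseteq> S" using D'(2) by auto
      then have "u \<le> v" "u \<in> S" "v \<in> S" by auto
      then show "dist (f u) (f v) \<le> C * (dist (g u) (g v) + (v - u))" using f[of u v] by simp
    qed
    also have "\<dots> = C * ((\<Sum>(u, v)\<in>D. dist (g u) (g v)) + (\<Sum>(u, v)\<in>D. v - u))"
      by (simp add: sum_distrib_left sum.distrib split_def distrib_left)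
    also have "\<dots> \<le> C * (r + r)"
      using D[OF D'(1-3)] D'(4) C by (intro mult_left_mono add_mono) auto
    also have "\<dots> < e"
    proof -
      have "r + r = e / (C + 1)" unfolding r_def by (rule field_sum_of_halves)
      then have "C * (r + r) = e * (C / (C + 1))" by simp
      also have "\<dots> < e * 1" using e C by (intro mult_strict_left_mono) auto
      finally show ?thesis by simp
    qed
    finally show ?thesis .
  qed
  then show "\<exists>d>0. \<forall>D. finite D \<longrightarrow> (\<forall>(u, v)\<in>D. u \<le> v \<and> {u..v} \<subseteq> S) \<longrightarrow>
     pairwise (\<lambda>(u, v) (u', v'). disjnt {u<..<v} {u'<..<v'}) D \<longrightarrow>
     (\<Sum>(u, v)\<in>D. v - u) < d \<longrightarrow> (\<Sum>(u, v)\<in>D. dist (f u) (f v)) < e"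
    using d r by (intro exI[of _ "min d r"]) auto
qed

text \<open>Cousin's lemma: points of differentiability are covered by the difference quotient, and the
  exceptional null set lies in an open set so small that absolute continuity controls it.\<close>

lemma abs_continuous_nonincreasing:
  fixes f :: "real \<Rightarrow> real"
  assumes ab: "a \<le> b" and ac: "abs_continuous_on {a..b} f" and N: "negligible N"
    and der: "\<And>t. t \<in> {a..b} - N \<Longrightarrow> \<exists>d\<le>0. (f has_real_derivative d) (at t)"
  shows "f b \<le> f a"
proof (rule field_le_epsilon)
  fix e0 :: real assume e0: "0 < e0"
  define e where "e = e0 / (b - a + 1)"
  have e: "0 < e" using e0 ab by (simp add: e_def)
  have "e * (b - a + 1) = e0" using ab by (simp add: e_def)
  then have e0_eq: "e * (b - a) + e = e0" by (simp add: distrib_left)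
  obtain d where d: "0 < d" and D: "\<And>D. finite D \<Longrightarrow> (\<forall>(u, v)\<in>D. u \<le> v \<and> {u..v} \<subseteq> {a..b}) \<Longrightarrow>
     pairwise (\<lambda>(u, v) (u', v'). disjnt {u<..<v} {u'<..<v'}) D \<Longrightarrow>
     (\<Sum>(u, v)\<in>D. v - u) < d \<Longrightarrow> (\<Sum>(u, v)\<in>D. dist (f u) (f v)) < e"
    using ac[unfolded abs_continuous_on_def, rule_format, OF e] by blast
  \<comment> \<open>Disjoint intervals inside \<open>T\<close> will have total length below
    \<open>d\<close>.\<close>
  obtain T where T: "open T" "N \<subseteq> T" "T - N \<in> lmeasurable" "emeasure lebesgue (T - N) < ennreal d"
    using sets_lebesgue_outer_open[OF negligible_imp_sets[OF N] d] by metis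
  have TN: "T = (T - N) \<union> N" using T(2) by auto
  have Tm: "T \<in> lmeasurable"
    by (subst TN, rule fmeasurable.Un[OF T(3) negligible_imp_measurable[OF N]])
  have "measure lebesgue T = measure lebesgue (T - N)"
    by (subst TN, rule measure_Un_null_set) (use T(3) N in \<open>auto simp: negligible_iff_null_sets\<close>)
  also have "\<dots> < d"
    using T(3,4) d by (simp add: emeasure_eq_measure2 ennreal_less_iff)
  finally have Td: "measure lebesgue T < d" .
  have "\<exists>r>0. \<forall>u v. u \<le> t \<longrightarrow> t \<le> v \<longrightarrow> u \<in> ball t r \<longrightarrow> v \<in> ball t r \<longrightarrow> f v - f u \<le> e * (v - u)"
    if t: "t \<in> {a..b} - N" for t
  proof -
    obtain c where c: "c \<le> 0" "(f has_real_derivative c) (at t)" using der[OF t] by blast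
    then have "((\<lambda>s. (f s - f t) / (s - t)) \<longlongrightarrow> c) (at t)" by (simp add: has_field_derivative_iff)
    from order_tendstoD(2)[OF this, of e]
    have "\<forall>\<^sub>F s in at t. (f s - f t) / (s - t) < e" using c e by simp
    then obtain r where r: "0 < r" "\<And>s. s \<noteq> t \<Longrightarrow> dist s t < r \<Longrightarrow> (f s - f t) / (s - t) < e"
      by (auto simp: eventually_at)
    have 1: "f v - f t \<le> e * (v - t)" if "t \<le> v" "v \<in> ball t r" for v
      using r(2)[of v] that by (cases "v = t") (auto simp: pos_divide_less_eq dist_commute)
    have 2: "f t - f u \<le> e * (t - u)" if "u \<le> t" "u \<in> ball t r" for u
      using r(2)[of u] that by (cases "u = t") (auto simp: neg_divide_less_eq dist_commute algebra_simps)
    show ?thesis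
      using r(1) 1 2 by (intro exI[of _ r]) (fastforce simp: algebra_simps)
  qed
  then obtain r where r: "\<And>t. t \<in> {a..b} - N \<Longrightarrow> 0 < r t" "\<And>t u v. t \<in> {a..b} - N \<Longrightarrow> u \<le> t \<Longrightarrow> t \<le> v \<Longrightarrow>
      u \<in> ball t (r t) \<Longrightarrow> v \<in> ball t (r t) \<Longrightarrow> f v - f u \<le> e * (v - u)"
    by metis
  \<comment> \<open>Intervals tagged in \<open>N\<close> stay inside \<open>T\<close>; the others
    are so close to their tag that \<open>f\<close> grows at rate at most \<open>e\<close> across
    them.\<close>
  define \<gamma> where "\<gamma> t = (if t \<in> N then T else if t \<in> {a..b} then ball t (r t) else UNIV)" for t
  have "gauge \<gamma>" unfolding gauge_def \<gamma>_def using T r(1) by auto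
  then obtain p where p: "p tagged_division_of {a..b}" "\<gamma> fine p" by (rule fine_division_exists_real)
  note fin = tagged_division_of_finite[OF p(1)]
  have pE: "\<exists>u v. K = {u..v} \<and> u \<le> t \<and> t \<le> v \<and> a \<le> u \<and> v \<le> b" if tK: "(t, K) \<in> p" for t K
  proof -
    obtain u v where "K = cbox u v" using tagged_division_ofD(4)[OF p(1) tK] by blast
    then show ?thesis using tagged_division_ofD(2,3)[OF p(1) tK] by (auto simp: atLeastatMost_subset_iff)
  qed
  define \<Delta> where "\<Delta> = (\<lambda>(t :: real, K). f (Sup K) - f (Inf K))"
  define len where "len = (\<lambda>(t :: real, K :: real set). Sup K - Inf K)"
  define p1 where "p1 = {(t, K) \<in> p. t \<notin> N}"
  \<comment> \<open>Degenerate intervals contribute zero. Leaving them out makes the open intervals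
    in the injectivity argument for \<open>q\<close> nonempty.\<close>
  define p2 where "p2 = {(t, K) \<in> p. t \<in> N \<and> Inf K < Sup K}"
  have sub: "p1 \<subseteq> p" "p2 \<subseteq> p" "finite p1" "finite p2" "p1 \<inter> p2 = {}"
    using fin by (auto simp: p1_def p2_def intro: finite_subset[of _ p])
  have "f b - f a = sum \<Delta> p" unfolding \<Delta>_def using additive_tagged_division_1[OF ab p(1), of f] by simp
  also have "\<dots> = sum \<Delta> (p1 \<union> p2)"
  proof (rule sum.mono_neutral_right[OF fin])
    show "\<forall>i\<in>p - (p1 \<union> p2). \<Delta> i = 0"
    proof
      fix i assume i: "i \<in> p - (p1 \<union> p2)"
      obtain t K where tK_eq: "i = (t, K)" by fastforce
      then have tK: "(t, K) \<in> p" "(t, K) \<notin> p1" "(t, K) \<notin> p2" using i by auto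
      obtain u v where uv: "K = {u..v}" "u \<le> t" "t \<le> v" using pE[OF tK(1)] by blast
      then have "u = v" using tK by (auto simp: p1_def p2_def)
      then show "\<Delta> i = 0" using uv by (simp add: \<Delta>_def tK_eq)
    qed
  qed (use sub in auto)
  also have "\<dots> = sum \<Delta> p1 + sum \<Delta> p2" using sub by (intro sum.union_disjoint)
  also have "sum \<Delta> p1 \<le> e * (b - a)"
  proof -
    have "sum \<Delta> p1 \<le> (\<Sum>i\<in>p1. e * len i)"
    proof (rule sum_mono, clarify)
      fix t K assume tK: "(t, K) \<in> p1"
      then have tp: "(t, K) \<in> p" and tN: "t \<notin> N" by (auto simp: p1_def)
      obtain u v where uv: "K = {u..v}" "u \<le> t" "t \<le> v" "a \<le> u" "v \<le> b" using pE[OF tp] by blast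
      have "K \<subseteq> \<gamma> t" using p(2) tp by (auto simp: fine_def)
      then have "K \<subseteq> ball t (r t)" using tN uv by (simp add: \<gamma>_def)
      then have "u \<in> ball t (r t)" "v \<in> ball t (r t)" using uv(1-3) by (meson atLeastAtMost_iff order_refl order_trans subsetD)+
      then have "f v - f u \<le> e * (v - u)" using uv tN by (intro r(2)) auto
      then show "\<Delta> (t, K) \<le> e * len (t, K)" using uv by (simp add: \<Delta>_def len_def)
    qed
    also have "\<dots> \<le> (\<Sum>i\<in>p. e * len i)"
    proof (rule sum_mono2[OF fin sub(1)], clarify)
      fix t K assume "(t, K) \<in> p"
      then show "0 \<le> e * len (t, K)" using pE[of t K] e by (auto simp: len_def)
    qed
    also have "\<dots> = e * (b - a)"
      using additive_tagged_division_1[OF ab p(1), of "\<lambda>t. t"] unfolding len_def by (simp flip: sum_distrib_left)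
    finally show ?thesis .
  qed
  also have "sum \<Delta> p2 \<le> e"
  proof -
    define q where "q = (\<lambda>(t :: real, K :: real set). (Inf K, Sup K))"
    have p2E: "\<exists>u v. K = {u..v} \<and> u < v \<and> a \<le> u \<and> v \<le> b \<and> {u<..<v} \<subseteq> T" if tK: "(t, K) \<in> p2" for t K
    proof -
      have tp: "(t, K) \<in> p" and tN: "t \<in> N" "Inf K < Sup K" using tK by (auto simp: p2_def)
      obtain u v where uv: "K = {u..v}" "u \<le> t" "t \<le> v" "a \<le> u" "v \<le> b" using pE[OF tp] by blast
      have "K \<subseteq> \<gamma> t" using p(2) tp by (auto simp: fine_def)
      then have "K \<subseteq> T" using tN by (simp add: \<gamma>_def)
      then show ?thesis using uv tN by (intro exI[of _ u] exI[of _ v]) auto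
    qed
    have disj: "disjnt {Inf K<..<Sup K} {Inf K'<..<Sup K'}" if "(t, K) \<in> p2" "(t', K') \<in> p2" "(t, K) \<noteq> (t', K')" for t K t' K'
    proof -
      have "interior K \<inter> interior K' = {}"
        using tagged_division_ofD(5)[OF p(1), of t K t' K'] that sub(2) by blast
      then show ?thesis using p2E[OF that(1)] p2E[OF that(2)] by (auto simp: disjnt_def)
    qed
    have inj: "inj_on q p2"
    proof (rule inj_onI, clarify)
      fix t K t' K' assume *: "(t, K) \<in> p2" "(t', K') \<in> p2" "q (t, K) = q (t', K')"
      show "t = t' \<and> K = K'"
      proof (rule ccontr)
        assume "\<not> (t = t' \<and> K = K')"
        then have "disjnt {Inf K<..<Sup K} {Inf K'<..<Sup K'}" using disj[OF *(1,2)] by simp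
        then have "{Inf K<..<Sup K} = {}" using *(3) by (simp add: q_def disjnt_def)
        then show False using p2E[OF *(1)] by auto
      qed
    qed
    have "(\<Sum>i\<in>q ` p2. case i of (u, v) \<Rightarrow> dist (f u) (f v)) < e"
    proof (rule D)
      show "finite (q ` p2)" using sub by simp
      show "\<forall>(u, v)\<in>q ` p2. u \<le> v \<and> {u..v} \<subseteq> {a..b}"
      proof (clarify)
        fix u v t K assume "(t, K) \<in> p2" "(u, v) = q (t, K)"
        then show "u \<le> v \<and> {u..v} \<subseteq> {a..b}" using p2E[of t K] by (auto simp: q_def)
      qed
      show "pairwise (\<lambda>(u, v) (u', v'). disjnt {u<..<v} {u'<..<v'}) (q ` p2)"
      proof (rule pairwiseI)
        fix i j assume ij: "i \<in> q ` p2" "j \<in> q ` p2" "i \<noteq> j"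
        then obtain t K t' K' where "(t, K) \<in> p2" "(t', K') \<in> p2" "i = q (t, K)" "j = q (t', K')" by fast
        then show "(case i of (u, v) \<Rightarrow> \<lambda>(u', v'). disjnt {u<..<v} {u'<..<v'}) j"
          using disj[of t K t' K'] ij(3) by (auto simp: q_def)
      qed
      have "(\<Sum>i\<in>q ` p2. case i of (u, v) \<Rightarrow> v - u) = (\<Sum>i\<in>p2. measure lebesgue (case i of (t, K) \<Rightarrow> {Inf K<..<Sup K}))"
        unfolding sum.reindex[OF inj]
      proof (rule sum.cong[OF refl])
        fix i assume i: "i \<in> p2"
        obtain t K where tK: "i = (t, K)" by fastforce
        then show "((\<lambda>(u, v). v - u) \<circ> q) i = measure lebesgue (case i of (t, K) \<Rightarrow> {Inf K<..<Sup K})"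
          using p2E[of t K] i by (auto simp: q_def)
      qed
      also have "\<dots> = measure lebesgue (\<Union>i\<in>p2. case i of (t, K) \<Rightarrow> {Inf K<..<Sup K})"
      proof (rule measure_finite_Union[symmetric, OF sub(4)])
        show "disjoint_family_on (\<lambda>i. case i of (t, K) \<Rightarrow> {Inf K<..<Sup K}) p2"
          unfolding disjoint_family_on_def using disj by (fastforce simp: disjnt_def)
      qed (auto dest!: p2E)
      also have "\<dots> \<le> measure lebesgue T"
      proof (rule measure_mono_fmeasurable[OF _ _ Tm])
        show "(\<Union>i\<in>p2. case i of (t, K) \<Rightarrow> {Inf K<..<Sup K}) \<subseteq> T"
          by (force dest!: p2E)
      qed (auto intro!: sets.finite_UN sub simp: split_def)
      also have "\<dots> < d" by (rule Td)
      finally show "(\<Sum>(u, v)\<in>q ` p2. v - u) < d" .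
    qed
    moreover have "sum \<Delta> p2 \<le> (\<Sum>i\<in>q ` p2. case i of (u, v) \<Rightarrow> dist (f u) (f v))"
      unfolding sum.reindex[OF inj]
      by (rule sum_mono) (auto simp: \<Delta>_def q_def dist_real_def)
    ultimately show ?thesis by simp
  qed
  finally show "f b \<le> f a + e0" using e0_eq by simp
qed

section \<open>The evolution variational inequality\<close>

context convex_energy
begin

lemma countable_minslope_discont:
  assumes x: "x \<in> H"
  shows "countable {t \<in> {0<..}. \<not> isCont (\<lambda>s. minslope (S s x)) t}"
proof -
  have "mono_on {0<..} (\<lambda>t. - minslope (S t x))"
    by (rule mono_onI) (use minslope_antimono[OF x] in auto)
  then have "countable {t \<in> {0<..}. \<not> isCont (\<lambda>s. - minslope (S s x)) t}"
    by (intro mono_on_ctble_discont_open) auto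
  moreover have "isCont (\<lambda>s. - minslope (S s x)) t \<longleftrightarrow> isCont (\<lambda>s. minslope (S s x)) t" for t
    using continuous_minus[of "at t" "\<lambda>s. minslope (S s x)"] continuous_minus[of "at t" "\<lambda>s. - minslope (S s x)"] by auto
  ultimately show ?thesis by simp
qed

text \<open>By \<open>quot_Cauchy\<close> the quotients converge. Taking \<open>a = t\<close> and
  \<open>b\<close> decreasing to \<open>t\<close> in \<open>quot_subgradient\<close> gives a plain
  subgradient inequality for the limit, which convexity along segments improves by the modulus
  \<open>l\<close>.\<close>

lemma S_differentiable:
  assumes x: "x \<in> H" and t: "0 < t" and cont: "isCont (\<lambda>s. minslope (S s x)) t"
  obtains L where "((\<lambda>s. S s x) has_vector_derivative L) (at t)"
    "\<And>v. v \<in> D \<Longrightarrow> (S t x - v) \<bullet> L + l / 2 * (norm (S t x - v))\<^sup>2 \<le> F v - F (S t x)"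
proof -
  define q where "q s = (S s x - S t x) /\<^sub>R (s - t)" for s
  have q_gt: "q s = - quot x t s" for s
  proof -
    have "inverse (s - t) *\<^sub>R (S s x - S t x) = - (inverse (s - t) *\<^sub>R (S t x - S s x))"
      by (simp flip: scaleR_minus_right)
    then show ?thesis by (simp add: q_def quot_def[OF x])
  qed
  have q_lt: "q s = - quot x s t" for s
  proof -
    have "inverse (s - t) *\<^sub>R (S s x - S t x) = - (inverse (t - s) *\<^sub>R (S s x - S t x))"
      by (metis inverse_minus_eq minus_diff_eq scaleR_minus_left)
    then show ?thesis by (simp add: q_def quot_def[OF x])
  qed
  have Cauchy: "\<exists>d>0. \<forall>s s'. s \<noteq> t \<longrightarrow> s' \<noteq> t \<longrightarrow> \<bar>s - t\<bar> < d \<longrightarrow> \<bar>s' - t\<bar> < d \<longrightarrow> norm (q s - q s') < e" if e: "0 < e" for e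
  proof -
    obtain d where d: "0 < d" and *: "\<And>a b a' b'. t - d < a \<Longrightarrow> a < b \<Longrightarrow> b < t + d \<Longrightarrow> t - d < a' \<Longrightarrow> a' < b' \<Longrightarrow> b' < t + d \<Longrightarrow>
        norm (quot x a b - quot x a' b') < e"
      using quot_Cauchy[OF x t cont e] by metis
    have ex: "\<exists>a b. t - d < a \<and> a < b \<and> b < t + d \<and> q s = - quot x a b" if "s \<noteq> t" "\<bar>s - t\<bar> < d" for s
    proof (cases "s < t")
      case True
      then have "t - d < s \<and> s < t \<and> t < t + d \<and> q s = - quot x s t" using that d q_lt by auto
      then show ?thesis by blast
    next
      case False
      then have "t - d < t \<and> t < s \<and> s < t + d \<and> q s = - quot x t s" using that d q_gt by auto
      then show ?thesis by blast
    qed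
    show ?thesis
    proof (intro exI[of _ d] conjI d allI impI)
      fix s s' assume s: "s \<noteq> t" "s' \<noteq> t" "\<bar>s - t\<bar> < d" "\<bar>s' - t\<bar> < d"
      obtain a b where ab: "t - d < a" "a < b" "b < t + d" "q s = - quot x a b" using ex[OF s(1,3)] by blast
      obtain a' b' where ab': "t - d < a'" "a' < b'" "b' < t + d" "q s' = - quot x a' b'" using ex[OF s(2,4)] by blast
      show "norm (q s - q s') < e"
        using *[OF ab(1-3) ab'(1-3)] unfolding ab(4) ab'(4) by (simp add: norm_minus_commute)
    qed
  qed
  define r where "r n = t + 1 / real (Suc n)" for n
  have r: "r n \<noteq> t" "0 \<le> r n" for n using t by (auto simp: r_def)
  have rd: "\<exists>N. \<forall>n\<ge>N. \<bar>r n - t\<bar> < d" if d: "0 < d" for d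
  proof -
    obtain N where N: "1 / real (Suc N) < d" using d nat_approx_posE by blast
    have "\<bar>r n - t\<bar> < d" if "n \<ge> N" for n
    proof -
      have "1 / real (Suc n) \<le> 1 / real (Suc N)" using that by (simp add: field_simps)
      then show ?thesis using N by (simp add: r_def)
    qed
    then show ?thesis by blast
  qed
  have "Cauchy (\<lambda>n. q (r n))"
  proof (rule metric_CauchyI)
    fix e :: real assume "0 < e"
    from Cauchy[OF this] obtain d where d: "0 < d" "\<And>s s'. s \<noteq> t \<Longrightarrow> s' \<noteq> t \<Longrightarrow> \<bar>s - t\<bar> < d \<Longrightarrow> \<bar>s' - t\<bar> < d \<Longrightarrow> norm (q s - q s') < e"
      by blast
    from rd[OF d(1)] obtain N where "\<And>n. n \<ge> N \<Longrightarrow> \<bar>r n - t\<bar> < d" by blast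
    then have "dist (q (r m)) (q (r n)) < e" if "m \<ge> N" "n \<ge> N" for m n
      unfolding dist_norm using d(2)[OF r(1) r(1)] that by blast
    then show "\<exists>M. \<forall>m\<ge>M. \<forall>n\<ge>M. dist (q (r m)) (q (r n)) < e" by blast
  qed
  moreover have "q (r n) \<in> H" for n
    unfolding q_def using r(2) t by (intro subspace_scale subspace_diff subspace_H S_H x) auto
  ultimately obtain L where L: "(\<lambda>n. q (r n)) \<longlonglongrightarrow> L" using Cauchy_limit_H[of "\<lambda>n. q (r n)"] by metis
  have qL: "(q \<longlongrightarrow> L) (at t)"
  proof (rule tendstoI)
    fix e :: real assume e: "0 < e"
    then have "0 < e / 2" by simp
    from Cauchy[OF this] obtain d where d: "0 < d" "\<And>s s'. s \<noteq> t \<Longrightarrow> s' \<noteq> t \<Longrightarrow> \<bar>s - t\<bar> < d \<Longrightarrow> \<bar>s' - t\<bar> < d \<Longrightarrow> norm (q s - q s') < e / 2"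
      by blast
    from rd[OF d(1)] obtain N where N: "\<And>n. n \<ge> N \<Longrightarrow> \<bar>r n - t\<bar> < d" by blast
    have "dist (q s) L < e" if s: "s \<noteq> t" "\<bar>s - t\<bar> < d" for s
    proof -
      have "dist (q s) L \<le> e / 2"
      proof (rule tendsto_upperbound)
        show "(\<lambda>n. dist (q s) (q (r n))) \<longlonglongrightarrow> dist (q s) L" by (intro tendsto_intros L)
        show "\<forall>\<^sub>F n in sequentially. dist (q s) (q (r n)) \<le> e / 2"
          unfolding eventually_sequentially dist_norm
          using d(2)[OF s(1) r(1) s(2)] N less_imp_le by blast
      qed simp
      then show ?thesis using e by simp
    qed
    then show "\<forall>\<^sub>F s in at t. dist (q s) L < e"
      using d(1) by (auto simp: eventually_at dist_real_def)
  qed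
  have der: "((\<lambda>s. S s x) has_vector_derivative L) (at t)"
    unfolding has_vector_derivative_iff_quotient using qL unfolding q_def[abs_def] .
  then have S_cont: "((\<lambda>s. S s x) \<longlongrightarrow> S t x) (at t)"
    using has_vector_derivative_continuous isCont_def by blast
  define m where "m = minslope (S t x)"
  have tD: "S t x \<in> D" using slope_boundD(1)[OF slope_bound_S[OF x t]] .
  \<comment> \<open>The slope bound at \<open>S t x\<close> supplies the lower estimate of
    \<open>F (S b x)\<close>.\<close>
  have sub: "F (S t x) + - L \<bullet> (w - S t x) \<le> F w" if w: "w \<in> D" for w
  proof (rule tendsto_upperbound)
    have "((\<lambda>b. F (S t x) - m * norm (S t x - S b x) + (- q b) \<bullet> (w - midpoint (S t x) (S b x)))
        \<longlongrightarrow> F (S t x) - m * norm (S t x - S t x) + (- L) \<bullet> (w - midpoint (S t x) (S t x))) (at_right t)"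
      unfolding midpoint_def
      by (intro tendsto_intros tendsto_mono[OF at_le[OF subset_UNIV] S_cont] tendsto_mono[OF at_le[OF subset_UNIV] qL])
    then show "((\<lambda>b. F (S t x) - m * norm (S t x - S b x) + (- q b) \<bullet> (w - midpoint (S t x) (S b x)))
        \<longlongrightarrow> F (S t x) + - L \<bullet> (w - S t x)) (at_right t)" by simp
    show "\<forall>\<^sub>F b in at_right t. F (S t x) - m * norm (S t x - S b x) + (- q b) \<bullet> (w - midpoint (S t x) (S b x)) \<le> F w"
      unfolding eventually_at_right_field
    proof (intro exI[of _ "t + 1"] conjI allI impI)
      fix b assume b: "t < b" "b < t + 1"
      have "F (S t x) - F (S b x) \<le> m * norm (S t x - S b x)"
        unfolding m_def using slope_boundD(1)[OF slope_bound_S[OF x, of b]] b t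
        by (intro slope_boundD(3)[OF slope_bound_S[OF x t]]) auto
      then show "F (S t x) - m * norm (S t x - S b x) + (- q b) \<bullet> (w - midpoint (S t x) (S b x)) \<le> F w"
        using quot_subgradient[OF x t b(1) w] unfolding q_gt minus_minus by linarith
    qed simp
  qed simp
  have "(S t x - v) \<bullet> L + l / 2 * (norm (S t x - v))\<^sup>2 \<le> F v - F (S t x)" if v: "v \<in> D" for v
  proof -
    let ?N = "(norm (S t x - v))\<^sup>2"
    have "F (S t x) + (- L) \<bullet> (v - S t x) + l / 2 * ?N \<le> F v"
    proof (rule le_of_mult_pos_limit)
      fix s :: real assume s: "0 < s" "s \<le> 1"
      let ?w = "(1 - s) *\<^sub>R S t x + s *\<^sub>R v"
      have "?w - S t x = s *\<^sub>R (v - S t x)" by (simp add: algebra_simps)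
      then have "F (S t x) + s * ((- L) \<bullet> (v - S t x)) \<le> F ?w"
        using sub[OF convex_D[OF tD v, of s]] s by simp
      also have "\<dots> \<le> (1 - s) * F (S t x) + s * F v - l / 2 * (s * (1 - s)) * ?N"
        using convex_F[OF tD v, of s] s by simp
      finally have "s * (F (S t x) + (- L) \<bullet> (v - S t x) + l / 2 * ?N) \<le> s * (F v + s * (l / 2 * ?N))"
        by (simp add: algebra_simps diff_divide_distrib)
      then show "F (S t x) + (- L) \<bullet> (v - S t x) + l / 2 * ?N \<le> F v + s * (l / 2 * ?N)"
        using s by (simp only: mult_le_cancel_left_pos)
    qed
    then show ?thesis by (simp add: inner_simps inner_commute)
  qed
  then show thesis using that der by blast
qed

text \<open>The initial point is approximated by a point \<open>v\<close> of finite slope, whose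
  orbit moves at speed at most \<open>M\<close> from time zero on; nonexpansiveness transfers the
  continuity.\<close>

lemma S_tendsto_initial:
  assumes x: "x \<in> H"
  shows "((\<lambda>t. S t x) \<longlongrightarrow> x) (at_right 0)"
proof (rule tendstoI)
  fix e :: real assume e: "0 < e"
  obtain v M where v: "slope_bound v M" and xv: "norm (x - v) < e / 3"
    using dense_slope_bound[OF x, of "e / 3"] e by auto
  have vH: "v \<in> H" using slope_boundD(1)[OF v] in_H by blast
  have "dist (S t x) x < e" if t: "0 < t" "t < e / 3 / (M + 1)" for t
  proof -
    have M: "0 \<le> M" by (rule slope_boundD(2)[OF v])
    have "norm (S t x - S t v) \<le> norm (x - v)" using S_nonexpansive[OF x vH] t by simp
    moreover have "norm (S t v - v) \<le> M * t" using S_drift[OF v] t by simp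
    moreover have "M * t < e / 3"
    proof -
      have "M * t \<le> (M + 1) * t" using t by simp
      also have "\<dots> < e / 3"
        using t(2) M by (subst mult.commute) (simp only: pos_less_divide_eq add_nonneg_pos zero_less_one)
      finally show ?thesis .
    qed
    moreover have "norm (S t x - x) \<le> norm (S t x - S t v) + norm (S t v - v) + norm (x - v)"
      using norm_triangle_ineq[of "S t x - S t v" "S t v - x"] norm_triangle_ineq4[of "S t v - v" "x - v"] by simp
    ultimately show ?thesis using xv by (simp add: dist_norm)
  qed
  moreover have "0 < e / 3 / (M + 1)" using e slope_boundD(2)[OF v] by simp
  ultimately show "\<forall>\<^sub>F t in at_right 0. dist (S t x) x < e"
    unfolding eventually_at_right_field by blast
qed

lemma S_abs_continuous:
  assumes x: "x \<in> H" and a: "0 < a"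
  shows "abs_continuous_on {a..b} (\<lambda>t. S t x)"
  unfolding abs_continuous_on_def
proof (intro allI impI)
  fix e :: real assume e: "0 < e"
  define K where "K = minslope (S a x)"
  have K: "0 \<le> K" unfolding K_def using slope_boundD(2)[OF slope_bound_S[OF x a]] .
  have "(\<Sum>(u, v)\<in>D. dist (S u x) (S v x)) < e"
    if D: "\<forall>(u, v)\<in>D. u \<le> v \<and> {u..v} \<subseteq> {a..b}" "(\<Sum>(u, v)\<in>D. v - u) < e / (K + 1)" for D
  proof -
    have "(\<Sum>(u, v)\<in>D. dist (S u x) (S v x)) \<le> (\<Sum>(u, v)\<in>D. K * (v - u))"
    proof (rule sum_mono, clarify)
      fix u v assume "(u, v) \<in> D"
      then have "u \<le> v" "{u..v} \<subseteq> {a..b}" using D(1) by auto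
      then have "u \<le> v" "a \<le> u" "a \<le> v" by auto
      then show "dist (S u x) (S v x) \<le> K * (v - u)"
        using S_lipschitz[OF x a, of u v] by (simp add: K_def dist_norm)
    qed
    also have "\<dots> = K * (\<Sum>(u, v)\<in>D. v - u)" by (simp add: sum_distrib_left split_def)
    also have "\<dots> \<le> K * (e / (K + 1))" using D(2) K by (intro mult_left_mono) auto
    also have "\<dots> = e * (K / (K + 1))" by simp
    also have "\<dots> < e * 1" using e K by (intro mult_strict_left_mono) auto
    finally show ?thesis by simp
  qed
  moreover have "0 < e / (K + 1)" using e K by simp
  ultimately show "\<exists>\<delta>>0. \<forall>D. finite D \<longrightarrow> (\<forall>(u, v)\<in>D. u \<le> v \<and> {u..v} \<subseteq> {a..b}) \<longrightarrow>
     pairwise (\<lambda>(u, v) (u', v'). disjnt {u<..<v} {u'<..<v'}) D \<longrightarrow>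
     (\<Sum>(u, v)\<in>D. v - u) < \<delta> \<longrightarrow> (\<Sum>(u, v)\<in>D. dist (S u x) (S v x)) < e"
    by (intro exI[of _ "e / (K + 1)"]) auto
qed

text \<open>Only the squared distances of \<open>g\<close> to fixed points are known to be
  differentiable, so the derivative of \<open>f\<close> at \<open>s\<close> is computed with
  \<open>h s\<close> frozen. The inequality for \<open>g\<close> tested at \<open>h s\<close> and
  that for \<open>h\<close> tested at \<open>g s\<close> then cancel the energies.\<close>

lemma EVI_characterizes_S:
  assumes x: "x \<in> H" and gH: "\<And>t. 0 < t \<Longrightarrow> g t \<in> H"
    and ac: "\<And>a b. 0 < a \<Longrightarrow> a \<le> b \<Longrightarrow> abs_continuous_on {a..b} g"
    and g0: "(g \<longlongrightarrow> x) (at_right 0)" and N: "negligible N"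
    and gD: "\<And>t. 0 < t \<Longrightarrow> t \<notin> N \<Longrightarrow> g t \<in> D"
    and evi: "\<And>t v. 0 < t \<Longrightarrow> t \<notin> N \<Longrightarrow> v \<in> D \<Longrightarrow> \<exists>d. ((\<lambda>s. (norm (g s - v))\<^sup>2) has_real_derivative d) (at t) \<and>
        1 / 2 * d + l / 2 * (norm (g t - v))\<^sup>2 \<le> F v - F (g t)"
    and t: "0 < t"
  shows "g t = S t x"
proof -
  define h where "h s = S s x" for s
  define f where "f s = (norm (g s - h s))\<^sup>2" for s
  define N' where "N' = N \<union> {t \<in> {0<..}. \<not> isCont (\<lambda>s. minslope (S s x)) t}"
  have N': "negligible N'"
    unfolding N'_def
    by (intro negligible_Un N negligible_iff_null_sets[THEN iffD2] null_sets_completionI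
      countable_imp_null_set_lborel countable_minslope_discont x)
  have der: "\<exists>d\<le>0. (f has_real_derivative d) (at s)" if s: "0 < s" "s \<notin> N'" for s
  proof -
    have sN: "s \<notin> N" and cont: "isCont (\<lambda>s. minslope (S s x)) s" using s by (auto simp: N'_def)
    obtain L where L: "(h has_vector_derivative L) (at s)"
      and sub: "\<And>v. v \<in> D \<Longrightarrow> (h s - v) \<bullet> L + l / 2 * (norm (h s - v))\<^sup>2 \<le> F v - F (h s)"
      using S_differentiable[OF x s(1) cont] unfolding h_def[symmetric, abs_def] by blast
    have hD: "h s \<in> D" unfolding h_def using slope_boundD(1)[OF slope_bound_S[OF x s(1)]] .
    obtain d where d: "((\<lambda>r. (norm (g r - h s))\<^sup>2) has_real_derivative d) (at s)"
      and dle: "1 / 2 * d + l / 2 * (norm (g s - h s))\<^sup>2 \<le> F (h s) - F (g s)"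
      using evi[OF s(1) sN hD] by blast
    have "continuous_on {s / 2..2 * s} g"
      by (rule abs_continuous_on_imp_continuous_on[OF ac]) (use s in auto)
    then have "isCont g s" using s by (intro continuous_on_interior) (auto simp: interior_atLeastAtMost_real)
    then have g_cont: "(g \<longlongrightarrow> g s) (at s)" by (simp add: isCont_def)
    have h_quot: "((\<lambda>r. (h r - h s) /\<^sub>R (r - s)) \<longlongrightarrow> L) (at s)"
      using L by (simp only: has_vector_derivative_iff_quotient)
    have h_cont: "(h \<longlongrightarrow> h s) (at s)"
      using has_vector_derivative_continuous[OF L] by (simp add: isCont_def)
    have "((\<lambda>r. ((norm (g r - h s))\<^sup>2 - (norm (g s - h s))\<^sup>2) / (r - s)
        - 2 * ((g r - h s) \<bullet> ((h r - h s) /\<^sub>R (r - s))) + (h r - h s) \<bullet> ((h r - h s) /\<^sub>R (r - s)))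
      \<longlongrightarrow> d - 2 * ((g s - h s) \<bullet> L) + (h s - h s) \<bullet> L) (at s)"
      using d[unfolded has_field_derivative_iff] by (intro tendsto_intros g_cont h_quot h_cont)
    moreover have "((norm (g r - h s))\<^sup>2 - (norm (g s - h s))\<^sup>2) / (r - s)
        - 2 * ((g r - h s) \<bullet> ((h r - h s) /\<^sub>R (r - s))) + (h r - h s) \<bullet> ((h r - h s) /\<^sub>R (r - s))
      = (f r - f s) / (r - s)" for r
    proof -
      have "f r - f s = (norm (g r - h s))\<^sup>2 - (norm (g s - h s))\<^sup>2 - 2 * ((g r - h s) \<bullet> (h r - h s)) + (h r - h s) \<bullet> (h r - h s)"
        by (simp add: f_def power2_norm_eq_inner inner_simps inner_commute)
      moreover have "a / c - 2 * (inverse c * b) + inverse c * e = (a - 2 * b + e) / c" for a b c e :: real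
        by (simp add: divide_inverse algebra_simps)
      ultimately show ?thesis by simp
    qed
    ultimately have "(f has_real_derivative d - 2 * ((g s - h s) \<bullet> L)) (at s)"
      unfolding has_field_derivative_iff by simp
    moreover have "d - 2 * ((g s - h s) \<bullet> L) \<le> 0"
    proof -
      have "(h s - g s) \<bullet> L = - ((g s - h s) \<bullet> L)" by (simp add: inner_simps)
      moreover have "0 \<le> l / 2 * (norm (g s - h s))\<^sup>2" using l_pos by simp
      ultimately show ?thesis
        using dle sub[OF gD[OF s(1) sN]] by (simp add: norm_minus_commute)
    qed
    ultimately show ?thesis by blast
  qed
  have mono: "f b \<le> f a" if ab: "0 < a" "a \<le> b" for a b
  proof (rule abs_continuous_nonincreasing[OF ab(2) _ N'])
    show "\<exists>d\<le>0. (f has_real_derivative d) (at s)" if "s \<in> {a..b} - N'" for s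
      using der[of s] that ab by auto
    have cont: "continuous_on {a..b} (\<lambda>s. norm (g s - h s))"
      unfolding h_def
      by (intro continuous_intros abs_continuous_on_imp_continuous_on ac S_abs_continuous x ab)
    have "\<exists>B. \<forall>s\<in>{a..b}. norm (g s - h s) \<le> B"
      using compact_imp_bounded[OF compact_continuous_image[OF cont compact_Icc]]
      by (auto simp: bounded_real)
    then obtain B where B: "\<And>s. s \<in> {a..b} \<Longrightarrow> norm (g s - h s) \<le> B" by blast
    define K where "K = minslope (S a x)"
    have K: "0 \<le> K" unfolding K_def using slope_boundD(2)[OF slope_bound_S[OF x ab(1)]] .
    have B0: "0 \<le> B" using order_trans[OF norm_ge_zero B[of a]] ab by simp
    show "abs_continuous_on {a..b} f"
    proof (rule abs_continuous_on_lipschitz_combination[OF ac[OF ab]])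
      show "0 \<le> 2 * B * (K + 1)" using B0 K by simp
      fix s r assume s: "s \<in> {a..b}" "r \<in> {a..b}"
      let ?p = "norm (g s - h s)" and ?q = "norm (g r - h r)"
      have "dist (f s) (f r) = \<bar>?p - ?q\<bar> * \<bar>?p + ?q\<bar>"
        unfolding f_def dist_real_def abs_mult[symmetric]
        by (simp add: square_diff_square_factored[symmetric] power2_eq_square algebra_simps)
      also have "\<dots> \<le> (dist (g s) (g r) + K * \<bar>s - r\<bar>) * (2 * B)"
      proof (rule mult_mono)
        have "\<bar>?p - ?q\<bar> \<le> norm ((g s - h s) - (g r - h r))" by (rule norm_triangle_ineq3)
        also have "\<dots> \<le> dist (g s) (g r) + norm (h s - h r)"
          using norm_triangle_ineq4[of "g s - g r" "h s - h r"] by (simp add: dist_norm algebra_simps)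
        finally show "\<bar>?p - ?q\<bar> \<le> dist (g s) (g r) + K * \<bar>s - r\<bar>"
          using S_lipschitz[OF x ab(1), of s r] s by (simp add: h_def K_def)
        show "\<bar>?p + ?q\<bar> \<le> 2 * B" using B[OF s(1)] B[OF s(2)] by simp
      qed (use K B0 in auto)
      also have "\<dots> \<le> ((K + 1) * (dist (g s) (g r) + \<bar>s - r\<bar>)) * (2 * B)"
        using K B0 by (intro mult_right_mono) (auto simp: algebra_simps)
      finally show "dist (f s) (f r) \<le> 2 * B * (K + 1) * (dist (g s) (g r) + \<bar>s - r\<bar>)"
        by (simp only: mult_ac)
    qed
  qed
  \<comment> \<open>Monotonicity is known at positive times; the common limit at zero then forces
    \<open>f\<close> to vanish.\<close>
  have "((\<lambda>s. norm (g s - h s)) \<longlongrightarrow> norm (x - x)) (at_right 0)"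
    unfolding h_def by (intro tendsto_intros g0 S_tendsto_initial x)
  then have "(f \<longlongrightarrow> 0\<^sup>2) (at_right 0)" unfolding f_def by (intro tendsto_power) simp
  then have "f t \<le> 0\<^sup>2"
    by (rule tendsto_lowerbound)
       (use t in \<open>auto simp: eventually_at_right_field intro!: exI[of _ t] mono\<close>)
  then show ?thesis by (simp add: f_def h_def)
qed

end

section \<open>Square integrable functions\<close>

lemma l2_rel_self [simp]: "l2_rel f f \<longleftrightarrow> f \<in> sq_integrable"
  by (auto simp: l2_rel_def)

lemma sq_integrable_measurable [measurable_dest]: "f \<in> sq_integrable \<Longrightarrow> f \<in> borel_measurable torus"
  by (simp add: sq_integrable_def)

lemma l2_exhaust:
  obtains f where "f \<in> sq_integrable" "u = abs_l2 f"
proof -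
  have "\<exists>f. f \<in> sq_integrable \<and> u = abs_l2 f"
    by (induction u rule: l2.abs_induct) auto
  then show thesis using that by blast
qed

lemma emeasure_torus: "emeasure torus (space torus) = 1"
  by (simp add: torus_def emeasure_restrict_space space_restrict_space)

lemma measure_torus: "measure torus (space torus) = 1"
  by (simp add: measure_def emeasure_torus)

lemma bounded_sq_integrable:
  assumes f: "f \<in> borel_measurable torus" and B: "\<And>x. x \<in> {0..1} \<Longrightarrow> \<bar>f x\<bar> \<le> B"
  shows "f \<in> sq_integrable"
proof -
  have "integrable torus (\<lambda>x. (f x)\<^sup>2)"
  proof (rule torus.integrable_const_bound[of _ "B\<^sup>2"])
    have "(f x)\<^sup>2 \<le> B\<^sup>2" if "x \<in> {0..1}" for x
      using power_mono[OF B[OF that], of 2] by simp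
    then show "AE x in torus. norm ((f x)\<^sup>2) \<le> B\<^sup>2"
      by (intro AE_I2) (auto simp: torus_def space_restrict_space)
  qed (use f in measurable)
  then show ?thesis using f by (simp add: sq_integrable_def)
qed

lemma continuous_measurable_torus: "continuous_on {0..1} f \<Longrightarrow> f \<in> borel_measurable torus"
  unfolding torus_def by (rule continuous_imp_measurable_on_sets_lebesgue) auto

lemma continuous_sq_integrable:
  fixes f :: "real \<Rightarrow> real"
  assumes f: "continuous_on {0..1} f"
  shows "f \<in> sq_integrable"
proof -
  have "bounded (f ` {0..1})"
    by (rule compact_imp_bounded[OF compact_continuous_image[OF f compact_Icc]])
  then have "\<exists>B. \<forall>x\<in>{0..1}. \<bar>f x\<bar> \<le> B" by (auto simp: bounded_real)
  then obtain B where "\<And>x. x \<in> {0..1} \<Longrightarrow> \<bar>f x\<bar> \<le> B" by blast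
  then show ?thesis using continuous_measurable_torus[OF f] bounded_sq_integrable by blast
qed

lemma sq_integrable_imp_integrable: "f \<in> sq_integrable \<Longrightarrow> integrable torus f"
  using sq_integrable_prod[OF _ sq_integrable_const[of 1], of f] by simp

lemma norm_abs_l2:
  assumes "f \<in> sq_integrable"
  shows "(norm (abs_l2 f))\<^sup>2 = (\<integral>x. (f x)\<^sup>2 \<partial>torus)"
  unfolding power2_norm_eq_inner using assms by (simp add: inner_l2.abs_eq power2_eq_square)

lemma norm_abs_l2_diff:
  assumes "f \<in> sq_integrable" "g \<in> sq_integrable"
  shows "(norm (abs_l2 f - abs_l2 g))\<^sup>2 = (\<integral>x. (f x - g x)\<^sup>2 \<partial>torus)"
  using assms norm_abs_l2[OF sq_integrable_diff[OF assms]] by (simp add: minus_l2.abs_eq)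

lemma norm_one_l2: "norm (abs_l2 (\<lambda>x. 1)) = 1"
proof (rule power2_eq_imp_eq)
  show "(norm (abs_l2 (\<lambda>x. 1)))\<^sup>2 = 1\<^sup>2"
    using norm_abs_l2[OF sq_integrable_const[of 1]] by (simp add: measure_torus)
qed auto

lemma integral_abs_le_norm:
  assumes f: "f \<in> sq_integrable"
  shows "(\<integral>x. \<bar>f x\<bar> \<partial>torus) \<le> norm (abs_l2 f)"
proof -
  have a: "(\<lambda>x. \<bar>f x\<bar>) \<in> sq_integrable" using f by (auto simp: sq_integrable_def)
  have "(\<integral>x. \<bar>f x\<bar> \<partial>torus) = inner (abs_l2 (\<lambda>x. \<bar>f x\<bar>)) (abs_l2 (\<lambda>x. 1))"
    using a sq_integrable_const[of 1] by (simp add: inner_l2.abs_eq)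
  also have "\<dots> \<le> norm (abs_l2 (\<lambda>x. \<bar>f x\<bar>)) * norm (abs_l2 (\<lambda>x. 1))"
    by (rule norm_cauchy_schwarz)
  also note norm_one_l2
  also have "norm (abs_l2 (\<lambda>x. \<bar>f x\<bar>)) = norm (abs_l2 f)"
  proof (rule power2_eq_imp_eq)
    show "(norm (abs_l2 (\<lambda>x. \<bar>f x\<bar>)))\<^sup>2 = (norm (abs_l2 f))\<^sup>2"
      unfolding norm_abs_l2[OF a] norm_abs_l2[OF f] by simp
  qed auto
  finally show ?thesis by simp
qed

section \<open>Pointwise convergence and completeness\<close>

lemma abs_l2_dominated_convergence:
  assumes f: "\<And>n::nat. f n \<in> sq_integrable" and g: "g \<in> sq_integrable" and w: "w \<in> sq_integrable"
    and bound: "\<And>n. AE x in torus. \<bar>f n x - g x\<bar> \<le> w x"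
    and lim: "AE x in torus. (\<lambda>n. f n x) \<longlonglongrightarrow> g x"
  shows "(\<lambda>n. abs_l2 (f n)) \<longlonglongrightarrow> abs_l2 g"
proof -
  have "(\<lambda>n. \<integral>x. (f n x - g x)\<^sup>2 \<partial>torus) \<longlonglongrightarrow> (\<integral>x. 0 \<partial>torus)"
  proof (rule integral_dominated_convergence[where w = "\<lambda>x. (w x)\<^sup>2"])
    show "integrable torus (\<lambda>x. (w x)\<^sup>2)" using w by (simp add: sq_integrable_def)
    show "AE x in torus. (\<lambda>n. (f n x - g x)\<^sup>2) \<longlonglongrightarrow> 0"
      using lim
    proof eventually_elim
      case (elim x)
      then have "(\<lambda>n. (f n x - g x)\<^sup>2) \<longlonglongrightarrow> (g x - g x)\<^sup>2" by (intro tendsto_intros)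
      then show ?case by simp
    qed
    show "AE x in torus. norm ((f n x - g x)\<^sup>2) \<le> (w x)\<^sup>2" for n
      using bound[of n] by eventually_elim (use power_mono[of "\<bar>_\<bar>" _ 2] in fastforce)
  qed (use f g in measurable)
  then have "(\<lambda>n. (norm (abs_l2 (f n) - abs_l2 g))\<^sup>2) \<longlonglongrightarrow> 0"
    using f g by (simp add: norm_abs_l2_diff)
  then have "(\<lambda>n. sqrt ((norm (abs_l2 (f n) - abs_l2 g))\<^sup>2)) \<longlonglongrightarrow> sqrt 0" by (rule tendsto_real_sqrt)
  then show ?thesis by (simp add: LIM_zero_cancel tendsto_norm_zero_iff)
qed

text \<open>On a space of measure one, convergence in the quadratic mean implies convergence in
  \<open>L^1\<close>, which yields the subsequence.\<close>

lemma AE_convergent_subsequence: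
  assumes f: "\<And>n::nat. f n \<in> sq_integrable" and g: "g \<in> sq_integrable"
    and lim: "(\<lambda>n. abs_l2 (f n)) \<longlonglongrightarrow> abs_l2 g"
  obtains r where "strict_mono r" "AE x in torus. (\<lambda>n. f (r n) x) \<longlonglongrightarrow> g x"
proof -
  have d: "(\<lambda>x. f n x - g x) \<in> sq_integrable" for n by (rule sq_integrable_diff[OF f g])
  have "(\<lambda>n. \<integral>x. \<bar>f n x - g x\<bar> \<partial>torus) \<longlonglongrightarrow> 0"
  proof (rule tendsto_sandwich[of "\<lambda>_. 0" _ _ "\<lambda>n. norm (abs_l2 (f n) - abs_l2 g)"])
    show "\<forall>\<^sub>F n in sequentially. (\<integral>x. \<bar>f n x - g x\<bar> \<partial>torus) \<le> norm (abs_l2 (f n) - abs_l2 g)"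
      using integral_abs_le_norm[OF d] f g by (simp add: minus_l2.abs_eq)
    show "(\<lambda>n. norm (abs_l2 (f n) - abs_l2 g)) \<longlonglongrightarrow> 0"
      using lim by (simp add: LIM_zero tendsto_norm_zero)
  qed auto
  then have "\<exists>r. strict_mono r \<and> (AE x in torus. (\<lambda>n. f (r n) x) \<longlonglongrightarrow> g x)"
    using tendsto_L1_AE_subseq[of torus "\<lambda>n x. f n x - g x"] sq_integrable_imp_integrable[OF d]
    by (auto simp: LIM_zero_iff)
  then show thesis using that by blast
qed

text \<open>The increments are summable in \<open>L^1\<close>, hence absolutely summable at almost
  every point, and they telescope.\<close>

lemma AE_convergent_of_summable_norms:
  assumes f: "\<And>n::nat. f n \<in> sq_integrable" and s: "summable (\<lambda>n. norm (abs_l2 (f (Suc n)) - abs_l2 (f n)))"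
  shows "AE x in torus. convergent (\<lambda>n. f n x)"
proof -
  have d: "(\<lambda>x. f (Suc n) x - f n x) \<in> sq_integrable" for n by (rule sq_integrable_diff[OF f f])
  have m: "(\<lambda>x. ennreal \<bar>f (Suc n) x - f n x\<bar>) \<in> borel_measurable torus" for n
    using f by measurable
  have "(\<integral>\<^sup>+x. (\<Sum>n. ennreal \<bar>f (Suc n) x - f n x\<bar>) \<partial>torus) = (\<Sum>n. \<integral>\<^sup>+x. ennreal \<bar>f (Suc n) x - f n x\<bar> \<partial>torus)"
    by (rule nn_integral_suminf[OF m])
  also have "\<dots> \<le> (\<Sum>n. ennreal (norm (abs_l2 (f (Suc n)) - abs_l2 (f n))))"
  proof (rule suminf_le)
    fix n
    have "(\<integral>\<^sup>+x. ennreal \<bar>f (Suc n) x - f n x\<bar> \<partial>torus) = ennreal (\<integral>x. \<bar>f (Suc n) x - f n x\<bar> \<partial>torus)"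
      using sq_integrable_imp_integrable[OF d] by (intro nn_integral_eq_integral) auto
    also have "\<dots> \<le> ennreal (norm (abs_l2 (f (Suc n)) - abs_l2 (f n)))"
      using integral_abs_le_norm[OF d, of n] f by (simp add: minus_l2.abs_eq ennreal_leI)
    finally show "(\<integral>\<^sup>+x. ennreal \<bar>f (Suc n) x - f n x\<bar> \<partial>torus) \<le> \<dots>" .
  qed auto
  also have "\<dots> = ennreal (\<Sum>n. norm (abs_l2 (f (Suc n)) - abs_l2 (f n)))"
    by (rule suminf_ennreal2[OF _ s]) simp
  also have "\<dots> < \<infinity>" by simp
  finally have "(\<integral>\<^sup>+x. (\<Sum>n. ennreal \<bar>f (Suc n) x - f n x\<bar>) \<partial>torus) \<noteq> \<infinity>" by simp
  then have "AE x in torus. (\<Sum>n. ennreal \<bar>f (Suc n) x - f n x\<bar>) \<noteq> \<infinity>"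
    by (intro nn_integral_noteq_infinite) (use m in measurable)
  then show ?thesis
  proof eventually_elim
    case (elim x)
    then have "summable (\<lambda>n. \<bar>f (Suc n) x - f n x\<bar>)"
      by (intro summable_suminf_not_top) auto
    then have "summable (\<lambda>n. f (Suc n) x - f n x)" by (rule summable_rabs_cancel)
    then have "convergent (\<lambda>n. \<Sum>i<n. f (Suc i) x - f i x)" by (simp add: summable_iff_convergent)
    then have "convergent (\<lambda>n. f n x - f 0 x)"
      unfolding sum_lessThan_telescope[of "\<lambda>i. f i x"] .
    then have "convergent (\<lambda>n. (f n x - f 0 x) + f 0 x)" by (intro convergent_add convergent_const)
    then show ?case by simp
  qed
qed

text \<open>Riesz-Fischer. A fast subsequence converges almost everywhere, and Fatou's lemma turns
  the Cauchy bounds into bounds on the distance to the pointwise limit.\<close>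

lemma complete_l2: "complete (UNIV :: l2 set)"
proof (rule completeI)
  fix w :: "nat \<Rightarrow> l2" assume w: "Cauchy w"
  have "\<exists>r. strict_mono r \<and> (\<forall>n. norm (w (r (Suc n)) - w (r n)) < (1 / 2) ^ n)"
  proof -
    have "\<exists>N. \<forall>m\<ge>N. \<forall>k\<ge>N. norm (w m - w k) < (1 / 2) ^ n" for n
      using w[unfolded Cauchy_iff, rule_format, of "(1 / 2) ^ n"] by simp
    then obtain N where N: "\<And>n m k. m \<ge> N n \<Longrightarrow> k \<ge> N n \<Longrightarrow> norm (w m - w k) < (1 / 2) ^ n" by metis
    \<comment> \<open>Adding \<open>n\<close> and all thresholds up to \<open>n\<close> makes
      \<open>r\<close> strictly increasing and at least \<open>N n\<close>.\<close>
    define r where "r n = n + (\<Sum>i\<le>n. N i)" for n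
    have "strict_mono r" by (rule strict_mono_Suc_iff[THEN iffD2]) (simp add: r_def)
    moreover have "N n \<le> r n" for n
      unfolding r_def by (rule trans_le_add2) (rule member_le_sum, auto)
    moreover have "N n \<le> r (Suc n)" for n
      using \<open>N n \<le> r n\<close> strict_mono_less_eq[OF \<open>strict_mono r\<close>, of n "Suc n"] by simp
    ultimately show ?thesis using N by blast
  qed
  then obtain r where r: "strict_mono r" and step: "\<And>n. norm (w (r (Suc n)) - w (r n)) < (1 / 2) ^ n" by blast
  have "\<exists>g. g \<in> sq_integrable \<and> w (r n) = abs_l2 g" for n
    using l2_exhaust[of "w (r n)"] by blast
  then obtain f where f: "\<And>n. f n \<in> sq_integrable" and wf: "\<And>n. w (r n) = abs_l2 (f n)" by metis
  have "summable (\<lambda>n. norm (abs_l2 (f (Suc n)) - abs_l2 (f n)))"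
    by (rule summable_comparison_test'[of "\<lambda>n. (1 / 2) ^ n" 0])
       (use step less_imp_le in \<open>auto simp: wf[symmetric]\<close>)
  from AE_convergent_of_summable_norms[OF f this]
  have conv: "AE x in torus. (\<lambda>n. f n x) \<longlonglongrightarrow> lim (\<lambda>n. f n x)" by (simp add: convergent_LIMSEQ_iff)
  define g where "g x = lim (\<lambda>n. f n x)" for x
  have gm: "g \<in> borel_measurable torus" unfolding g_def using f by measurable
  have fatou: "(\<integral>\<^sup>+x. ennreal ((g x - f n x)\<^sup>2) \<partial>torus) \<le> ennreal (e\<^sup>2)"
    if e: "0 < e" and n: "\<And>m. m \<ge> n \<Longrightarrow> norm (w (r m) - w (r n)) \<le> e" for n e
  proof -
    have "(\<integral>\<^sup>+x. ennreal ((g x - f n x)\<^sup>2) \<partial>torus) = (\<integral>\<^sup>+x. liminf (\<lambda>m. ennreal ((f m x - f n x)\<^sup>2)) \<partial>torus)"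
      using conv
    proof (intro nn_integral_cong_AE, eventually_elim)
      case (elim x)
      then have "(\<lambda>m. ennreal ((f m x - f n x)\<^sup>2)) \<longlonglongrightarrow> ennreal ((g x - f n x)\<^sup>2)"
        unfolding g_def by (intro tendsto_intros)
      then show ?case by (rule lim_imp_Liminf[OF trivial_limit_sequentially, symmetric])
    qed
    also have "\<dots> \<le> liminf (\<lambda>m. \<integral>\<^sup>+x. ennreal ((f m x - f n x)\<^sup>2) \<partial>torus)"
      by (rule nn_integral_liminf) (use f in measurable)
    also have "\<dots> \<le> ennreal (e\<^sup>2)"
    proof (rule Liminf_le)
      show "\<forall>\<^sub>F m in sequentially. (\<integral>\<^sup>+x. ennreal ((f m x - f n x)\<^sup>2) \<partial>torus) \<le> ennreal (e\<^sup>2)"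
        unfolding eventually_sequentially
      proof (intro exI[of _ n] allI impI)
        fix m assume m: "n \<le> m"
        have "(\<integral>\<^sup>+x. ennreal ((f m x - f n x)\<^sup>2) \<partial>torus) = ennreal ((norm (abs_l2 (f m) - abs_l2 (f n)))\<^sup>2)"
          using sq_integrable_diff[OF f f] unfolding norm_abs_l2_diff[OF f f]
          by (intro nn_integral_eq_integral) (auto simp: sq_integrable_def)
        also have "\<dots> \<le> ennreal (e\<^sup>2)"
          using n[OF m] by (intro ennreal_leI power_mono) (auto simp: wf)
        finally show "(\<integral>\<^sup>+x. ennreal ((f m x - f n x)\<^sup>2) \<partial>torus) \<le> ennreal (e\<^sup>2)" .
      qed
    qed simp
    finally show ?thesis .
  qed
  have near: "\<exists>N. \<forall>n\<ge>N. \<forall>m\<ge>n. norm (w (r m) - w (r n)) \<le> e" if "0 < e" for e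
    using w[unfolded Cauchy_iff, rule_format, OF that] seq_suble[OF r] less_imp_le
    by (meson order_trans)
  have sq_diff: "(\<lambda>x. g x - f n x) \<in> sq_integrable \<and> (norm (abs_l2 (\<lambda>x. g x - f n x)))\<^sup>2 \<le> e\<^sup>2"
    if e: "0 < e" and n: "\<And>m. m \<ge> n \<Longrightarrow> norm (w (r m) - w (r n)) \<le> e" for n e
  proof -
    have m: "(\<lambda>x. g x - f n x) \<in> borel_measurable torus" using gm f by measurable
    have i: "integrable torus (\<lambda>x. (g x - f n x)\<^sup>2)"
    proof (rule integrableI_bounded)
      show "(\<integral>\<^sup>+x. ennreal (norm ((g x - f n x)\<^sup>2)) \<partial>torus) < \<infinity>"
        using fatou[OF that] by (simp add: le_less_trans)
    qed (use m in measurable)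
    then have s: "(\<lambda>x. g x - f n x) \<in> sq_integrable" using m by (simp add: sq_integrable_def)
    have "ennreal (\<integral>x. (g x - f n x)\<^sup>2 \<partial>torus) \<le> ennreal (e\<^sup>2)"
      using fatou[OF that] i by (simp add: nn_integral_eq_integral)
    then show ?thesis using s by (simp add: norm_abs_l2 ennreal_le_iff)
  qed
  obtain N1 where N1: "\<And>m. m \<ge> N1 \<Longrightarrow> norm (w (r m) - w (r N1)) \<le> 1" using near[of 1] by auto
  have "(\<lambda>x. (g x - f N1 x) + f N1 x) \<in> sq_integrable"
    using sq_diff[OF _ N1] by (intro sq_integrable_add f) auto
  then have g: "g \<in> sq_integrable" by simp
  have "w \<longlonglongrightarrow> abs_l2 g"
  proof (rule LIMSEQ_I)
    fix e :: real assume e: "0 < e"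
    obtain N where N: "\<And>n m. n \<ge> N \<Longrightarrow> m \<ge> n \<Longrightarrow> norm (w (r m) - w (r n)) \<le> e / 3" using near[of "e / 3"] e by auto
    obtain M where M: "\<And>m k. m \<ge> M \<Longrightarrow> k \<ge> M \<Longrightarrow> norm (w m - w k) < e / 3"
      using w[unfolded Cauchy_iff, rule_format, of "e / 3"] e by auto
    define n where "n = max N M"
    have rn: "M \<le> r n" using seq_suble[OF r, of n] by (simp add: n_def)
    have "(norm (abs_l2 (\<lambda>x. g x - f n x)))\<^sup>2 \<le> (e / 3)\<^sup>2"
      using sq_diff[of "e / 3" n] N[of n] e by (simp add: n_def)
    then have "norm (abs_l2 g - w (r n)) \<le> e / 3"
      using e g f by (simp add: wf minus_l2.abs_eq power2_le_iff_abs_le)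
    then have "norm (w k - abs_l2 g) < e" if "k \<ge> M" for k
      using M[OF that rn] norm_diff_le_add[of "w k" "abs_l2 g" "w (r n)"] e by linarith
    then show "\<exists>no. \<forall>n\<ge>no. norm (w n - abs_l2 g) < e" by blast
  qed
  then show "\<exists>l\<in>UNIV. w \<longlonglongrightarrow> l" by blast
qed

section \<open>Density of trigonometric polynomials\<close>

definition trigpoly :: "nat \<Rightarrow> (nat \<Rightarrow> real) \<Rightarrow> (nat \<Rightarrow> real) \<Rightarrow> real \<Rightarrow> real" where
  "trigpoly n a b x = (\<Sum>k\<le>n. a k * cos (2 * pi * real k * x) + b k * sin (2 * pi * real k * x))"

text \<open>Integer frequencies make the product of two terms a sum of two terms without case distinction.\<close>

definition trig_term :: "real \<Rightarrow> real \<Rightarrow> int \<Rightarrow> real \<Rightarrow> real" where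
  "trig_term a b k x = a * cos (2 * pi * of_int k * x) + b * sin (2 * pi * of_int k * x)"

text \<open>Frequencies may repeat or be negative, so closure under sums and products needs no
  bookkeeping; \<open>trig_sum_imp_trigpoly\<close> collects the coefficients afterwards.\<close>

inductive trig_sum :: "(real \<Rightarrow> real) \<Rightarrow> bool" where
  zero: "trig_sum (\<lambda>x. 0)"
| add_term: "trig_sum f \<Longrightarrow> trig_sum (\<lambda>x. f x + trig_term a b k x)"

lemma trig_term_mult:
  "trig_term a b k x * trig_term c d m x =
    trig_term ((a * c + b * d) / 2) ((b * c - a * d) / 2) (k - m) x
    + trig_term ((a * c - b * d) / 2) ((a * d + b * c) / 2) (k + m) x"
proof -
  define w z where "w = 2 * pi * of_int k * x" and "z = 2 * pi * of_int m * x"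
  have eqs: "2 * pi * of_int (k - m) * x = w - z" "2 * pi * of_int (k + m) * x = w + z"
    by (simp_all add: w_def z_def algebra_simps)
  show ?thesis
    unfolding trig_term_def eqs w_def[symmetric] z_def[symmetric]
    by (simp add: cos_diff cos_add sin_diff sin_add field_simps)
qed

lemma trig_sum_term: "trig_sum (trig_term a b k)"
  using trig_sum.add_term[OF trig_sum.zero, of a b k] by simp

lemma trig_sum_add:
  assumes "trig_sum f" "trig_sum g"
  shows "trig_sum (\<lambda>x. f x + g x)"
  using assms(2)
proof induction
  case (add_term g a b k)
  show ?case using trig_sum.add_term[OF add_term.IH, of a b k] by (simp add: add.assoc)
qed (simp add: assms(1))

lemma trig_sum_mult_term:
  assumes "trig_sum f"
  shows "trig_sum (\<lambda>x. f x * trig_term c d m x)"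
  using assms
proof induction
  case (add_term f a b k)
  show ?case
    using trig_sum_add[OF add_term.IH trig_sum_add[OF trig_sum_term trig_sum_term]]
    by (simp add: distrib_right trig_term_mult)
qed (simp add: trig_sum.zero)

lemma trig_sum_mult:
  assumes "trig_sum f" "trig_sum g"
  shows "trig_sum (\<lambda>x. f x * g x)"
  using assms(2)
proof induction
  case (add_term g a b k)
  show ?case
    using trig_sum_add[OF add_term.IH trig_sum_mult_term[OF assms(1)]]
    by (simp add: distrib_left)
qed (simp add: trig_sum.zero)

text \<open>On the unit circle a real linear functional is a combination of cosine and sine of
  frequency one; sums and products follow from the closure properties.\<close>

lemma trig_sum_polynomial:
  fixes P :: "complex \<Rightarrow> real"
  assumes "real_polynomial_function P"
  shows "trig_sum (\<lambda>x. P (cis (2 * pi * x)))"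
  using assms
proof induction
  case (linear f)
  interpret bounded_linear f by (rule linear)
  have "f (cis (2 * pi * x)) = trig_term (f 1) (f \<i>) 1 x" for x
  proof -
    have "cis (2 * pi * x) = cos (2 * pi * x) *\<^sub>R 1 + sin (2 * pi * x) *\<^sub>R \<i>"
      by (simp add: complex_eq_iff)
    then show ?thesis by (simp only: add scaleR) (simp add: trig_term_def)
  qed
  then show ?case using trig_sum_term by simp
next
  case (const c)
  have "(\<lambda>x. c) = trig_term c 0 0" by (auto simp: trig_term_def)
  then show ?case using trig_sum_term by simp
qed (simp_all add: trig_sum_add trig_sum_mult)

lemma trig_sum_imp_trigpoly:
  assumes "trig_sum f"
  shows "\<exists>n a b. f = trigpoly n a b"
  using assms
proof induction
  case zero
  show ?case by (rule exI[of _ 0], rule exI[of _ "\<lambda>_. 0"], rule exI[of _ "\<lambda>_. 0"]) (auto simp: trigpoly_def)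
next
  case (add_term f \<alpha> \<beta> k)
  then obtain n a b where f: "f = trigpoly n a b" by blast
  define m where "m = nat \<bar>k\<bar>"
  \<comment> \<open>A negative frequency is replaced by its absolute value, which reverses the sign
    of the sine coefficient.\<close>
  define \<gamma> where "\<gamma> = (if k < 0 then - \<beta> else \<beta>)"
  define N where "N = max n m"
  define a' where "a' j = (if j \<le> n then a j else 0) + (if j = m then \<alpha> else 0)" for j
  define b' where "b' j = (if j \<le> n then b j else 0) + (if j = m then \<gamma> else 0)" for j
  have k: "trig_term \<alpha> \<beta> k x = \<alpha> * cos (2 * pi * real m * x) + \<gamma> * sin (2 * pi * real m * x)" for x
  proof (cases "k < 0")
    case True
    then have "of_int k = - real m" by (simp add: m_def)
    then show ?thesis using True by (simp add: trig_term_def \<gamma>_def)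
  next
    case False
    then have "of_int k = real m" by (simp add: m_def)
    then show ?thesis using False by (simp add: trig_term_def \<gamma>_def)
  qed
  have "f x + trig_term \<alpha> \<beta> k x = trigpoly N a' b' x" for x
  proof -
    define C S where "C j = cos (2 * pi * real j * x)" and "S j = sin (2 * pi * real j * x)" for j
    have "trigpoly N a' b' x = (\<Sum>j\<le>N. (if j \<le> n then a j * C j + b j * S j else 0) + (if j = m then \<alpha> * C j + \<gamma> * S j else 0))"
      unfolding trigpoly_def a'_def b'_def C_def S_def
      by (intro sum.cong) (auto simp: algebra_simps)
    also have "\<dots> = (\<Sum>j\<le>N. if j \<le> n then a j * C j + b j * S j else 0) + (\<alpha> * C m + \<gamma> * S m)"
      by (simp add: sum.distrib N_def)
    also have "(\<Sum>j\<le>N. if j \<le> n then a j * C j + b j * S j else 0) = (\<Sum>j\<le>n. a j * C j + b j * S j)"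
      by (intro sum.mono_neutral_cong_right) (auto simp: N_def)
    finally show ?thesis unfolding k f by (simp add: trigpoly_def C_def S_def)
  qed
  then show ?case by blast
qed

section \<open>Trigonometric polynomials as test functions and uniform approximation\<close>

lemma trigpoly_has_derivative:
  "(trigpoly n a b has_real_derivative
    trigpoly n (\<lambda>k. 2 * pi * real k * b k) (\<lambda>k. - (2 * pi * real k * a k)) x) (at x)"
  unfolding trigpoly_def[abs_def]
  by (auto intro!: derivative_eq_intros sum.cong simp: algebra_simps)

lemma deriv_trigpoly:
  "deriv (trigpoly n a b) = trigpoly n (\<lambda>k. 2 * pi * real k * b k) (\<lambda>k. - (2 * pi * real k * a k))"
  by (rule ext, rule DERIV_imp_deriv, rule trigpoly_has_derivative)

lemma trigpoly_periodic: "trigpoly n a b (x + 1) = trigpoly n a b x"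
proof -
  have "cos (2 * pi * real k * (x + 1)) = cos (2 * pi * real k * x)"
    "sin (2 * pi * real k * (x + 1)) = sin (2 * pi * real k * x)" for k
  proof -
    have "2 * pi * real k * (x + 1) = 2 * pi * real k * x + real k * (2 * pi)" by (simp add: algebra_simps)
    then show "cos (2 * pi * real k * (x + 1)) = cos (2 * pi * real k * x)"
      "sin (2 * pi * real k * (x + 1)) = sin (2 * pi * real k * x)"
      by (simp_all add: cos_add sin_add mult.commute[of "real k"] cos_2npi sin_2npi flip: mult.assoc)
  qed
  then show ?thesis by (simp add: trigpoly_def)
qed

lemma test_function_trigpoly: "test_function (trigpoly n a b)"
proof -
  have "\<exists>a' b'. (deriv ^^ m) (trigpoly n a b) = trigpoly n a' b'" for m
  proof (induction m)
    case (Suc m)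
    then obtain a' b' where "(deriv ^^ m) (trigpoly n a b) = trigpoly n a' b'" by blast
    then show ?case unfolding funpow.simps o_apply by (metis deriv_trigpoly)
  qed auto
  then have "(deriv ^^ m) (trigpoly n a b) differentiable (at x)" for m x
    unfolding real_differentiable_def using trigpoly_has_derivative by metis
  then show ?thesis by (simp add: test_function_def trigpoly_periodic)
qed

lemma continuous_on_trigpoly: "continuous_on A (trigpoly n a b)"
  unfolding trigpoly_def[abs_def] by (intro continuous_intros)

lemma trigpoly_sq_integrable [simp]: "trigpoly n a b \<in> sq_integrable"
  by (rule continuous_sq_integrable[OF continuous_on_trigpoly])

text \<open>A continuous function with equal end values lives on the circle, where the
  Stone-Weierstrass theorem provides polynomials; on the circle these are trigonometric.\<close>

lemma trigpoly_uniformly_dense: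
  fixes g :: "real \<Rightarrow> real"
  assumes g: "continuous_on {0..1} g" "g 0 = g 1" and e: "0 < e"
  obtains n a b where "\<And>x. x \<in> {0..1} \<Longrightarrow> \<bar>g x - trigpoly n a b x\<bar> < e"
proof -
  define W where "W = g \<circ> (\<lambda>z. Arg2pi z / (2 * pi))"
  \<comment> \<open>The trivial homotopy of the loop \<open>g\<close> with itself gives access to
    the theorem on circle maps, which yields continuity of \<open>W\<close> across the jump of
    \<open>Arg2pi\<close>.\<close>
  have "homotopic_loops UNIV g g"
    using g by (simp add: homotopic_loops_refl path_def pathfinish_def pathstart_def)
  then have "continuous_on (sphere 0 1) W"
    unfolding W_def using homotopic_loops_imp_homotopic_circlemaps homotopic_with_imp_continuous by blast
  then obtain P where P: "real_polynomial_function P" "\<And>z. z \<in> sphere 0 1 \<Longrightarrow> \<bar>W z - P z\<bar> < e"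
    using Stone_Weierstrass_real_polynomial_function[of "sphere 0 1" W e] e by auto
  obtain n a b where T: "(\<lambda>x. P (cis (2 * pi * x))) = trigpoly n a b"
    using trig_sum_imp_trigpoly[OF trig_sum_polynomial[OF P(1)]] by blast
  have W: "W (cis (2 * pi * x)) = g x" if x: "x \<in> {0..1}" for x
  proof (cases "x = 1")
    case True
    then have "cis (2 * pi * x) = 1" by (simp add: cis_2pi)
    then show ?thesis using True g(2) Arg2pi_of_real[of 1] by (simp add: W_def)
  next
    case False
    then have "Arg2pi (cis (2 * pi * x)) = 2 * pi * x"
      using x by (simp add: cis_conv_exp Arg2pi_exp)
    then show ?thesis by (simp add: W_def)
  qed
  have "\<bar>g x - trigpoly n a b x\<bar> < e" if x: "x \<in> {0..1}" for x
    using P(2)[of "cis (2 * pi * x)"] W[OF x] fun_cong[OF T, of x] by simp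
  then show thesis by (rule that)
qed

section \<open>Density in the quadratic mean\<close>

definition trig_l2 :: "l2 set" where
  "trig_l2 = {abs_l2 (trigpoly n a b) | n a b. True}"

lemma norm_abs_l2_le:
  assumes f: "f \<in> sq_integrable" and B: "0 \<le> B" "\<And>x. x \<in> {0..1} \<Longrightarrow> \<bar>f x\<bar> \<le> B"
  shows "norm (abs_l2 f) \<le> B"
proof (rule power2_le_imp_le[OF _ B(1)])
  have "(\<integral>x. (f x)\<^sup>2 \<partial>torus) \<le> (\<integral>x. B\<^sup>2 \<partial>torus)"
  proof (rule integral_mono)
    fix x assume "x \<in> space torus"
    then show "(f x)\<^sup>2 \<le> B\<^sup>2"
      using power_mono[OF B(2), of x 2] by (simp add: torus_def space_restrict_space)
  qed (use f in \<open>auto simp: sq_integrable_def\<close>)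
  then show "(norm (abs_l2 f))\<^sup>2 \<le> B\<^sup>2"
    by (simp add: norm_abs_l2[OF f] measure_torus)
qed

lemma periodic_continuous_in_closure_trig:
  fixes g :: "real \<Rightarrow> real"
  assumes g: "continuous_on {0..1} g" "g 0 = g 1"
  shows "abs_l2 g \<in> closure trig_l2"
  unfolding closure_approachable
proof (intro allI impI)
  fix e :: real assume e: "0 < e"
  obtain n a b where T: "\<And>x. x \<in> {0..1} \<Longrightarrow> \<bar>g x - trigpoly n a b x\<bar> < e / 2"
    using trigpoly_uniformly_dense[OF g, of "e / 2"] e by auto
  have gs: "g \<in> sq_integrable" by (rule continuous_sq_integrable[OF g(1)])
  have "norm (abs_l2 (\<lambda>x. g x - trigpoly n a b x)) \<le> e / 2"
    using T e less_imp_le by (intro norm_abs_l2_le sq_integrable_diff gs) auto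
  then have "dist (abs_l2 g) (abs_l2 (trigpoly n a b)) < e"
    using gs e by (simp add: dist_norm minus_l2.abs_eq)
  then have "dist (abs_l2 (trigpoly n a b)) (abs_l2 g) < e" by (simp only: dist_commute)
  then show "\<exists>y\<in>trig_l2. dist y (abs_l2 g) < e" by (auto simp: trig_l2_def)
qed

lemma AE_torus_interior: "AE x in torus. 0 < x \<and> x < 1"
proof (rule AE_I')
  have "negligible {0, 1::real}" by simp
  then have "{0, 1::real} \<in> null_sets lebesgue" by (simp add: negligible_iff_null_sets)
  then show "{0, 1::real} \<in> null_sets torus"
    unfolding torus_def by (subst null_sets_restrict_space) auto
qed (auto simp: torus_def space_restrict_space)

lemma bounded_in_closure_trig:
  assumes f: "f \<in> borel_measurable torus" and B: "\<And>x. x \<in> {0..1} \<Longrightarrow> \<bar>f x\<bar> \<le> B"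
  shows "abs_l2 f \<in> closure trig_l2"
proof -
  have fs: "f \<in> sq_integrable" by (rule bounded_sq_integrable[OF f B])
  have B0: "0 \<le> B" using order_trans[OF abs_ge_zero B[of 0]] by simp
  have "f measurable_on {0..1}"
    using f by (simp add: torus_def measurable_on_iff_borel_measurable)
  then obtain N g where N: "negligible N" and g: "\<And>n. continuous_on UNIV (g n)"
    and lim: "\<And>x. x \<notin> N \<Longrightarrow> (\<lambda>n. g n x) \<longlonglongrightarrow> (if x \<in> {0..1} then f x else 0)"
    unfolding measurable_on_def by blast
  \<comment> \<open>The first factor vanishes at both end points, which makes \<open>G n\<close>
    periodic, and tends to one inside; the clamp between \<open>- B\<close> and \<open>B\<close>
    gives the dominating function.\<close>
  define G where "G n x = min 1 (real n * (x * (1 - x))) * max (- B) (min B (g n x))" for n x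
  have Gc: "continuous_on {0..1} (G n)" for n
    unfolding G_def using continuous_on_subset[OF g[of n]] by (intro continuous_intros) auto
  have GB: "\<bar>G n x\<bar> \<le> B" if x: "x \<in> {0..1}" for n x
  proof -
    have "0 \<le> real n * (x * (1 - x))" using x by simp
    then have "\<bar>min 1 (real n * (x * (1 - x)))\<bar> \<le> 1" by simp
    moreover have "\<bar>max (- B) (min B (g n x))\<bar> \<le> B" using B0 by auto
    ultimately have "\<bar>min 1 (real n * (x * (1 - x)))\<bar> * \<bar>max (- B) (min B (g n x))\<bar> \<le> 1 * B"
      by (intro mult_mono) auto
    then show ?thesis by (simp add: G_def abs_mult)
  qed
  have lim_G: "(\<lambda>n. abs_l2 (G n)) \<longlonglongrightarrow> abs_l2 f"
  proof (rule abs_l2_dominated_convergence[where w = "\<lambda>x. 2 * B"])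
    show "G n \<in> sq_integrable" for n by (rule continuous_sq_integrable[OF Gc])
    show "AE x in torus. \<bar>G n x - f x\<bar> \<le> 2 * B" for n
    proof (rule AE_I2)
      fix x assume "x \<in> space torus"
      then have x: "x \<in> {0..1}" by (simp add: torus_def space_restrict_space)
      show "\<bar>G n x - f x\<bar> \<le> 2 * B" using GB[OF x, of n] B[OF x] by linarith
    qed
    have "AE x in lebesgue. x \<notin> N" using N by (simp add: negligible_iff_null_sets AE_not_in)
    then have "AE x in lebesgue. x \<in> {0..1} \<longrightarrow> x \<notin> N" by eventually_elim simp
    then have "AE x in torus. x \<notin> N" unfolding torus_def by (simp add: AE_restrict_space_iff)
    with AE_torus_interior show "AE x in torus. (\<lambda>n. G n x) \<longlonglongrightarrow> f x"
    proof eventually_elim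
      case (elim x)
      then have x: "x \<in> {0..1}" "0 < x * (1 - x)" by auto
      have "(\<lambda>n. max (- B) (min B (g n x))) \<longlonglongrightarrow> max (- B) (min B (f x))"
        using lim[OF elim(2)] x by (intro tendsto_intros) simp
      moreover have "max (- B) (min B (f x)) = f x" using B[OF x(1)] by (auto simp: abs_le_iff)
      moreover have "(\<lambda>n. min 1 (real n * (x * (1 - x)))) \<longlonglongrightarrow> 1"
      proof (rule tendsto_eventually)
        obtain k where k: "1 / (x * (1 - x)) < real k" using reals_Archimedean2 by blast
        show "\<forall>\<^sub>F n in sequentially. min 1 (real n * (x * (1 - x))) = 1"
          using eventually_ge_at_top[of k]
        proof eventually_elim
          case (elim n)
          then have "1 / (x * (1 - x)) < real n" using k by simp
          then have "1 < real n * (x * (1 - x))" using x(2) by (simp only: pos_divide_less_eq)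
          then show ?case by simp
        qed
      qed
      ultimately have "(\<lambda>n. min 1 (real n * (x * (1 - x))) * max (- B) (min B (g n x))) \<longlonglongrightarrow> 1 * f x"
        by (intro tendsto_mult) simp_all
      then show ?case by (simp add: G_def)
    qed
  qed (use fs sq_integrable_const in auto)
  have "abs_l2 (G n) \<in> closure trig_l2" for n
    by (rule periodic_continuous_in_closure_trig[OF Gc]) (simp add: G_def)
  then show ?thesis by (rule closed_sequentially[OF closed_closure _ lim_G])
qed

lemma closure_trig_l2: "closure trig_l2 = UNIV"
proof -
  have "u \<in> closure trig_l2" for u
  proof -
    obtain f where f: "f \<in> sq_integrable" and u: "u = abs_l2 f" by (rule l2_exhaust)
    \<comment> \<open>Truncation reduces the claim to bounded functions, with
      \<open>\<bar>f x\<bar>\<close> dominating the error.\<close>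
    define g where "g n x = max (- real n) (min (real n) (f x))" for n x
    have gm: "g n \<in> borel_measurable torus" for n unfolding g_def using f by measurable
    have gB: "\<bar>g n x\<bar> \<le> real n" for n x by (auto simp: g_def)
    have lim_g: "(\<lambda>n. abs_l2 (g n)) \<longlonglongrightarrow> abs_l2 f"
    proof (rule abs_l2_dominated_convergence[where w = "\<lambda>x. \<bar>f x\<bar>"])
      show "g n \<in> sq_integrable" for n by (rule bounded_sq_integrable[OF gm gB])
      show "(\<lambda>x. \<bar>f x\<bar>) \<in> sq_integrable" using f by (auto simp: sq_integrable_def)
      show "AE x in torus. \<bar>g n x - f x\<bar> \<le> \<bar>f x\<bar>" for n by (auto simp: g_def max_def min_def abs_if)
      have "(\<lambda>n. g n x) \<longlonglongrightarrow> f x" for x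
      proof (rule tendsto_eventually)
        obtain k where k: "\<bar>f x\<bar> < real k" using reals_Archimedean2 by blast
        show "\<forall>\<^sub>F n in sequentially. g n x = f x"
          using eventually_ge_at_top[of k] by eventually_elim (use k in \<open>auto simp: g_def\<close>)
      qed
      then show "AE x in torus. (\<lambda>n. g n x) \<longlonglongrightarrow> f x" by simp
    qed (rule f)
    have "abs_l2 (g n) \<in> closure trig_l2" for n
      by (rule bounded_in_closure_trig[OF gm gB])
    then show ?thesis unfolding u by (rule closed_sequentially[OF closed_closure _ lim_g])
  qed
  then show ?thesis by blast
qed

lemma trigpoly_approx:
  assumes "0 < e"
  obtains n a b where "norm (u - abs_l2 (trigpoly n a b)) < e"
proof -
  have "u \<in> closure trig_l2" by (simp add: closure_trig_l2)
  then obtain y where "y \<in> trig_l2" "dist y u < e" using assms closure_approachable by blast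
  then show thesis using that unfolding trig_l2_def dist_norm by (auto simp: norm_minus_commute)
qed

section \<open>Weak derivatives on the torus\<close>

lemma test_functionD:
  assumes "test_function \<psi>"
  shows "(\<psi> has_real_derivative deriv \<psi> x) (at x)" "continuous_on A \<psi>" "continuous_on A (deriv \<psi>)"
    "\<psi> \<in> sq_integrable" "deriv \<psi> \<in> sq_integrable"
proof -
  have d: "(deriv ^^ n) \<psi> differentiable (at x)" for n x
    using assms by (simp add: test_function_def)
  show "(\<psi> has_real_derivative deriv \<psi> x) (at x)"
    using d[of 0 x] by (simp add: DERIV_deriv_iff_real_differentiable)
  have c: "continuous_on A \<psi>" "continuous_on A (deriv \<psi>)" for A
    using d[of 0] d[of 1]
    by (auto intro!: continuous_at_imp_continuous_on differentiable_imp_continuous_within)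
  show "continuous_on A \<psi>" "continuous_on A (deriv \<psi>)" "\<psi> \<in> sq_integrable" "deriv \<psi> \<in> sq_integrable"
    using c continuous_sq_integrable by auto
qed

text \<open>In terms of inner products the relation is linear and closed because the inner product
  is bilinear and continuous.\<close>

lemma weak_deriv_iff:
  "weak_deriv u g \<longleftrightarrow> (\<forall>\<psi>. test_function \<psi> \<longrightarrow> inner u (abs_l2 (deriv \<psi>)) = - inner g (abs_l2 \<psi>))"
proof -
  obtain f where f: "f \<in> sq_integrable" "u = abs_l2 f" by (rule l2_exhaust)
  obtain h where h: "h \<in> sq_integrable" "g = abs_l2 h" by (rule l2_exhaust)
  show ?thesis
    using f(1) h(1) unfolding f(2) h(2)
    by (auto simp: weak_deriv.abs_eq inner_l2.abs_eq test_functionD)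
qed

lemma weak_deriv_linear:
  assumes "weak_deriv u g" "weak_deriv v h"
  shows "weak_deriv (a *\<^sub>R u + b *\<^sub>R v) (a *\<^sub>R g + b *\<^sub>R h)"
  using assms by (simp add: weak_deriv_iff inner_add_left algebra_simps)

lemma weak_deriv_limit:
  assumes "\<And>n::nat. weak_deriv (u n) (g n)" "u \<longlonglongrightarrow> u'" "g \<longlonglongrightarrow> g'"
  shows "weak_deriv u' g'"
  unfolding weak_deriv_iff
proof (intro allI impI)
  fix \<psi> assume \<psi>: "test_function \<psi>"
  have "(\<lambda>n. inner (u n) (abs_l2 (deriv \<psi>))) \<longlonglongrightarrow> inner u' (abs_l2 (deriv \<psi>))"
    by (intro tendsto_intros assms)
  moreover have "(\<lambda>n. - inner (g n) (abs_l2 \<psi>)) \<longlonglongrightarrow> - inner g' (abs_l2 \<psi>)"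
    by (intro tendsto_intros assms)
  moreover have "inner (u n) (abs_l2 (deriv \<psi>)) = - inner (g n) (abs_l2 \<psi>)" for n
    using assms(1) \<psi> by (simp add: weak_deriv_iff)
  ultimately show "inner u' (abs_l2 (deriv \<psi>)) = - inner g' (abs_l2 \<psi>)"
    using LIMSEQ_unique by auto
qed

lemma mean_eq_inner: "mean u = inner u (abs_l2 (\<lambda>x. 1))"
proof -
  obtain f where f: "f \<in> sq_integrable" "u = abs_l2 f" by (rule l2_exhaust)
  then show ?thesis using sq_integrable_const[of 1] by (simp add: mean.abs_eq inner_l2.abs_eq)
qed

text \<open>The constant function one is a test function with zero derivative.\<close>

lemma weak_deriv_mean_zero:
  assumes "weak_deriv u g"
  shows "mean g = 0"
proof -
  have "trigpoly 0 (\<lambda>_. 1) (\<lambda>_. 0) = (\<lambda>x. 1)" by (simp add: trigpoly_def fun_eq_iff)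
  then have "test_function (\<lambda>x. 1)" using test_function_trigpoly[of 0 "\<lambda>_. 1" "\<lambda>_. 0"] by simp
  then have "inner u (abs_l2 (deriv (\<lambda>x. 1))) = - mean g"
    using assms by (simp only: weak_deriv_iff mean_eq_inner)
  moreover have "deriv (\<lambda>x::real. 1::real) = (\<lambda>x. 0)" by (simp add: fun_eq_iff)
  moreover have "abs_l2 (\<lambda>x. 0) = 0" by (simp add: zero_l2_def)
  ultimately show ?thesis by simp
qed

lemma trig_l2_sequence:
  obtains y where "\<And>n::nat. y n \<in> trig_l2" "y \<longlonglongrightarrow> u"
proof -
  have "u \<in> closure trig_l2" by (simp add: closure_trig_l2)
  then show thesis using that unfolding closure_sequential by blast
qed

text \<open>The difference of two weak derivatives is orthogonal to all trigonometric polynomials,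
  which are dense.\<close>

lemma weak_deriv_unique:
  assumes "weak_deriv u g" "weak_deriv u h"
  shows "g = h"
proof -
  obtain y where y: "\<And>n::nat. y n \<in> trig_l2" "y \<longlonglongrightarrow> g - h"
    using trig_l2_sequence[of "g - h"] by blast
  have "inner (g - h) (y n) = 0" for n
  proof -
    obtain m a b where "y n = abs_l2 (trigpoly m a b)" using y(1)[of n] by (auto simp: trig_l2_def)
    then show ?thesis
      using assms test_function_trigpoly[of m a b] by (simp add: weak_deriv_iff inner_diff_left)
  qed
  moreover have "(\<lambda>n. inner (g - h) (y n)) \<longlonglongrightarrow> inner (g - h) (g - h)"
    by (intro tendsto_intros y)
  ultimately have "inner (g - h) (g - h) = 0" by (simp add: LIMSEQ_const_iff)
  then show ?thesis by simp
qed

section \<open>Integration by parts and Parseval's identity\<close>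

lemma torus_integral_deriv:
  fixes F f :: "real \<Rightarrow> real"
  assumes F: "\<And>x. (F has_real_derivative f x) (at x)" and f: "continuous_on UNIV f"
  shows "(\<integral>x. f x \<partial>torus) = F 1 - F 0"
proof -
  have "f \<in> sq_integrable" using continuous_sq_integrable continuous_on_subset[OF f] by blast
  then have "integrable torus f" by (rule sq_integrable_imp_integrable)
  then have "(\<integral>x. f x \<partial>torus) = integral {0..1} f"
    unfolding torus_def by (intro lebesgue_integral_eq_integral) auto
  also have "(f has_integral F 1 - F 0) {0..1}"
    using F by (intro fundamental_theorem_of_calculus)
      (auto simp: has_real_derivative_iff_has_vector_derivative[symmetric] intro: has_field_derivative_at_within)
  then have "integral {0..1} f = F 1 - F 0" by (rule integral_unique)
  finally show ?thesis .
qed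

text \<open>Integration by parts; periodicity cancels the boundary terms.\<close>

lemma weak_deriv_test_function:
  assumes \<phi>: "test_function \<phi>"
  shows "weak_deriv (abs_l2 \<phi>) (abs_l2 (deriv \<phi>))"
  unfolding weak_deriv_iff
proof (intro allI impI)
  fix \<psi> assume \<psi>: "test_function \<psi>"
  have "(\<integral>x. \<phi> x * deriv \<psi> x + deriv \<phi> x * \<psi> x \<partial>torus) = \<phi> 1 * \<psi> 1 - \<phi> 0 * \<psi> 0"
  proof (rule torus_integral_deriv[of "\<lambda>x. \<phi> x * \<psi> x"])
    show "((\<lambda>x. \<phi> x * \<psi> x) has_real_derivative \<phi> x * deriv \<psi> x + deriv \<phi> x * \<psi> x) (at x)" for x
      using test_functionD(1)[OF \<phi>] test_functionD(1)[OF \<psi>] by (auto intro!: derivative_eq_intros)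
    show "continuous_on UNIV (\<lambda>x. \<phi> x * deriv \<psi> x + deriv \<phi> x * \<psi> x)"
      by (intro continuous_intros test_functionD \<phi> \<psi>)
  qed
  also have "\<phi> 1 * \<psi> 1 = \<phi> 0 * \<psi> 0"
    using \<phi>[unfolded test_function_def, THEN conjunct1, rule_format, of 0]
      \<psi>[unfolded test_function_def, THEN conjunct1, rule_format, of 0] by simp
  finally show "inner (abs_l2 \<phi>) (abs_l2 (deriv \<psi>)) = - inner (abs_l2 (deriv \<phi>)) (abs_l2 \<psi>)"
    using test_functionD[OF \<phi>] test_functionD[OF \<psi>] by (simp add: inner_l2.abs_eq sq_integrable_prod)
qed

lemma integral_trig_term: "(\<integral>x. trig_term a b k x \<partial>torus) = (if k = 0 then a else 0)"
proof (cases "k = 0")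
  case True
  then show ?thesis by (simp add: trig_term_def measure_torus)
next
  case False
  define c where "c = 2 * pi * of_int k"
  have c: "c \<noteq> 0" using False by (simp add: c_def)
  have "(\<integral>x. trig_term a b k x \<partial>torus) =
      (a * sin (c * 1) - b * cos (c * 1)) / c - (a * sin (c * 0) - b * cos (c * 0)) / c"
    unfolding trig_term_def c_def[symmetric]
    by (rule torus_integral_deriv) (use c in \<open>auto intro!: derivative_eq_intros continuous_intros simp: field_simps\<close>)
  moreover have "sin c = 0" "cos c = 1"
    unfolding c_def by (simp_all add: sin_integer_2pi cos_integer_2pi)
  ultimately show ?thesis using False by simp
qed

lemma trig_term_sq_integrable: "trig_term a b k \<in> sq_integrable"
  unfolding trig_term_def[abs_def] by (intro continuous_sq_integrable continuous_intros)

lemma integral_trig_term_mult: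
  "(\<integral>x. trig_term a b k x * trig_term c d m x \<partial>torus) =
    (if k = m then (a * c + b * d) / 2 else 0) + (if k + m = 0 then (a * c - b * d) / 2 else 0)"
  unfolding trig_term_mult
  by (simp add: sq_integrable_imp_integrable trig_term_sq_integrable integral_trig_term)

lemma trigpoly_eq_terms: "trigpoly n a b x = (\<Sum>k\<le>n. trig_term (a k) (b k) (int k) x)"
  by (simp add: trigpoly_def trig_term_def)

text \<open>Parseval's identity by induction: the term of frequency \<open>Suc n\<close> is
  orthogonal to all lower ones.\<close>

lemma norm_trigpoly:
  "(norm (abs_l2 (trigpoly n a b)))\<^sup>2 = (a 0)\<^sup>2 + (\<Sum>k=1..n. ((a k)\<^sup>2 + (b k)\<^sup>2) / 2)"
proof (induction n)
  case 0
  have "trigpoly 0 a b = trig_term (a 0) (b 0) 0" by (simp add: fun_eq_iff trigpoly_eq_terms)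
  then have "(norm (abs_l2 (trigpoly 0 a b)))\<^sup>2 = (\<integral>x. trig_term (a 0) (b 0) 0 x * trig_term (a 0) (b 0) 0 x \<partial>torus)"
    by (simp add: norm_abs_l2 trig_term_sq_integrable) (simp add: power2_eq_square)
  then show ?case by (simp add: integral_trig_term_mult power2_eq_square field_simps)
next
  case (Suc n)
  define t where "t = trig_term (a (Suc n)) (b (Suc n)) (int (Suc n))"
  have ts: "t \<in> sq_integrable" unfolding t_def by (rule trig_term_sq_integrable)
  have "trigpoly (Suc n) a b = (\<lambda>x. trigpoly n a b x + t x)"
    by (simp add: fun_eq_iff trigpoly_eq_terms t_def)
  then have "abs_l2 (trigpoly (Suc n) a b) = abs_l2 (trigpoly n a b) + abs_l2 t"
    using ts by (simp add: plus_l2.abs_eq)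
  then have "(norm (abs_l2 (trigpoly (Suc n) a b)))\<^sup>2 =
      (norm (abs_l2 (trigpoly n a b)))\<^sup>2 + 2 * inner (abs_l2 (trigpoly n a b)) (abs_l2 t) + (norm (abs_l2 t))\<^sup>2"
    by (simp add: power2_norm_eq_inner inner_add_left inner_add_right inner_commute)
  also have "inner (abs_l2 (trigpoly n a b)) (abs_l2 t) = (\<integral>x. (\<Sum>k\<le>n. trig_term (a k) (b k) (int k) x * t x) \<partial>torus)"
    using ts by (simp add: inner_l2.abs_eq trigpoly_eq_terms sum_distrib_right)
  also have "\<dots> = (\<Sum>k\<le>n. \<integral>x. trig_term (a k) (b k) (int k) x * t x \<partial>torus)"
    by (intro Bochner_Integration.integral_sum sq_integrable_prod trig_term_sq_integrable ts)
  also have "\<dots> = 0"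
    unfolding t_def integral_trig_term_mult by (intro sum.neutral) auto
  also have "(norm (abs_l2 t))\<^sup>2 = (\<integral>x. t x * t x \<partial>torus)"
    using norm_abs_l2[OF ts] by (simp add: power2_eq_square)
  also have "\<dots> = ((a (Suc n))\<^sup>2 + (b (Suc n))\<^sup>2) / 2"
    unfolding t_def integral_trig_term_mult by (simp add: power2_eq_square)
  finally show ?case using Suc by simp
qed

text \<open>Wirtinger's inequality, by duality: for trigonometric polynomials \<open>f\<close> with mean-free primitive
  \<open>q\<close>, Parseval gives \<open>2 * pi * norm q \<le> norm f\<close>, and testing with \<open>q\<close> bounds \<open>inner u f\<close>.\<close>

lemma wirtinger:
  assumes u: "mean u = 0" and g: "weak_deriv u g"
  shows "2 * pi * norm u \<le> norm g"
proof -
  have trig: "2 * pi * inner u y \<le> norm g * norm y" if y_in: "y \<in> trig_l2" for y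
  proof -
    obtain n a b where y: "y = abs_l2 (trigpoly n a b)" using y_in by (auto simp: trig_l2_def)
    \<comment> \<open>The constant term has no periodic primitive; it is split off, and
      \<open>u\<close> is orthogonal to it.\<close>
    define a0 b0 where "a0 = a(0 := 0)" and "b0 = b(0 := 0)"
    define q where "q = trigpoly n (\<lambda>k. - (b0 k / (2 * pi * real k))) (\<lambda>k. a0 k / (2 * pi * real k))"
    have "deriv q = trigpoly n a0 b0"
      unfolding q_def deriv_trigpoly
      by (auto simp: trigpoly_def a0_def b0_def fun_eq_iff intro!: sum.cong)
    moreover have "trigpoly n a b = (\<lambda>x. a 0 * 1 + trigpoly n a0 b0 x)"
    proof
      fix x
      have "trigpoly n a b x = a 0 + (\<Sum>k\<in>{..n} - {0}. trig_term (a k) (b k) (int k) x)"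
        unfolding trigpoly_eq_terms by (subst sum.remove[of _ 0]) (auto simp: trig_term_def)
      moreover have "trigpoly n a0 b0 x = (\<Sum>k\<in>{..n} - {0}. trig_term (a0 k) (b0 k) (int k) x)"
        unfolding trigpoly_eq_terms by (subst sum.remove[of _ 0]) (auto simp: trig_term_def a0_def b0_def)
      moreover have "(\<Sum>k\<in>{..n} - {0}. trig_term (a0 k) (b0 k) (int k) x) = (\<Sum>k\<in>{..n} - {0}. trig_term (a k) (b k) (int k) x)"
        by (rule sum.cong) (auto simp: a0_def b0_def)
      ultimately show "trigpoly n a b x = a 0 * 1 + trigpoly n a0 b0 x" by simp
    qed
    then have "y = a 0 *\<^sub>R abs_l2 (\<lambda>x. 1) + abs_l2 (trigpoly n a0 b0)"
      using sq_integrable_const[of 1] sq_integrable_scale[OF sq_integrable_const[of 1], of "a 0"]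
      unfolding y by (simp add: plus_l2.abs_eq scaleR_l2.abs_eq)
    ultimately have "inner u y = inner u (abs_l2 (deriv q))"
      using u by (simp add: inner_add_right mean_eq_inner)
    also have "\<dots> = - inner g (abs_l2 q)"
      using g test_function_trigpoly unfolding weak_deriv_iff q_def by blast
    also have "\<dots> \<le> norm g * norm (abs_l2 q)"
      using norm_cauchy_schwarz[of "- g" "abs_l2 q"] by simp
    finally have 1: "inner u y \<le> norm g * norm (abs_l2 q)" .
    have "2 * pi * norm (abs_l2 q) \<le> norm y"
    proof (rule power2_le_imp_le)
      have "(2 * pi * norm (abs_l2 q))\<^sup>2 = (2 * pi)\<^sup>2 * (\<Sum>k=1..n. ((b0 k / (2 * pi * real k))\<^sup>2 + (a0 k / (2 * pi * real k))\<^sup>2) / 2)"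
        unfolding power_mult_distrib q_def norm_trigpoly by (simp add: a0_def b0_def)
      also have "\<dots> \<le> (\<Sum>k=1..n. ((a k)\<^sup>2 + (b k)\<^sup>2) / 2)"
        unfolding sum_distrib_left
      proof (rule sum_mono)
        \<comment> \<open>The constant \<open>2 * pi\<close> belongs to the lowest nonzero
          frequency; higher frequencies gain the factor \<open>1 / (real k)\<^sup>2\<close>.\<close>
        fix k assume "k \<in> {1..n}"
        then have k: "1 \<le> real k" by simp
        have "(2 * pi)\<^sup>2 * (((b0 k / (2 * pi * real k))\<^sup>2 + (a0 k / (2 * pi * real k))\<^sup>2) / 2) = ((a0 k)\<^sup>2 + (b0 k)\<^sup>2) / 2 / (real k)\<^sup>2"
          using k by (simp add: power_divide power_mult_distrib field_simps)
        also have "\<dots> \<le> ((a0 k)\<^sup>2 + (b0 k)\<^sup>2) / 2 / 1"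
          using k by (intro divide_left_mono) auto
        also have "\<dots> \<le> ((a k)\<^sup>2 + (b k)\<^sup>2) / 2" by (simp add: a0_def b0_def)
        finally show "(2 * pi)\<^sup>2 * (((b0 k / (2 * pi * real k))\<^sup>2 + (a0 k / (2 * pi * real k))\<^sup>2) / 2) \<le> ((a k)\<^sup>2 + (b k)\<^sup>2) / 2" .
      qed
      also have "\<dots> \<le> (norm y)\<^sup>2" unfolding y norm_trigpoly by simp
      finally show "(2 * pi * norm (abs_l2 q))\<^sup>2 \<le> (norm y)\<^sup>2" .
    qed simp
    then have "norm g * (2 * pi * norm (abs_l2 q)) \<le> norm g * norm y" by (rule mult_left_mono) simp
    then show ?thesis using 1 pi_gt_zero
      by (smt (verit) mult.assoc mult.commute mult_left_mono mult_left_le_imp_le zero_less_mult_iff)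
  qed
  \<comment> \<open>By density the bound extends to the test vector \<open>u\<close> itself.\<close>
  obtain y where y: "\<And>n::nat. y n \<in> trig_l2" "y \<longlonglongrightarrow> u"
    using trig_l2_sequence[of u] by blast
  have "(\<lambda>n. 2 * pi * inner u (y n)) \<longlonglongrightarrow> 2 * pi * inner u u" by (intro tendsto_intros y)
  moreover have "(\<lambda>n. norm g * norm (y n)) \<longlonglongrightarrow> norm g * norm u" by (intro tendsto_intros y)
  ultimately have "2 * pi * inner u u \<le> norm g * norm u" 
    by (rule LIMSEQ_le) (use trig[OF y(1)] in auto)
  then have "norm u * (2 * pi * norm u) \<le> norm u * norm g"
    by (simp add: power2_norm_eq_inner[symmetric] power2_eq_square mult_ac)
  then have "2 * pi * norm u \<le> norm g" if "0 < norm u"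
    using that by (simp only: mult_le_cancel_left_pos)
  then show ?thesis by (cases "norm u = 0") auto
qed

text \<open>Relational form of membership in \<open>V\<close> together with
  \<open>dx (dx u) = k\<close>; linear combinations and limits are handled without the description
  operator in \<open>dx\<close>.\<close>

definition second_deriv :: "l2 \<Rightarrow> l2 \<Rightarrow> bool" where
  "second_deriv u k \<longleftrightarrow> mean u = 0 \<and> (\<exists>g. weak_deriv u g \<and> weak_deriv g k)"

lemma dx_eq: "weak_deriv u g \<Longrightarrow> dx u = g"
  unfolding dx_def using weak_deriv_unique by blast

lemma second_deriv_dx: "second_deriv u k \<Longrightarrow> dx (dx u) = k"
  by (auto simp: second_deriv_def dx_eq)

lemma in_V_iff: "u \<in> V \<longleftrightarrow> (\<exists>k. second_deriv u k)"
  unfolding V_def H2_def H1_def second_deriv_def by (auto simp: dx_eq) (metis dx_eq)+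

lemma second_deriv_linear:
  assumes "second_deriv u k" "second_deriv v m"
  shows "second_deriv (a *\<^sub>R u + b *\<^sub>R v) (a *\<^sub>R k + b *\<^sub>R m)"
proof -
  obtain g h where "weak_deriv u g" "weak_deriv g k" "weak_deriv v h" "weak_deriv h m"
    using assms by (auto simp: second_deriv_def)
  then have "weak_deriv (a *\<^sub>R u + b *\<^sub>R v) (a *\<^sub>R g + b *\<^sub>R h)" "weak_deriv (a *\<^sub>R g + b *\<^sub>R h) (a *\<^sub>R k + b *\<^sub>R m)"
    by (auto intro: weak_deriv_linear)
  then show ?thesis using assms by (auto simp: second_deriv_def mean_eq_inner inner_add_left)
qed

lemma second_deriv_norm:
  assumes "second_deriv u k"
  shows "(2 * pi)\<^sup>2 * norm u \<le> norm k"
proof -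
  obtain g where g: "mean u = 0" "weak_deriv u g" "weak_deriv g k" using assms by (auto simp: second_deriv_def)
  have "2 * pi * (2 * pi * norm u) \<le> 2 * pi * norm g"
    using wirtinger[OF g(1,2)] by (intro mult_left_mono) auto
  also have "\<dots> \<le> norm k" using wirtinger[OF weak_deriv_mean_zero[OF g(2)] g(3)] .
  finally show ?thesis by (simp add: power2_eq_square mult.assoc)
qed

text \<open>The first derivatives converge as well: they have mean zero, so Wirtinger's inequality
  bounds their differences by those of the second derivatives.\<close>

lemma second_deriv_limit:
  assumes s: "\<And>n::nat. second_deriv (u n) (k n)" and lim: "u \<longlonglongrightarrow> u'" "k \<longlonglongrightarrow> k'"
  shows "second_deriv u' k'"
proof -
  have "\<forall>n. \<exists>g. weak_deriv (u n) g \<and> weak_deriv g (k n)" using s by (auto simp: second_deriv_def)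
  then obtain g where g: "\<And>n. weak_deriv (u n) (g n)" "\<And>n. weak_deriv (g n) (k n)" by metis
  have diff: "2 * pi * norm (g m - g n) \<le> norm (k m - k n)" for m n
  proof (rule wirtinger)
    show "mean (g m - g n) = 0"
      using weak_deriv_mean_zero[OF g(1)] by (simp add: mean_eq_inner inner_diff_left)
    show "weak_deriv (g m - g n) (k m - k n)"
      using weak_deriv_linear[OF g(2)[of m] g(2)[of n], of 1 "-1"] by simp
  qed
  have "Cauchy g"
  proof (rule metric_CauchyI)
    fix e :: real assume e: "0 < e"
    then obtain M where M: "\<And>m n. m \<ge> M \<Longrightarrow> n \<ge> M \<Longrightarrow> dist (k m) (k n) < e"
      using LIMSEQ_imp_Cauchy[OF lim(2)] unfolding Cauchy_def by meson
    have "dist (g m) (g n) < e" if "m \<ge> M" "n \<ge> M" for m n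
    proof -
      have "1 * norm (g m - g n) \<le> 2 * pi * norm (g m - g n)"
        using pi_ge_two by (intro mult_right_mono) auto
      then show ?thesis using diff[of m n] M[OF that] by (simp add: dist_norm)
    qed
    then show "\<exists>M. \<forall>m\<ge>M. \<forall>n\<ge>M. dist (g m) (g n) < e" by blast
  qed
  then obtain g' where g': "g \<longlonglongrightarrow> g'" using complete_l2 unfolding complete_def by blast
  have "(\<lambda>n. mean (u n)) \<longlonglongrightarrow> mean u'" unfolding mean_eq_inner by (intro tendsto_intros lim)
  moreover have "mean (u n) = 0" for n using s by (simp add: second_deriv_def)
  ultimately have "mean u' = 0" by (simp add: LIMSEQ_const_iff)
  then show ?thesis
    using weak_deriv_limit[OF g(1) lim(1) g'] weak_deriv_limit[OF g(2) g' lim(2)]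
    by (auto simp: second_deriv_def)
qed

section \<open>The functional\<close>

lemma cosh_uniformly_convex:
  fixes x y s :: real
  assumes s: "0 \<le> s" "s \<le> 1"
  shows "cosh ((1 - s) * x + s * y) \<le> (1 - s) * cosh x + s * cosh y - s * (1 - s) / 2 * (x - y)\<^sup>2"
proof -
  have "convex_on UNIV (\<lambda>x::real. cosh x - x\<^sup>2 / 2)"
  proof (rule f''_ge0_imp_convex)
    show "((\<lambda>x. cosh x - x\<^sup>2 / 2) has_real_derivative sinh x - x) (at x)" for x :: real
      by (auto intro!: derivative_eq_intros)
    show "((\<lambda>x. sinh x - x) has_real_derivative cosh x - 1) (at x)" for x :: real
      by (auto intro!: derivative_eq_intros)
    show "0 \<le> cosh x - 1" for x :: real using cosh_real_ge_1[of x] by simp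
  qed simp
  then have "cosh ((1 - s) * x + s * y) - ((1 - s) * x + s * y)\<^sup>2 / 2 \<le>
      (1 - s) * (cosh x - x\<^sup>2 / 2) + s * (cosh y - y\<^sup>2 / 2)"
    using convex_onD[of UNIV "\<lambda>x. cosh x - x\<^sup>2 / 2" s x y] s by simp
  moreover have "(1 - s) * (x\<^sup>2 / 2) + s * (y\<^sup>2 / 2) - ((1 - s) * x + s * y)\<^sup>2 / 2 = s * (1 - s) / 2 * (x - y)\<^sup>2"
    by (simp add: power2_eq_square field_simps)
  ultimately show ?thesis by (simp add: right_diff_distrib)
qed

section \<open>The integral functional on square integrable functions\<close>

lemma cosh_integral_abs:
  assumes "f \<in> sq_integrable"
  shows "cosh_integral (abs_l2 f) = (\<integral>\<^sup>+x. ennreal (cosh (f x)) \<partial>torus)"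
  using assms by (simp add: cosh_integral.abs_eq)

lemma cosh_measurable [measurable]: "(cosh :: real \<Rightarrow> real) \<in> borel_measurable borel"
  by (intro borel_measurable_continuous_onI continuous_intros)

lemma cosh_integral_finite_iff:
  assumes f: "f \<in> sq_integrable"
  shows "cosh_integral (abs_l2 f) < \<infinity> \<longleftrightarrow> integrable torus (\<lambda>x. cosh (f x))"
proof -
  have "(\<lambda>x. cosh (f x)) \<in> borel_measurable torus" using f by measurable
  then show ?thesis
    by (simp add: cosh_integral_abs[OF f] integrable_iff_bounded cosh_real_nonneg)
qed

lemma enn2real_cosh_integral:
  assumes f: "f \<in> sq_integrable"
  shows "enn2real (cosh_integral (abs_l2 f)) = (\<integral>x. cosh (f x) \<partial>torus)"
proof -
  have "(\<lambda>x. cosh (f x)) \<in> borel_measurable torus" using f by measurable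
  then show ?thesis
    unfolding cosh_integral_abs[OF f] by (simp add: integral_eq_nn_integral cosh_real_nonneg)
qed

lemma cosh_integral_convex:
  assumes fin: "cosh_integral k < \<infinity>" "cosh_integral m < \<infinity>" and s: "0 \<le> s" "s \<le> 1"
  shows "cosh_integral ((1 - s) *\<^sub>R k + s *\<^sub>R m) < \<infinity>"
    and "enn2real (cosh_integral ((1 - s) *\<^sub>R k + s *\<^sub>R m)) \<le>
      (1 - s) * enn2real (cosh_integral k) + s * enn2real (cosh_integral m) - s * (1 - s) / 2 * (norm (k - m))\<^sup>2"
proof -
  obtain f where f: "f \<in> sq_integrable" "k = abs_l2 f" by (rule l2_exhaust)
  obtain g where g: "g \<in> sq_integrable" "m = abs_l2 g" by (rule l2_exhaust)
  let ?c = "\<lambda>x. (1 - s) * f x + s * g x"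
  have c: "?c \<in> sq_integrable" by (intro sq_integrable_add sq_integrable_scale f g)
  have eq: "(1 - s) *\<^sub>R k + s *\<^sub>R m = abs_l2 ?c"
    using f g sq_integrable_scale[of f] sq_integrable_scale[of g] by (simp add: plus_l2.abs_eq scaleR_l2.abs_eq)
  have i: "integrable torus (\<lambda>x. cosh (f x))" "integrable torus (\<lambda>x. cosh (g x))"
    using fin cosh_integral_finite_iff f g by auto
  have d: "integrable torus (\<lambda>x. (f x - g x)\<^sup>2)" using sq_integrable_diff[OF f(1) g(1)] by (simp add: sq_integrable_def)
  let ?b = "\<lambda>x. (1 - s) * cosh (f x) + s * cosh (g x) - s * (1 - s) / 2 * (f x - g x)\<^sup>2"
  have b: "integrable torus ?b" using i d by simp
  have le: "cosh (?c x) \<le> ?b x" for x by (rule cosh_uniformly_convex[OF s])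
  have ci: "integrable torus (\<lambda>x. cosh (?c x))"
  proof (rule Bochner_Integration.integrable_bound[OF b])
    show "(\<lambda>x. cosh (?c x)) \<in> borel_measurable torus" using c by measurable
    show "AE x in torus. norm (cosh (?c x)) \<le> norm (?b x)"
      using le cosh_real_nonneg by (auto intro!: AE_I2 order_trans[OF _ abs_ge_self])
  qed
  then show "cosh_integral ((1 - s) *\<^sub>R k + s *\<^sub>R m) < \<infinity>"
    unfolding eq using cosh_integral_finite_iff[OF c] by simp
  have "(\<integral>x. cosh (?c x) \<partial>torus) \<le> (\<integral>x. ?b x \<partial>torus)"
    by (rule integral_mono[OF ci b le])
  also have "\<dots> = (1 - s) * (\<integral>x. cosh (f x) \<partial>torus) + s * (\<integral>x. cosh (g x) \<partial>torus) - s * (1 - s) / 2 * (\<integral>x. (f x - g x)\<^sup>2 \<partial>torus)"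
    using i d by simp
  finally show "enn2real (cosh_integral ((1 - s) *\<^sub>R k + s *\<^sub>R m)) \<le>
      (1 - s) * enn2real (cosh_integral k) + s * enn2real (cosh_integral m) - s * (1 - s) / 2 * (norm (k - m))\<^sup>2"
    unfolding eq unfolding f(2) g(2) enn2real_cosh_integral[OF c] enn2real_cosh_integral[OF f(1)]
      enn2real_cosh_integral[OF g(1)] norm_abs_l2_diff[OF f(1) g(1)] .
qed

lemma cosh_integral_ge_1: "1 \<le> cosh_integral k"
proof -
  obtain f where f: "f \<in> sq_integrable" "k = abs_l2 f" by (rule l2_exhaust)
  have "1 = (\<integral>\<^sup>+x. 1 \<partial>torus)" by (simp add: emeasure_torus)
  also have "\<dots> \<le> cosh_integral k"
    unfolding f(2) cosh_integral_abs[OF f(1)] by (intro nn_integral_mono) (simp add: cosh_real_ge_1)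
  finally show ?thesis .
qed

lemma cosh_integral_0: "cosh_integral 0 = 1"
  using cosh_integral_abs[OF sq_integrable_const[of 0]] by (simp add: zero_l2_def emeasure_torus)

text \<open>Fatou's lemma along an almost everywhere convergent subsequence.\<close>

lemma cosh_integral_limit:
  assumes fin: "\<And>n::nat. cosh_integral (k n) \<le> ennreal (c n)" and lim: "k \<longlonglongrightarrow> k'" "c \<longlonglongrightarrow> C"
  shows "cosh_integral k' \<le> ennreal C"
proof -
  have "\<exists>f. f \<in> sq_integrable \<and> k n = abs_l2 f" for n using l2_exhaust[of "k n"] by blast
  then obtain f where f: "\<And>n. f n \<in> sq_integrable" "\<And>n. k n = abs_l2 (f n)" by metis
  obtain g where g: "g \<in> sq_integrable" "k' = abs_l2 g" by (rule l2_exhaust)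
  have "k = (\<lambda>n. abs_l2 (f n))" by (rule ext) (rule f(2))
  then have lim_f: "(\<lambda>n. abs_l2 (f n)) \<longlonglongrightarrow> abs_l2 g" using lim(1) g(2) by simp
  obtain r where r: "strict_mono r" "AE x in torus. (\<lambda>n. f (r n) x) \<longlonglongrightarrow> g x"
    using AE_convergent_subsequence[OF f(1) g(1) lim_f] by blast
  have "cosh_integral k' = (\<integral>\<^sup>+x. liminf (\<lambda>n. ennreal (cosh (f (r n) x))) \<partial>torus)"
    unfolding g(2) cosh_integral_abs[OF g(1)]
  proof (rule nn_integral_cong_AE, use r(2) in eventually_elim)
    case (elim x)
    then have "(\<lambda>n. cosh (f (r n) x)) \<longlonglongrightarrow> cosh (g x)" by (rule tendsto_cosh)
    then have "(\<lambda>n. ennreal (cosh (f (r n) x))) \<longlonglongrightarrow> ennreal (cosh (g x))" by (rule tendsto_ennrealI)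
    then show ?case by (rule lim_imp_Liminf[OF trivial_limit_sequentially, symmetric])
  qed
  also have "\<dots> \<le> liminf (\<lambda>n. \<integral>\<^sup>+x. ennreal (cosh (f (r n) x)) \<partial>torus)"
    by (rule nn_integral_liminf) (use f(1) in measurable)
  also have "\<dots> \<le> liminf (\<lambda>n. ennreal (c (r n)))"
    using fin unfolding f(2) cosh_integral_abs[OF f(1)] by (intro Liminf_mono always_eventually) auto
  also have "(\<lambda>n. c (r n)) \<longlonglongrightarrow> C" using LIMSEQ_subseq_LIMSEQ[OF lim(2) r(1)] by (simp add: o_def)
  then have "liminf (\<lambda>n. ennreal (c (r n))) = ennreal C"
    by (intro lim_imp_Liminf[OF trivial_limit_sequentially] tendsto_ennrealI)
  finally show ?thesis .
qed

section \<open>The real-valued energy and the hypotheses of \<open>convex_energy\<close>\<close>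

definition energy :: "l2 \<Rightarrow> real" where
  "energy u = enn2real (cosh_integral (dx (dx u)))"

lemma dom_phi_iff: "v \<in> dom_phi \<longleftrightarrow> (\<exists>k. second_deriv v k \<and> cosh_integral k < \<infinity>)"
proof -
  have fin: "enn2ereal x < \<infinity> \<longleftrightarrow> x < \<infinity>" for x
    by (cases x) (simp_all add: enn2ereal_ennreal)
  show ?thesis
  proof
    assume v: "v \<in> dom_phi"
    then have V: "v \<in> V" by (auto simp: dom_phi_def phi_def split: if_splits)
    then obtain k where k: "second_deriv v k" by (auto simp: in_V_iff)
    then have "cosh_integral k < \<infinity>"
      using v V fin[of "cosh_integral k"] by (simp add: dom_phi_def phi_def second_deriv_dx)
    then show "\<exists>k. second_deriv v k \<and> cosh_integral k < \<infinity>" using k by blast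
  next
    assume "\<exists>k. second_deriv v k \<and> cosh_integral k < \<infinity>"
    then obtain k where k: "second_deriv v k" "cosh_integral k < \<infinity>" by blast
    then have "v \<in> V" "v \<in> H" by (auto simp: in_V_iff H_def second_deriv_def)
    then show "v \<in> dom_phi" using k fin[of "cosh_integral k"] by (simp add: dom_phi_def phi_def second_deriv_dx)
  qed
qed

lemma energy_eq: "second_deriv v k \<Longrightarrow> energy v = enn2real (cosh_integral k)"
  by (simp add: energy_def second_deriv_dx)

lemma phi_eq: "phi v = (if v \<in> dom_phi then ereal (energy v) else \<infinity>)"
proof (cases "v \<in> dom_phi")
  case True
  then obtain k where k: "second_deriv v k" "cosh_integral k < \<infinity>" by (auto simp: dom_phi_iff)
  then obtain r where r: "0 \<le> r" "cosh_integral k = ennreal r" by (cases "cosh_integral k") auto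
  have "v \<in> V" using k(1) by (auto simp: in_V_iff)
  then show ?thesis
    using True r energy_eq[OF k(1)] by (simp add: phi_def second_deriv_dx[OF k(1)] enn2ereal_ennreal)
next
  case False
  have "v \<in> V \<Longrightarrow> v \<in> H" by (simp add: V_def H_def)
  then show ?thesis using False unfolding dom_phi_def by (cases "v \<in> V") (auto simp: phi_def)
qed

lemma subspace_H: "subspace H"
  by (auto simp: subspace_def H_def mean_eq_inner inner_add_left)

lemma complete_H: "complete H"
proof -
  have "closed {u :: l2. inner u (abs_l2 (\<lambda>x. 1)) = 0}"
    by (intro closed_Collect_eq continuous_intros)
  then have "closed H" by (simp add: H_def mean_eq_inner)
  then show ?thesis using complete_Int_closed[OF complete_l2] by simp
qed

text \<open>The approximants are trigonometric polynomials with their mean removed. As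
  \<open>u\<close> has mean zero, that mean is no larger than the approximation error.\<close>

lemma dom_phi_dense: "H \<subseteq> closure dom_phi"
proof
  fix u assume u: "u \<in> H"
  show "u \<in> closure dom_phi"
    unfolding closure_approachable
  proof (intro allI impI)
    fix e :: real assume e: "0 < e"
    obtain n a b where T: "norm (u - abs_l2 (trigpoly n a b)) < e / 2"
      using trigpoly_approx[of "e / 2" u] e by auto
    define y where "y = abs_l2 (trigpoly n a b)"
    define i where "i = abs_l2 (\<lambda>x. 1)"
    have norm_i: "norm i = 1" unfolding i_def by (rule norm_one_l2)
    have "trigpoly 0 (\<lambda>_. 1) (\<lambda>_. 0) = (\<lambda>x. 1)" by (simp add: trigpoly_def fun_eq_iff)
    then have wi: "weak_deriv i 0"
      using weak_deriv_test_function[OF test_function_trigpoly[of 0 "\<lambda>_. 1" "\<lambda>_. 0"]]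
      by (simp add: i_def zero_l2_def)
    obtain a' b' where T': "deriv (trigpoly n a b) = trigpoly n a' b'" by (simp add: deriv_trigpoly)
    obtain a'' b'' where T'': "deriv (trigpoly n a' b') = trigpoly n a'' b''" by (simp add: deriv_trigpoly)
    have wy: "weak_deriv y (abs_l2 (trigpoly n a' b'))" "weak_deriv (abs_l2 (trigpoly n a' b')) (abs_l2 (trigpoly n a'' b''))"
      using weak_deriv_test_function[OF test_function_trigpoly] T' T'' unfolding y_def by metis+
    define v where "v = y - mean y *\<^sub>R i"
    have "weak_deriv v (abs_l2 (trigpoly n a' b'))"
      using weak_deriv_linear[OF wy(1) wi, of 1 "- mean y"] by (simp add: v_def)
    moreover have "mean v = 0"
      using norm_i by (simp add: v_def mean_eq_inner inner_diff_left i_def[symmetric] dot_square_norm)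
    ultimately have "second_deriv v (abs_l2 (trigpoly n a'' b''))" using wy(2) by (auto simp: second_deriv_def)
    moreover have "cosh_integral (abs_l2 (trigpoly n a'' b'')) < \<infinity>"
      unfolding cosh_integral_finite_iff[OF trigpoly_sq_integrable]
      by (intro sq_integrable_imp_integrable continuous_sq_integrable continuous_intros continuous_on_trigpoly)
    ultimately have "v \<in> dom_phi" by (auto simp: dom_phi_iff)
    moreover have "dist v u < e"
    proof -
      have "mean u = 0" using u by (simp add: H_def)
      then have "\<bar>mean y\<bar> = \<bar>inner (u - y) i\<bar>" by (simp add: mean_eq_inner inner_diff_left i_def)
      also have "\<dots> \<le> norm (u - y)" using Cauchy_Schwarz_ineq2[of "u - y" i] norm_i by simp
      finally have "norm (mean y *\<^sub>R i) \<le> norm (u - y)" using norm_i by simp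
      moreover have "norm (u - v) \<le> norm (u - y) + norm (mean y *\<^sub>R i)"
        using norm_triangle_ineq[of "u - y" "mean y *\<^sub>R i"] by (simp only: v_def diff_diff_eq2 diff_add_eq)
      ultimately show ?thesis using T by (simp add: dist_norm norm_minus_commute y_def[symmetric])
    qed
    ultimately show "\<exists>v\<in>dom_phi. dist v u < e" by blast
  qed
qed

text \<open>The modulus is stated for the second derivatives: \<open>energy_closed\<close> needs
  these to form a Cauchy sequence, and \<open>lam_norm_le\<close> weakens the modulus to the one of
  the locale.\<close>

lemma energy_convex:
  assumes u: "u \<in> dom_phi" and v: "v \<in> dom_phi" and s: "0 \<le> s" "s \<le> 1"
  shows "(1 - s) *\<^sub>R u + s *\<^sub>R v \<in> dom_phi"
    and "energy ((1 - s) *\<^sub>R u + s *\<^sub>R v) \<le>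
      (1 - s) * energy u + s * energy v - s * (1 - s) / 2 * (norm (dx (dx u) - dx (dx v)))\<^sup>2"
proof -
  obtain k where k: "second_deriv u k" "cosh_integral k < \<infinity>" using u by (auto simp: dom_phi_iff)
  obtain m where m: "second_deriv v m" "cosh_integral m < \<infinity>" using v by (auto simp: dom_phi_iff)
  note lin = second_deriv_linear[OF k(1) m(1), of "1 - s" s]
  note conv = cosh_integral_convex[OF k(2) m(2) s]
  show "(1 - s) *\<^sub>R u + s *\<^sub>R v \<in> dom_phi" using lin conv(1) by (auto simp: dom_phi_iff)
  show "energy ((1 - s) *\<^sub>R u + s *\<^sub>R v) \<le>
      (1 - s) * energy u + s * energy v - s * (1 - s) / 2 * (norm (dx (dx u) - dx (dx v)))\<^sup>2"
    using conv(2) by (simp only: energy_eq[OF lin] energy_eq[OF k(1)] energy_eq[OF m(1)] second_deriv_dx[OF k(1)] second_deriv_dx[OF m(1)])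
qed

lemma lam_norm_le:
  assumes u: "u \<in> dom_phi" and v: "v \<in> dom_phi"
  shows "lam * (norm (u - v))\<^sup>2 \<le> (norm (dx (dx u) - dx (dx v)))\<^sup>2"
proof -
  obtain k where k: "second_deriv u k" using u by (auto simp: dom_phi_iff)
  obtain m where m: "second_deriv v m" using v by (auto simp: dom_phi_iff)
  have "second_deriv (u - v) (k - m)" using second_deriv_linear[OF k m, of 1 "-1"] by simp
  then have "((2 * pi)\<^sup>2 * norm (u - v))\<^sup>2 \<le> (norm (k - m))\<^sup>2"
    by (intro power_mono second_deriv_norm) auto
  then show ?thesis
    by (simp add: second_deriv_dx[OF k] second_deriv_dx[OF m] lam_def power_mult_distrib flip: power_mult)
qed

lemma energy_closed:
  assumes w: "\<And>n::nat. w n \<in> dom_phi" and lim: "w \<longlonglongrightarrow> h" and c: "\<And>n. energy (w n) \<le> c n" "c \<longlonglongrightarrow> C"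
    and mid: "\<And>e. 0 < e \<Longrightarrow> \<exists>N. \<forall>m\<ge>N. \<forall>n\<ge>N. energy (w m) / 2 + energy (w n) / 2 - e \<le> energy (midpoint (w m) (w n))"
  shows "h \<in> dom_phi \<and> energy h \<le> C"
proof -
  have "\<exists>k. second_deriv (w n) k \<and> cosh_integral k < \<infinity>" for n using w[of n] by (simp add: dom_phi_iff)
  then obtain k where k: "\<And>n. second_deriv (w n) (k n)" "\<And>n. cosh_integral (k n) < \<infinity>" by metis
  have "Cauchy k"
  proof (rule metric_CauchyI)
    fix e :: real assume e: "0 < e"
    then have "0 < e\<^sup>2 / 16" by simp
    from mid[OF this] obtain N where N: "\<And>m n. m \<ge> N \<Longrightarrow> n \<ge> N \<Longrightarrow>
        energy (w m) / 2 + energy (w n) / 2 - e\<^sup>2 / 16 \<le> energy (midpoint (w m) (w n))" by blast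
    have "dist (k m) (k n) < e" if "m \<ge> N" "n \<ge> N" for m n
    proof -
      have "energy (midpoint (w m) (w n)) \<le> energy (w m) / 2 + energy (w n) / 2 - (norm (k m - k n))\<^sup>2 / 8"
        using energy_convex(2)[OF w[of m] w[of n], of "1/2"]
        unfolding midpoint_conv second_deriv_dx[OF k(1)] by simp
      then have "(norm (k m - k n))\<^sup>2 \<le> e\<^sup>2 / 2" using N[OF that] by linarith
      also have "\<dots> < e\<^sup>2" using e by simp
      finally show ?thesis unfolding dist_norm by (rule power_less_imp_less_base) (use e in simp)
    qed
    then show "\<exists>M. \<forall>m\<ge>M. \<forall>n\<ge>M. dist (k m) (k n) < e" by blast
  qed
  then obtain k' where k': "k \<longlonglongrightarrow> k'" using complete_l2 unfolding complete_def by blast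
  have h: "second_deriv h k'" by (rule second_deriv_limit[OF k(1) lim k'])
  have "cosh_integral (k n) \<le> ennreal (c n)" for n
    using c(1)[of n] k(2)[of n] by (cases "cosh_integral (k n)") (auto simp: energy_eq[OF k(1)] ennreal_leI)
  from cosh_integral_limit[OF this k' c(2)] have le: "cosh_integral k' \<le> ennreal C" .
  then have "cosh_integral k' < \<infinity>" using ennreal_less_top le_less_trans by fastforce
  moreover have "energy h \<le> C"
  proof -
    \<comment> \<open>Since \<open>ennreal\<close> sends negative numbers to zero, the return to
      real numbers needs \<open>0 \<le> C\<close>.\<close>
    have "0 \<le> energy (w n)" for n by (simp add: energy_def)
    then have "0 \<le> c n" for n using c(1) order_trans by blast
    then have "0 \<le> C" using LIMSEQ_le_const[OF c(2)] by blast
    then show ?thesis using le unfolding energy_eq[OF h] by (rule enn2real_leI)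
  qed
  ultimately show ?thesis using h by (auto simp: dom_phi_iff)
qed

lemma zero_in_dom_phi: "0 \<in> dom_phi" and energy_0: "energy 0 = 1"
proof -
  have "weak_deriv 0 0" by (simp add: weak_deriv_iff)
  then have s: "second_deriv 0 0" by (auto simp: second_deriv_def mean_eq_inner)
  then show "0 \<in> dom_phi" using cosh_integral_0 by (auto simp: dom_phi_iff intro!: exI[of _ 0])
  show "energy 0 = 1" using energy_eq[OF s] by (simp add: cosh_integral_0)
qed

lemma energy_ge_1:
  assumes "v \<in> dom_phi"
  shows "1 \<le> energy v"
proof -
  obtain k where k: "second_deriv v k" "cosh_integral k < \<infinity>" using assms by (auto simp: dom_phi_iff)
  then show ?thesis using cosh_integral_ge_1[of k]
    by (cases "cosh_integral k") (auto simp: energy_eq[OF k(1)])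
qed

lemma lam_pos: "0 < lam"
  by (simp add: lam_def)

interpretation flow: convex_energy H dom_phi energy lam
proof (rule convex_energy.intro)
  show "subspace H" "complete H" "H \<subseteq> closure dom_phi" "0 < lam" "0 \<in> dom_phi"
    by (fact subspace_H complete_H dom_phi_dense lam_pos zero_in_dom_phi)+
  show "dom_phi \<subseteq> H" by (auto simp: dom_phi_def)
  show "energy 0 \<le> energy v" if "v \<in> dom_phi" for v
    using energy_ge_1[OF that] by (simp add: energy_0)
  show "(1 - s) *\<^sub>R u + s *\<^sub>R v \<in> dom_phi"
    if "u \<in> dom_phi" "v \<in> dom_phi" "0 \<le> s" "s \<le> 1" for u v s
    by (rule energy_convex(1)[OF that])
  show "energy ((1 - s) *\<^sub>R u + s *\<^sub>R v) \<le> (1 - s) * energy u + s * energy v - lam / 2 * (s * (1 - s)) * (norm (u - v))\<^sup>2"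
    if "u \<in> dom_phi" "v \<in> dom_phi" "0 \<le> s" "s \<le> 1" for u v s
  proof -
    have "s * (1 - s) / 2 * (lam * (norm (u - v))\<^sup>2) \<le> s * (1 - s) / 2 * (norm (dx (dx u) - dx (dx v)))\<^sup>2"
      using that by (intro mult_left_mono lam_norm_le) auto
    moreover have "lam / 2 * (s * (1 - s)) * (norm (u - v))\<^sup>2 = s * (1 - s) / 2 * (lam * (norm (u - v))\<^sup>2)"
      by simp
    ultimately show ?thesis using energy_convex(2)[OF that] by linarith
  qed
  show "h \<in> dom_phi \<and> energy h \<le> C"
    if "\<And>n. w n \<in> dom_phi" "w \<longlonglongrightarrow> h" "\<And>n. energy (w n) \<le> c n" "c \<longlonglongrightarrow> C"
      "\<And>e. 0 < e \<Longrightarrow> \<exists>N. \<forall>m\<ge>N. \<forall>n\<ge>N. energy (w m) / 2 + energy (w n) / 2 - e \<le> energy (midpoint (w m) (w n))"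
    for w :: "nat \<Rightarrow> l2" and h c C
    by (rule energy_closed[OF that])
qed

section \<open>Minimizing movements and slopes\<close>

lemma Phi_eq:
  "Phi \<tau> h v = (if v \<in> dom_phi then ereal (flow.yosida \<tau> h v) else \<infinity>)"
  by (simp add: Phi_def phi_eq flow.yosida_def)

lemma is_arg_min_Phi_iff:
  assumes h: "h \<in> H" and \<tau>: "0 < \<tau>"
  shows "is_arg_min (Phi \<tau> h) (\<lambda>v. v \<in> H) u \<longleftrightarrow> u = flow.J \<tau> h"
proof
  assume u: "is_arg_min (Phi \<tau> h) (\<lambda>v. v \<in> H) u"
  then have le: "Phi \<tau> h u \<le> Phi \<tau> h v" if "v \<in> H" for v
    using that by (simp add: is_arg_min_linorder)
  have "Phi \<tau> h u < \<infinity>"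
    using le[of 0] zero_in_dom_phi flow.in_H by (auto simp: Phi_eq split: if_splits)
  then have uD: "u \<in> dom_phi" by (auto simp: Phi_eq split: if_splits)
  show "u = flow.J \<tau> h"
    by (rule flow.J_unique[OF h \<tau> uD]) (use le uD flow.in_H in \<open>force simp: Phi_eq\<close>)
next
  assume u: "u = flow.J \<tau> h"
  show "is_arg_min (Phi \<tau> h) (\<lambda>v. v \<in> H) u"
    unfolding is_arg_min_linorder u
    using flow.J_H[OF h \<tau>] flow.J_D[OF h \<tau>] flow.J_min[OF h \<tau>] by (auto simp: Phi_eq)
qed

lemma resolvent_eq: "h \<in> H \<Longrightarrow> 0 < \<tau> \<Longrightarrow> resolvent \<tau> h = flow.J \<tau> h"
  using someI_ex[of "is_arg_min (Phi \<tau> h) (\<lambda>v. v \<in> H)"] is_arg_min_Phi_iff[of h \<tau>]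
  unfolding resolvent_def arg_min_def by auto

lemma resolvent_iterate_eq:
  assumes "h \<in> H" "0 < \<tau>"
  shows "(resolvent \<tau> ^^ n) h = (flow.J \<tau> ^^ n) h"
  by (induction n) (simp_all add: resolvent_eq flow.iterate_H assms)

section \<open>Partitions of vanishing mesh\<close>

lemma eventually_vanishing_mesh:
  assumes d: "0 < d" and P: "\<And>p. partition p \<Longrightarrow> (\<And>n. p (Suc n) - p n \<le> d) \<Longrightarrow> P p"
  shows "\<forall>\<^sub>F p in vanishing_mesh. P p"
proof -
  have "\<forall>\<^sub>F y in nhds (0::ereal). y < ereal d"
    by (rule order_tendstoD(2)[OF filterlim_ident]) (use d in simp)
  then have "\<forall>\<^sub>F p in filtercomap mesh (nhds 0). mesh p < ereal d" by (rule eventually_filtercomapI)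
  then have "\<forall>\<^sub>F p in filtercomap mesh (nhds 0). partition p \<longrightarrow> P p"
  proof eventually_elim
    case (elim p)
    have "p (Suc n) - p n \<le> d" for n
    proof -
      have "ereal (p (Suc n) - p n) \<le> mesh p" unfolding mesh_def by (rule SUP_upper) simp
      then have "ereal (p (Suc n) - p n) < ereal d" using elim by (rule le_less_trans)
      then show ?thesis by simp
    qed
    then show ?case using P by blast
  qed
  then show ?thesis by (simp add: vanishing_mesh_def eventually_inf_principal)
qed

definition euler_sequence :: "l2 \<Rightarrow> (nat \<Rightarrow> real) \<Rightarrow> nat \<Rightarrow> l2" where
  "euler_sequence x p = rec_nat x (\<lambda>n u. flow.J (p (Suc n) - p n) u)"

lemma euler_sequence_scheme:
  assumes "partition p"
  shows "flow.scheme x (\<lambda>n. p (Suc n) - p n) (euler_sequence x p)"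
  using assms by (auto simp: flow.scheme_def euler_sequence_def partition_def strict_mono_Suc_iff)

lemma discrete_solution_euler_sequence:
  assumes p: "partition p" and x: "x \<in> H"
  shows "discrete_solution p (euler_sequence x p)"
proof -
  note s = euler_sequence_scheme[OF p, of x]
  show ?thesis
    unfolding discrete_solution_def
  proof (intro conjI allI)
    show "euler_sequence x p 0 \<in> H" using flow.scheme_H[OF s x] .
    show "is_arg_min (Phi (p (Suc n) - p n) (euler_sequence x p n)) (\<lambda>v. v \<in> H) (euler_sequence x p (Suc n))" for n
      using flow.scheme_H[OF s x, of n] flow.schemeD(2,3)[OF s, of n] by (simp add: is_arg_min_Phi_iff)
  qed
qed

text \<open>All schemes start at \<open>x\<close> itself, which settles the conditions on the
  initial data even when \<open>phi x\<close> is infinite; the rest is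
  \<open>scheme_limit\<close>.\<close>

lemma S_in_MM:
  assumes x: "x \<in> H"
  shows "(\<lambda>t. flow.S t x) \<in> MM x"
  unfolding MM_def
proof (intro CollectI conjI allI impI exI[of _ "euler_sequence x"])
  have init: "euler_sequence x p 0 = x" for p by (simp add: euler_sequence_def)
  show "0 \<le> t \<Longrightarrow> flow.S t x \<in> H" for t by (rule flow.S_H[OF x])
  show "\<forall>\<^sub>F p in vanishing_mesh. discrete_solution p (euler_sequence x p)"
    by (rule eventually_vanishing_mesh[of 1]) (auto intro: discrete_solution_euler_sequence x)
  show "((\<lambda>p. phi (euler_sequence x p 0)) \<longlongrightarrow> phi x) vanishing_mesh" by (simp add: init)
  have "Limsup vanishing_mesh (\<lambda>p. ereal (norm (euler_sequence x p 0 - x))) \<le> 0"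
    by (rule Limsup_bounded) (simp add: init)
  then show "Limsup vanishing_mesh (\<lambda>p. ereal (norm (euler_sequence x p 0 - x))) < \<infinity>"
    using le_less_trans by fastforce
  fix t :: real assume t: "0 \<le> t"
  show "((\<lambda>p. interpolant p (euler_sequence x p) t) \<longlongrightarrow> flow.S t x) vanishing_mesh"
  proof (rule tendstoI)
    fix e :: real assume e: "0 < e"
    obtain d where d: "0 < d" and lim: "\<And>s \<tau> U i. 0 \<le> s \<Longrightarrow> s \<le> t \<Longrightarrow> flow.scheme x \<tau> U \<Longrightarrow> \<forall>k<i. \<tau> k \<le> d \<Longrightarrow>
        \<bar>(\<Sum>k<i. \<tau> k) - s\<bar> \<le> d \<Longrightarrow> norm (U i - flow.S s x) \<le> e / 2"
      using flow.scheme_limit[OF x, of "e / 2" t] e t by auto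
    show "\<forall>\<^sub>F p in vanishing_mesh. dist (interpolant p (euler_sequence x p) t) (flow.S t x) < e"
    proof (rule eventually_vanishing_mesh[OF d])
      fix p assume p: "partition p" and mesh: "\<And>n. p (Suc n) - p n \<le> d"
      define i where "i = (LEAST n. t \<le> p n)"
      have "\<exists>n. t \<le> p n"
        using p unfolding partition_def filterlim_at_top eventually_sequentially by blast
      then have i: "t \<le> p i" unfolding i_def by (rule LeastI_ex)
      \<comment> \<open>The least index makes \<open>p i\<close> exceed \<open>t\<close> by at most
        one step; \<open>i = 0\<close> occurs only for \<open>t = 0\<close>.\<close>
      have "p i - t \<le> d"
      proof (cases i)
        case 0
        then show ?thesis using p t d by (simp add: partition_def)
      next
        case (Suc j)
        then have "\<not> t \<le> p j" unfolding i_def using not_less_Least[of j] by (metis lessI)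
        then show ?thesis using mesh[of j] Suc by simp
      qed
      moreover have "(\<Sum>k<i. p (Suc k) - p k) = p i"
        using p by (simp add: sum_lessThan_telescope partition_def)
      ultimately have "norm (euler_sequence x p i - flow.S t x) \<le> e / 2"
        using i mesh t by (intro lim[OF _ _ euler_sequence_scheme[OF p]]) auto
      then show "dist (interpolant p (euler_sequence x p) t) (flow.S t x) < e"
        using e by (simp add: interpolant_def i_def dist_norm)
    qed
  qed
qed

section \<open>Identification of the metric slope\<close>

lemma segment_filterlim:
  assumes v: "v \<in> H" and w: "w \<in> H" and ne: "w \<noteq> v"
  shows "filterlim (\<lambda>s. (1 - s) *\<^sub>R v + s *\<^sub>R w) (at v within H) (at_right (0::real))"
  unfolding filterlim_at
proof
  show "\<forall>\<^sub>F s in at_right 0. (1 - s) *\<^sub>R v + s *\<^sub>R w \<in> H \<and> (1 - s) *\<^sub>R v + s *\<^sub>R w \<noteq> v"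
    unfolding eventually_at_right_field
  proof (intro exI[of _ 1] conjI allI impI)
    fix s :: real assume s: "0 < s" "s < 1"
    show "(1 - s) *\<^sub>R v + s *\<^sub>R w \<in> H" by (intro subspace_add subspace_scale subspace_H v w)
    have "(1 - s) *\<^sub>R v + s *\<^sub>R w - v = s *\<^sub>R (w - v)" by (simp add: algebra_simps)
    then show "(1 - s) *\<^sub>R v + s *\<^sub>R w \<noteq> v" using s ne by auto
  qed simp
  have "((\<lambda>s. (1 - s) *\<^sub>R v + s *\<^sub>R w) \<longlongrightarrow> (1 - 0) *\<^sub>R v + 0 *\<^sub>R w) (at_right 0)"
    by (intro tendsto_intros)
  then show "((\<lambda>s. (1 - s) *\<^sub>R v + s *\<^sub>R w) \<longlongrightarrow> v) (at_right 0)" by simp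
qed

lemma exists_nonzero_H: "\<exists>w\<in>H. w \<noteq> 0"
proof -
  let ?T = "trigpoly 1 (\<lambda>_. 0) (\<lambda>_. 1)"
  have "mean (abs_l2 (deriv ?T)) = 0"
    by (rule weak_deriv_mean_zero[OF weak_deriv_test_function[OF test_function_trigpoly]])
  moreover have "norm (abs_l2 (deriv ?T)) \<noteq> 0"
  proof
    assume "norm (abs_l2 (deriv ?T)) = 0"
    then have "(norm (abs_l2 (deriv ?T)))\<^sup>2 = 0" by simp
    then show False unfolding deriv_trigpoly norm_trigpoly by simp
  qed
  ultimately show ?thesis by (intro bexI[of _ "abs_l2 (deriv ?T)"]) (auto simp: H_def)
qed

text \<open>On the trivial filter a \<open>Limsup\<close> in \<open>ereal\<close> would be
  \<open>- \<infinity>\<close>; excluding this gives \<open>slope_nonneg\<close>.\<close>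

lemma at_within_H_nontrivial:
  assumes v: "v \<in> H"
  shows "at v within H \<noteq> bot"
proof -
  obtain w where w: "w \<in> H" "w \<noteq> 0" using exists_nonzero_H by blast
  have "filterlim (\<lambda>s. (1 - s) *\<^sub>R v + s *\<^sub>R (v + w)) (at v within H) (at_right (0::real))"
    by (rule segment_filterlim) (use v w subspace_add[OF subspace_H v w(1)] in auto)
  note lim = filterlim_iff[THEN iffD1, OF this, rule_format]
  show ?thesis
  proof
    assume "at v within H = bot"
    then have "\<forall>\<^sub>F w in at v within H. False" by simp
    from lim[OF this] show False by simp
  qed
qed

lemma slope_nonneg: "v \<in> H \<Longrightarrow> 0 \<le> slope v"
proof -
  assume v: "v \<in> H"
  have "0 \<le> max (phi v - phi w) 0 / ereal (dist v w)" for w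
    by (rule zero_le_divide_ereal) auto
  then show ?thesis
    by (auto simp: slope_def intro!: le_Limsup at_within_H_nontrivial[OF v] always_eventually)
qed

lemma slope_quotient_eq:
  assumes "v \<in> dom_phi" "w \<noteq> v"
  shows "max (phi v - phi w) 0 / ereal (dist v w) =
    ereal (if w \<in> dom_phi then max (energy v - energy w) 0 / dist v w else 0)"
  using assms by (cases "energy w \<le> energy v") (auto simp: phi_eq max_def)

text \<open>By convexity the rate of energy decrease from \<open>v\<close> along a segment is
  largest near \<open>v\<close>, so the local limsup already controls the drop towards every
  \<open>w\<close>.\<close>

lemma slope_le_iff:
  assumes v: "v \<in> dom_phi" and M: "0 \<le> M"
  shows "slope v \<le> ereal M \<longleftrightarrow> flow.slope_bound v M"
proof
  assume sb: "flow.slope_bound v M"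
  have "max (phi v - phi w) 0 / ereal (dist v w) \<le> ereal M" if w: "w \<noteq> v" for w
    unfolding slope_quotient_eq[OF v w]
    using w M flow.slope_boundD(3)[OF sb, of w] by (simp add: dist_norm pos_divide_le_eq)
  then have "\<forall>\<^sub>F w in at v within H. max (phi v - phi w) 0 / ereal (dist v w) \<le> ereal M"
    by (auto simp: eventually_at_filter)
  then show "slope v \<le> ereal M" using v by (simp add: slope_def Limsup_bounded)
next
  assume sl: "slope v \<le> ereal M"
  have vH: "v \<in> H" by (rule flow.in_H[OF v])
  \<comment> \<open>A limsup bounded by \<open>M\<close> gives an eventual inequality only for
    constants \<open>M'\<close> above \<open>M\<close>; the gap is closed at the end.\<close>
  have main: "energy v - energy w \<le> M' * norm (v - w)" if w: "w \<in> dom_phi" "w \<noteq> v" and M': "M < M'" for w M'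
  proof -
    have "Limsup (at v within H) (\<lambda>w. max (phi v - phi w) 0 / ereal (dist v w)) < ereal M'"
      using sl v M' by (simp add: slope_def) (metis ereal_less(2) le_less_trans less_ereal.simps(1))
    then have "\<forall>\<^sub>F w in at v within H. max (phi v - phi w) 0 / ereal (dist v w) < ereal M'"
      by (rule Limsup_lessD)
    from filterlim_iff[THEN iffD1, OF segment_filterlim[OF vH flow.in_H[OF w(1)] w(2)], rule_format, OF this]
    have "\<forall>\<^sub>F s in at_right 0. max (phi v - phi ((1 - s) *\<^sub>R v + s *\<^sub>R w)) 0 / ereal (dist v ((1 - s) *\<^sub>R v + s *\<^sub>R w)) < ereal M'" .
    moreover have "\<forall>\<^sub>F s in at_right (0::real). 0 < s \<and> s < 1"
      unfolding eventually_at_right_field by (intro exI[of _ 1]) auto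
    ultimately obtain s :: real where s: "0 < s" "s < 1"
      and lt: "max (phi v - phi ((1 - s) *\<^sub>R v + s *\<^sub>R w)) 0 / ereal (dist v ((1 - s) *\<^sub>R v + s *\<^sub>R w)) < ereal M'"
      using eventually_happens'[OF trivial_limit_at_right_real eventually_conj] by blast
    let ?z = "(1 - s) *\<^sub>R v + s *\<^sub>R w"
    have zD: "?z \<in> dom_phi" using flow.convex_D[OF v w(1)] s by simp
    have "v - ?z = s *\<^sub>R (v - w)" by (simp add: algebra_simps)
    then have dz: "dist v ?z = s * norm (v - w)" using s by (simp add: dist_norm)
    have p: "0 < s * norm (v - w)" using s w by simp
    then have "?z \<noteq> v" using dz by auto
    have "max (energy v - energy ?z) 0 / (s * norm (v - w)) < M'"
      using lt zD unfolding slope_quotient_eq[OF v \<open>?z \<noteq> v\<close>] unfolding dz by simp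
    then have "energy v - energy ?z < M' * (s * norm (v - w))" using p by (simp add: pos_divide_less_eq)
    moreover have "energy ?z \<le> (1 - s) * energy v + s * energy w"
      using energy_convex(2)[OF v w(1), of s] s
      by (smt (verit) divide_nonneg_nonneg mult_nonneg_nonneg zero_le_power2)
    ultimately have "s * (energy v - energy w) \<le> s * (M' * norm (v - w))" by (simp add: algebra_simps)
    then show ?thesis using s by (simp only: mult_le_cancel_left_pos)
  qed
  show "flow.slope_bound v M"
    unfolding flow.slope_bound_def
  proof (intro conjI ballI v M)
    fix w assume w: "w \<in> dom_phi"
    show "energy v - energy w \<le> M * norm (v - w)"
    proof (cases "w = v")
      case False
      then have p: "0 < norm (v - w)" by simp
      have "(energy v - energy w) / norm (v - w) \<le> M"
      proof (rule field_le_epsilon)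
        fix e :: real assume "0 < e"
        then show "(energy v - energy w) / norm (v - w) \<le> M + e"
          using main[OF w False, of "M + e"] p by (simp add: pos_divide_le_eq)
      qed
      then show ?thesis using p by (simp add: pos_divide_le_eq)
    qed simp
  qed
qed

lemma slope_regularizing:
  assumes x: "x \<in> H" and t: "0 < t" and v: "v \<in> dom_slope"
  shows "(slope (flow.S t x))\<^sup>2 \<le> (slope v)\<^sup>2 + ereal (1 / t\<^sup>2 * (norm (v - x))\<^sup>2)"
proof -
  have vD: "v \<in> dom_phi" and fin: "slope v < \<infinity>" using v by (auto simp: dom_slope_def)
  obtain M where M: "slope v = ereal M" "0 \<le> M"
    using fin slope_nonneg[OF flow.in_H[OF vD]] by (cases "slope v") auto
  define R where "R = sqrt (M\<^sup>2 + (norm (v - x))\<^sup>2 / t\<^sup>2)"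
  have R: "0 \<le> R" "R\<^sup>2 = M\<^sup>2 + (norm (v - x))\<^sup>2 / t\<^sup>2" by (simp_all add: R_def)
  have "flow.slope_bound v M" using slope_le_iff[OF vD M(2)] M(1) by simp
  from flow.S_regularizes[OF x t this] have sb: "flow.slope_bound (flow.S t x) R" unfolding R_def .
  note SD = flow.slope_boundD(1)[OF sb]
  have "slope (flow.S t x) \<le> ereal R" using slope_le_iff[OF SD R(1)] sb by simp
  then obtain r where r: "slope (flow.S t x) = ereal r" "0 \<le> r" "r \<le> R"
    using slope_nonneg[OF flow.in_H[OF SD]] by (cases "slope (flow.S t x)") auto
  have "r\<^sup>2 \<le> R\<^sup>2" using r by (intro power_mono)
  then show ?thesis using r(1) M(1) R(2) by simp
qed

section \<open>The evolution variational inequality for \<open>phi\<close>, and decay\<close>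

lemma S_EVI_solution:
  assumes x: "x \<in> H"
  shows "EVI_solution x (\<lambda>t. flow.S t x)"
  unfolding EVI_solution_def
proof (intro conjI allI impI)
  show "0 < t \<Longrightarrow> flow.S t x \<in> H" for t using flow.S_H[OF x] by simp
  show "0 < a \<Longrightarrow> a \<le> b \<Longrightarrow> abs_continuous_on {a..b} (\<lambda>t. flow.S t x)" for a b
    by (rule flow.S_abs_continuous[OF x])
  show "((\<lambda>t. flow.S t x) \<longlongrightarrow> x) (at_right 0)" by (rule flow.S_tendsto_initial[OF x])
  let ?C = "{t \<in> {0<..}. \<not> isCont (\<lambda>s. flow.minslope (flow.S s x)) t}"
  show "AE t in lborel. 0 < t \<longrightarrow> (\<forall>v\<in>dom_phi. \<exists>d.
      ((\<lambda>s. (norm (flow.S s x - v))\<^sup>2) has_real_derivative d) (at t) \<and>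
      ereal (1 / 2 * d + lam / 2 * (norm (flow.S t x - v))\<^sup>2) \<le> phi v - phi (flow.S t x))"
  proof (rule AE_mp[OF AE_not_in[OF countable_imp_null_set_lborel[OF flow.countable_minslope_discont[OF x]]]], rule AE_I2, intro impI ballI)
    fix t v assume tC: "t \<notin> ?C" and t: "0 < t" and v: "v \<in> dom_phi"
    then have cont: "isCont (\<lambda>s. flow.minslope (flow.S s x)) t" by simp
    obtain L where L: "((\<lambda>s. flow.S s x) has_vector_derivative L) (at t)"
      and le: "\<And>v. v \<in> dom_phi \<Longrightarrow> inner (flow.S t x - v) L + lam / 2 * (norm (flow.S t x - v))\<^sup>2 \<le> energy v - energy (flow.S t x)"
      using flow.S_differentiable[OF x t cont] by blast
    have SD: "flow.S t x \<in> dom_phi" using flow.slope_boundD(1)[OF flow.slope_bound_S[OF x t]] .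
    have "((\<lambda>s. flow.S s x - v) has_derivative (\<lambda>r. r *\<^sub>R L)) (at t)"
      using L[unfolded has_vector_derivative_def] by (auto intro!: derivative_eq_intros)
    from has_derivative_inner[OF this this]
    have "((\<lambda>s. (norm (flow.S s x - v))\<^sup>2) has_real_derivative 2 * inner (flow.S t x - v) L) (at t)"
      unfolding power2_norm_eq_inner has_field_derivative_def
      by (rule has_derivative_eq_rhs) (auto simp: inner_commute)
    moreover have "ereal (1 / 2 * (2 * inner (flow.S t x - v) L) + lam / 2 * (norm (flow.S t x - v))\<^sup>2) \<le> phi v - phi (flow.S t x)"
      using le[OF v] v SD by (simp add: phi_eq)
    ultimately show "\<exists>d. ((\<lambda>s. (norm (flow.S s x - v))\<^sup>2) has_real_derivative d) (at t) \<and>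
      ereal (1 / 2 * d + lam / 2 * (norm (flow.S t x - v))\<^sup>2) \<le> phi v - phi (flow.S t x)" by blast
  qed
qed

lemma EVI_solution_unique:
  assumes x: "x \<in> H" and g: "EVI_solution x g" and t: "0 < t"
  shows "g t = flow.S t x"
proof -
  obtain N where N: "N \<in> null_sets lborel"
    and evi: "\<And>t v. t \<notin> N \<Longrightarrow> 0 < t \<Longrightarrow> v \<in> dom_phi \<Longrightarrow> \<exists>d.
      ((\<lambda>s. (norm (g s - v))\<^sup>2) has_real_derivative d) (at t) \<and>
      ereal (1 / 2 * d + lam / 2 * (norm (g t - v))\<^sup>2) \<le> phi v - phi (g t)"
    using g[unfolded EVI_solution_def, THEN conjunct2, THEN conjunct2, THEN conjunct2] by (auto elim!: AE_E3)
  \<comment> \<open>The left-hand side of the inequality for \<open>v = 0\<close> is a real number,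
    so \<open>phi (g t)\<close> cannot be infinite.\<close>
  have gD: "g t \<in> dom_phi" if t: "0 < t" "t \<notin> N" for t
  proof (rule ccontr)
    assume "g t \<notin> dom_phi"
    then have "phi 0 - phi (g t) = - \<infinity>" using zero_in_dom_phi by (simp add: phi_eq)
    then show False using evi[OF t(2,1) zero_in_dom_phi] by auto
  qed
  show ?thesis
  proof (rule flow.EVI_characterizes_S[OF x _ _ _ _ gD _ t])
    show "negligible N" using N by (simp add: negligible_iff_null_sets null_sets_completionI)
    show "\<exists>d. ((\<lambda>s. (norm (g s - v))\<^sup>2) has_real_derivative d) (at t) \<and>
        1 / 2 * d + lam / 2 * (norm (g t - v))\<^sup>2 \<le> energy v - energy (g t)"
      if "0 < t" "t \<notin> N" "v \<in> dom_phi" for t v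
      using evi[OF that(2,1,3)] gD[OF that(1,2)] that(3) by (simp add: phi_eq)
  qed (use g in \<open>auto simp: EVI_solution_def\<close>)
qed

lemma is_arg_min_phi_iff: "is_arg_min phi (\<lambda>w. w \<in> H) v \<longleftrightarrow> v = 0"
proof
  assume "is_arg_min phi (\<lambda>w. w \<in> H) v"
  then have "phi v \<le> phi 0" using flow.in_H[OF zero_in_dom_phi] by (simp add: is_arg_min_linorder)
  then have v: "v \<in> dom_phi" "energy v \<le> energy 0" using zero_in_dom_phi by (auto simp: phi_eq split: if_splits)
  then have "lam / 2 * (norm v)\<^sup>2 \<le> 0" using flow.growth[OF v(1)] by linarith
  then show "v = 0" using lam_pos by (simp add: mult_le_0_iff)
next
  assume "v = 0"
  then show "is_arg_min phi (\<lambda>w. w \<in> H) v"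
    using zero_in_dom_phi flow.in_H[OF zero_in_dom_phi] flow.min_0 by (auto simp: is_arg_min_linorder phi_eq)
qed

text \<open>Growth at the minimizer bounds \<open>lam / 2 * (norm x)\<^sup>2\<close> by the initial
  excess energy, and squaring \<open>S_decay\<close> doubles the rate. Any positive
  \<open>t0\<close> serves, as it only enlarges the right-hand side; for infinite
  \<open>phi x\<close> that side is infinite.\<close>

lemma S_exponential_decay:
  assumes x: "x \<in> H" and t0: "0 < t0" and t: "t0 \<le> t"
  shows "ereal (lam / 2 * (norm (flow.S t x))\<^sup>2) \<le> (phi x - phi 0) * ereal (exp (- 2 * lam * (t - t0)))"
proof (cases "x \<in> dom_phi")
  case True
  have "norm (flow.S t x) \<le> exp (- lam * t) * norm x" using flow.S_decay[OF x] t0 t by simp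
  then have "(norm (flow.S t x))\<^sup>2 \<le> (exp (- lam * t) * norm x)\<^sup>2" by (rule power_mono) simp
  also have "\<dots> = exp (- 2 * lam * t) * (norm x)\<^sup>2"
    by (simp add: power_mult_distrib flip: exp_double)
  finally have "lam / 2 * (norm (flow.S t x))\<^sup>2 \<le> lam / 2 * (exp (- 2 * lam * t) * (norm x)\<^sup>2)"
    using lam_pos by (intro mult_left_mono) auto
  also have "\<dots> = (lam / 2 * (norm x)\<^sup>2) * exp (- 2 * lam * t)" by simp
  also have "\<dots> \<le> (energy x - energy 0) * exp (- 2 * lam * (t - t0))"
    using flow.growth[OF True] flow.min_0[OF True] lam_pos t0 by (intro mult_mono) auto
  finally show ?thesis using True zero_in_dom_phi by (simp add: phi_eq)
next
  case False
  then show ?thesis using zero_in_dom_phi by (simp add: phi_eq)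
qed

theorem proposition3p5:
  fixes h0 :: l2
  assumes "h0 \<in> H"
  shows "\<exists>h :: real \<Rightarrow> l2.
    (h 0 = h0 \<and> continuous_on {0..} h \<and>
      (\<forall>a b. 0 < a \<longrightarrow> a \<le> b \<longrightarrow> (\<exists>C. C-lipschitz_on {a..b} h)) \<and>
      h \<in> MM h0 \<and>
      (\<forall>t>0. (\<lambda>n. (resolvent (t / real n) ^^ n) h0) \<longlonglongrightarrow> h t) \<and>
      EVI_solution h0 h \<and>
      (\<forall>g. EVI_solution h0 g \<longrightarrow> (\<forall>t>0. g t = h t))) \<and>
    (\<forall>t>0. (\<forall>v\<in>dom_phi. phi (h t) \<le> phi v + ereal (1 / (2 * t) * (norm (v - h0))\<^sup>2)) \<and>
      (\<forall>v\<in>dom_slope. (slope (h t))\<^sup>2 \<le> (slope v)\<^sup>2 + ereal (1 / t\<^sup>2 * (norm (v - h0))\<^sup>2))) \<and>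
    (\<forall>v. is_arg_min phi (\<lambda>w. w \<in> H) v \<longleftrightarrow> v = 0) \<and>
    (\<exists>t0>0. \<forall>t\<ge>t0. ereal (lam / 2 * (norm (h t - 0))\<^sup>2)
        \<le> (phi h0 - phi 0) * ereal (exp (- 2 * lam * (t - t0))))"
proof (intro exI[of _ "\<lambda>t. flow.S t h0"] conjI allI impI ballI)
  show "flow.S 0 h0 = h0" by simp
  have lip: "(flow.minslope (flow.S a h0))-lipschitz_on {a..b} (\<lambda>t. flow.S t h0)" if "0 < a" for a b
    using that flow.slope_boundD(2)[OF flow.slope_bound_S[OF assms that]] flow.S_lipschitz[OF assms that]
    by (auto simp: lipschitz_on_def dist_norm)
  show "\<exists>C. C-lipschitz_on {a..b} (\<lambda>t. flow.S t h0)" if "0 < a" for a b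
    using lip[OF that] by blast
  \<comment> \<open>The Lipschitz constants are available at positive times; at zero the initial
    limit takes over.\<close>
  show "continuous_on {0..} (\<lambda>t. flow.S t h0)"
    unfolding continuous_on_eq_continuous_within
  proof
    fix t :: real assume "t \<in> {0..}"
    then consider "t = 0" | "0 < t" by force
    then show "continuous (at t within {0..}) (\<lambda>t. flow.S t h0)"
    proof cases
      case 1
      then show ?thesis
        using flow.S_tendsto_initial[OF assms] by (simp add: continuous_within at_within_Ici_at_right)
    next
      case 2
      have "continuous_on {t / 2..2 * t} (\<lambda>t. flow.S t h0)"
        by (rule lipschitz_on_continuous_on[OF lip]) (use 2 in simp)
      then have "isCont (\<lambda>t. flow.S t h0) t"
        using 2 by (intro continuous_on_interior) (auto simp: interior_atLeastAtMost_real)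
      then show ?thesis by (rule continuous_at_imp_continuous_within)
    qed
  qed
  show "(\<lambda>t. flow.S t h0) \<in> MM h0" by (rule S_in_MM[OF assms])
  show "(\<lambda>n. (resolvent (t / real n) ^^ n) h0) \<longlonglongrightarrow> flow.S t h0" if t: "0 < t" for t
  proof (rule Lim_transform_eventually[OF flow.S_LIMSEQ(1)[OF assms t]])
    show "\<forall>\<^sub>F n in sequentially. (flow.J (t / real n) ^^ n) h0 = (resolvent (t / real n) ^^ n) h0"
      using eventually_gt_at_top[of 0] by eventually_elim (use t assms in \<open>simp add: resolvent_iterate_eq\<close>)
  qed
  show "EVI_solution h0 (\<lambda>t. flow.S t h0)" by (rule S_EVI_solution[OF assms])
  show "g t = flow.S t h0" if "EVI_solution h0 g" "0 < t" for g t
    by (rule EVI_solution_unique[OF assms that])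
  show "phi (flow.S t h0) \<le> phi v + ereal (1 / (2 * t) * (norm (v - h0))\<^sup>2)" if t: "0 < t" and v: "v \<in> dom_phi" for t v
  proof -
    note est = flow.S_energy_estimate[OF assms t v]
    have "t * energy (flow.S t h0) \<le> t * (energy v + 1 / (2 * t) * (norm (v - h0))\<^sup>2)"
    proof -
      have "t * (1 / (2 * t) * (norm (v - h0))\<^sup>2) = (norm (h0 - v))\<^sup>2 / 2"
        using t by (simp add: norm_minus_commute)
      then show ?thesis
        using est(2) zero_le_power2[of "norm (flow.S t h0 - v)"] unfolding distrib_left by linarith
    qed
    then have "energy (flow.S t h0) \<le> energy v + 1 / (2 * t) * (norm (v - h0))\<^sup>2"
      using t by (simp only: mult_le_cancel_left_pos)
    then show ?thesis using est(1) v by (simp add: phi_eq)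
  qed
  show "(slope (flow.S t h0))\<^sup>2 \<le> (slope v)\<^sup>2 + ereal (1 / t\<^sup>2 * (norm (v - h0))\<^sup>2)" if "0 < t" "v \<in> dom_slope" for t v
    by (rule slope_regularizing[OF assms that])
  show "is_arg_min phi (\<lambda>w. w \<in> H) v \<longleftrightarrow> v = 0" for v by (rule is_arg_min_phi_iff)
  show "\<exists>t0>0. \<forall>t\<ge>t0. ereal (lam / 2 * (norm (flow.S t h0 - 0))\<^sup>2)
        \<le> (phi h0 - phi 0) * ereal (exp (- 2 * lam * (t - t0)))"
    using S_exponential_decay[OF assms zero_less_one] by (intro exI[of _ 1]) simp
qed

end
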